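(* Let $G$ be a graph on $n$ vertices that has a partition of $V(G)$ into sets $L$, $H$, $R$ such that $|L| \geq \frac{1}{60}\cdot n$, every vertex in $L$ has strictly fewer than $14$ neighbors outside $H$, and $|H| \leq \frac{1}{10^4}\cdot n$. Then $G$ has at most $2^{n(1-10^{-50})}$ minimal connected dominating sets. Further, there is an algorithm that, given as input $G$ together with the partition $(L,H,R)$, enumerates all minimal connected dominating sets of $G$ in time $2^{n(1-10^{-50})}\cdot n^{\mathcal{O}(1)}$.
   Context: All graphs are finite and simple. A vertex subset $S$ of $G$ is a dominating set if every vertex not in $S$ has a neighbor in $S$; it is a connected dominating set if moreover $G[S]$ is connected; a connected dominating set is minimal if no proper subset of it is a connected dominating set. *)

theory Defs
  imports Complex_Main "Graph_Theory.Graph_Theory"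
begin

section \<open>Connected dominating sets\<close>

text \<open>
  A finite simple graph is a \<open>pair_graph\<close>: a finite, loop-free, symmetric digraph whose
  arcs are pairs of vertices.
\<close>

definition dominating_set :: "'a pair_pre_digraph \<Rightarrow> 'a set \<Rightarrow> bool" where
  "dominating_set G S \<longleftrightarrow>
     S \<subseteq> pverts G \<and> (\<forall>v \<in> pverts G - S. \<exists>u \<in> S. (v, u) \<in> parcs G)"

text \<open>The library's \<open>connected\<close> requires a nonempty vertex set.\<close>

definition connected_dominating_set :: "'a pair_pre_digraph \<Rightarrow> 'a set \<Rightarrow> bool" where
  "connected_dominating_set G S \<longleftrightarrow>
     dominating_set G S \<and> Digraph_Component.connected (with_proj G \<restriction> S)"

definition minimal_connected_dominating_set :: "'a pair_pre_digraph \<Rightarrow> 'a set \<Rightarrow> bool" where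
  "minimal_connected_dominating_set G S \<longleftrightarrow>
     connected_dominating_set G S \<and> (\<forall>T. T \<subset> S \<longrightarrow> \<not> connected_dominating_set G T)"

definition LHR_partition ::
  "'a pair_pre_digraph \<Rightarrow> 'a set \<Rightarrow> 'a set \<Rightarrow> 'a set \<Rightarrow> bool" where
  "LHR_partition G L H R \<longleftrightarrow>
     L \<union> H \<union> R = pverts G \<and> L \<inter> H = {} \<and> L \<inter> R = {} \<and> H \<inter> R = {} \<and>
     real (card L) \<ge> 1 / 60 * real (card (pverts G)) \<and>
     (\<forall>v \<in> L. card ({u. (v, u) \<in> parcs G} - H) < 14) \<and>
     real (card H) \<le> 1 / 10 ^ 4 * real (card (pverts G))"

section \<open>Model of computation\<close>

text \<open>
  Algorithms are programs of a first-order call-by-value functional language over binary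
  trees (pure first-order LISP with a single atom). A program is a list of function bodies,
  and the function with index 0 is the main function. Variables are de Bruijn indices into
  the environment. Running time counts one unit for each evaluation of an expression node.
  As the arities and the environment lengths are bounded by the program, each unit is a
  constant number of pointer operations (copy, allocate a cell, select a component, test
  for the atom, call, return). Conversely the tapes of a Turing machine are pairs of lists,
  so each step of a multi-tape machine takes a constant number of units.
  There is no arithmetic, so no unit of time can hide work on large numbers.
\<close>

datatype sexp = Atom | Pair sexp sexp

datatype expr =
    Var nat
  | AtomE
  | PairE expr expr
  | FstE expr
  | SndE expr
  | IfE expr expr expr
  | LetE expr expr
  | CallE nat "expr list"

type_synonym program = "expr list"

fun fst_sexp :: "sexp \<Rightarrow> sexp" where
  "fst_sexp Atom = Atom"
| "fst_sexp (Pair a b) = a"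

fun snd_sexp :: "sexp \<Rightarrow> sexp" where
  "snd_sexp Atom = Atom"
| "snd_sexp (Pair a b) = b"

text \<open>
  \<open>eval P env e v t\<close>: in program \<open>P\<close> and environment \<open>env\<close>, the expression \<open>e\<close> evaluates
  to \<open>v\<close> in time \<open>t\<close>. Conditionals treat \<open>Atom\<close> as false and every pair as true.
\<close>

inductive
  eval :: "program \<Rightarrow> sexp list \<Rightarrow> expr \<Rightarrow> sexp \<Rightarrow> nat \<Rightarrow> bool" and
  evals :: "program \<Rightarrow> sexp list \<Rightarrow> expr list \<Rightarrow> sexp list \<Rightarrow> nat \<Rightarrow> bool"
  for P :: program
where
  eval_Var: "i < length env \<Longrightarrow> eval P env (Var i) (env ! i) 1"
| eval_Atom: "eval P env AtomE Atom 1"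
| eval_Pair: "eval P env e1 v1 t1 \<Longrightarrow> eval P env e2 v2 t2 \<Longrightarrow>
    eval P env (PairE e1 e2) (Pair v1 v2) (t1 + t2 + 1)"
| eval_Fst: "eval P env e v t \<Longrightarrow> eval P env (FstE e) (fst_sexp v) (t + 1)"
| eval_Snd: "eval P env e v t \<Longrightarrow> eval P env (SndE e) (snd_sexp v) (t + 1)"
| eval_IfTrue: "eval P env b (Pair x y) t1 \<Longrightarrow> eval P env e1 v t2 \<Longrightarrow>
    eval P env (IfE b e1 e2) v (t1 + t2 + 1)"
| eval_IfFalse: "eval P env b Atom t1 \<Longrightarrow> eval P env e2 v t2 \<Longrightarrow>
    eval P env (IfE b e1 e2) v (t1 + t2 + 1)"
| eval_Let: "eval P env e1 v1 t1 \<Longrightarrow> eval P (v1 # env) e2 v2 t2 \<Longrightarrow>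
    eval P env (LetE e1 e2) v2 (t1 + t2 + 1)"
| eval_Call: "f < length P \<Longrightarrow> evals P env es vs t1 \<Longrightarrow> eval P vs (P ! f) v t2 \<Longrightarrow>
    eval P env (CallE f es) v (t1 + t2 + 1)"
| evals_Nil: "evals P env [] [] 0"
| evals_Cons: "eval P env e v t1 \<Longrightarrow> evals P env es vs t2 \<Longrightarrow>
    evals P env (e # es) (v # vs) (t1 + t2)"

inductive_cases eval_VarE: "eval P env (Var i) v t"
inductive_cases eval_AtomE: "eval P env AtomE v t"
inductive_cases eval_PairE: "eval P env (PairE e1 e2) v t"
inductive_cases eval_FstE: "eval P env (FstE e) v t"
inductive_cases eval_SndE: "eval P env (SndE e) v t"
inductive_cases eval_IfE: "eval P env (IfE b e1 e2) v t"
inductive_cases eval_LetE: "eval P env (LetE e1 e2) v t"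
inductive_cases eval_CallE: "eval P env (CallE f es) v t"
inductive_cases evals_NilE: "evals P env [] vs t"
inductive_cases evals_ConsE: "evals P env (e # es) vs t"

lemma eval_deterministic:
  "eval P env e v t \<Longrightarrow> eval P env e v' t' \<Longrightarrow> v' = v \<and> t' = t"
  "evals P env es vs t \<Longrightarrow> evals P env es vs' t' \<Longrightarrow> vs' = vs \<and> t' = t"
proof (induction arbitrary: v' t' and vs' t' rule: eval_evals.inducts)
  case eval_Var
  from eval_Var.prems show ?case
    by (elim eval_VarE) (auto)
next
  case eval_Atom
  from eval_Atom.prems show ?case
    by (elim eval_AtomE) (auto)
next
  case eval_Pair
  from eval_Pair.prems show ?case
    by (elim eval_PairE) (metis Suc_eq_plus1 eval_Pair.IH)+
next
  case eval_Fst
  from eval_Fst.prems show ?case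
    by (elim eval_FstE) (metis Suc_eq_plus1 eval_Fst.IH)+
next
  case eval_Snd
  from eval_Snd.prems show ?case
    by (elim eval_SndE) (metis Suc_eq_plus1 eval_Snd.IH)+
next
  case eval_IfTrue
  from eval_IfTrue.prems show ?case
    by (elim eval_IfE) (metis Suc_eq_plus1 eval_IfTrue.IH sexp.distinct)+
next
  case eval_IfFalse
  from eval_IfFalse.prems show ?case
    by (elim eval_IfE) (metis Suc_eq_plus1 eval_IfFalse.IH sexp.distinct)+
next
  case eval_Let
  from eval_Let.prems show ?case
    by (elim eval_LetE) (metis Suc_eq_plus1 eval_Let.IH)+
next
  case eval_Call
  from eval_Call.prems show ?case
    by (elim eval_CallE) (metis Suc_eq_plus1 eval_Call.IH)+
next
  case evals_Nil
  from evals_Nil.prems show ?case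
    by (elim evals_NilE) (auto)
next
  case evals_Cons
  from evals_Cons.prems show ?case
    by (elim evals_ConsE) (metis Suc_eq_plus1 evals_Cons.IH)+
qed

definition runs_in_time :: "program \<Rightarrow> sexp \<Rightarrow> sexp \<Rightarrow> nat \<Rightarrow> bool" where
  "runs_in_time P x y t \<longleftrightarrow> P \<noteq> [] \<and> eval P [x] (P ! 0) y t"

section \<open>Encoding of inputs and outputs\<close>

definition enc_bool :: "bool \<Rightarrow> sexp" where
  "enc_bool b = (if b then Pair Atom Atom else Atom)"

definition enc_list :: "sexp list \<Rightarrow> sexp" where
  "enc_list xs = foldr Pair xs Atom"

definition enc_set :: "nat \<Rightarrow> nat set \<Rightarrow> sexp" where
  "enc_set n S = enc_list (map (\<lambda>v. enc_bool (v \<in> S)) [0..<n])"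

text \<open>
  For a graph with vertex set \<open>{0..<n}\<close>, the input consists of the adjacency matrix and
  the characteristic vectors of the three parts.
\<close>

definition enc_input ::
  "nat \<Rightarrow> nat pair_pre_digraph \<Rightarrow> nat set \<Rightarrow> nat set \<Rightarrow> nat set \<Rightarrow> sexp" where
  "enc_input n G L H R = enc_list
     [enc_list (map (\<lambda>u. enc_set n {v. (u, v) \<in> parcs G}) [0..<n]),
      enc_set n L, enc_set n H, enc_set n R]"

text \<open>
  The output lists every member of the family exactly once, in any order, each as a
  characteristic vector.
\<close>

definition enumeration_of :: "nat \<Rightarrow> nat set set \<Rightarrow> sexp \<Rightarrow> bool" where
  "enumeration_of n F y \<longleftrightarrow>
     (\<exists>Ss. distinct Ss \<and> set Ss = F \<and> y = enc_list (map (enc_set n) Ss))"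

end

theory Submission
  imports Defs
begin

text \<open>
  Let \<open>S\<close> be a minimal connected dominating set and \<open>K \<subseteq> S\<close>, and write \<open>N(K)\<close> for the set of
  vertices with a neighbour in \<open>K\<close>. All but \<open>2|K|\<close> of the vertices \<open>v \<in> S \<inter> N(K) - K\<close> are not needed
  to keep \<open>K\<close> connected. Minimality charges each of them to its own vertex outside \<open>S\<close> with exactly
  one neighbour in \<open>S\<close>: a private neighbour of \<open>v\<close>, or a private neighbour of a non-cut vertex that
  \<open>v\<close> separates from \<open>K\<close>. Hence \<open>|S \<inter> N(K)| \<le> 3|K| + |{p \<notin> S \<union> N(K). |N(p) \<inter> S| = 1}|\<close>.

  Apply this with \<open>K = S \<inter> H'\<close>, where \<open>H' \<supseteq> H\<close> is slightly larger than \<open>H\<close> and chosen such that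
  the neighbourhoods outside \<open>H'\<close>, truncated to 14 vertices, overlap boundedly. A vertex of low degree
  outside \<open>H'\<close> is either not dominated by \<open>K\<close>, and then undominated by a random \<open>S\<close> with constant
  probability, or it contributes to the left-hand side with probability one half; the vertices of
  degree at least 14 rarely contribute to the right-hand side. By a bounded differences inequality
  all but an exponentially small fraction of the sets \<open>S\<close> violate domination or the inequality.

  For the algorithm fix a small linear-size subset \<open>W\<close> of \<open>L\<close>. Both conditions have versions that
  depend only on \<open>S' = S - W\<close>. Enumerating all \<open>S' \<subseteq> V - W\<close> costs \<open>2\<^bsup>n - |W|\<^esup>\<close>, and only the few
  \<open>S'\<close> that satisfy the conditions are extended by all subsets of \<open>W\<close>. The set \<open>H'\<close> is not computed:
  a greedily chosen \<open>K\<close> is nearly as good. For \<open>n \<le> 10\<^sup>5\<^sup>0\<close> the bounds hold because minimal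
  connected dominating sets form an antichain, and because the constant factor absorbs \<open>2\<^sup>n\<close>.
\<close>

section \<open>Connected dominating sets of a symmetric relation\<close>

text \<open>\<open>E\<close> contains both orientations of every edge in all applications, so
  directed reachability inside \<open>S\<close> is connectivity of the induced subgraph. The
  agreement with the library's notion, including nonemptiness, is
  \<open>connected_induced_iff_conn\<close>.\<close>

definition conn :: "('a \<times> 'a) set \<Rightarrow> 'a set \<Rightarrow> bool" where
  "conn E S \<longleftrightarrow> S \<noteq> {} \<and> (\<forall>u\<in>S. \<forall>v\<in>S. (u, v) \<in> (E \<inter> S \<times> S)\<^sup>*)"

definition cds :: "'a set \<Rightarrow> ('a \<times> 'a) set \<Rightarrow> 'a set \<Rightarrow> bool" where
  "cds V E S \<longleftrightarrow> S \<subseteq> V \<and> V - S \<subseteq> E `` S \<and> conn E S"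

definition mcds :: "'a set \<Rightarrow> ('a \<times> 'a) set \<Rightarrow> 'a set \<Rightarrow> bool" where
  "mcds V E S \<longleftrightarrow> cds V E S \<and> (\<forall>T. T \<subset> S \<longrightarrow> \<not> cds V E T)"

text \<open>Asking for at most one neighbour instead of exactly one makes this set grow when
  \<open>S\<close> shrinks. It can thus be computed from a known part of a solution and still
  contains all nonmembers with a single neighbour in the whole solution.\<close>

definition sparse_nonmembers :: "'a set \<Rightarrow> ('a \<times> 'a) set \<Rightarrow> 'a set \<Rightarrow> 'a set" where
  "sparse_nonmembers V E S = {p \<in> V - S. card (E `` {p} \<inter> S) \<le> 1}"

section \<open>Connectivity and domination inside a vertex subset\<close>

lemma rtrancl_leaves_set:
  assumes "(x, y) \<in> r\<^sup>*" "x \<in> T" "y \<notin> T"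
  shows "\<exists>a b. (a, b) \<in> r \<and> a \<in> T \<and> b \<notin> T"
  using assms by (induction rule: rtrancl_induct) blast+

lemma rtrancl_restrict_mono:
  assumes "(u, v) \<in> (E \<inter> S \<times> S)\<^sup>*" "S \<subseteq> T"
  shows "(u, v) \<in> (E \<inter> T \<times> T)\<^sup>*"
  using assms by (meson Int_mono Sigma_mono order_refl rtrancl_mono subsetD)

locale fin_graph =
  fixes V :: "'a set" and E :: "('a \<times> 'a) set"
  assumes finite_V: "finite V"
    and E_sub: "E \<subseteq> V \<times> V"
    and sym_E: "sym E"
    and irrefl_E: "(v, v) \<notin> E"
begin

lemma E_swap: "(u, v) \<in> E \<Longrightarrow> (v, u) \<in> E"
  using sym_E by (auto dest: symD)

lemma conn_sym: "(u, v) \<in> (E \<inter> S \<times> S)\<^sup>* \<Longrightarrow> (v, u) \<in> (E \<inter> S \<times> S)\<^sup>*"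
proof -
  have "sym (E \<inter> S \<times> S)" using sym_E by (auto simp: sym_def)
  then show "(u, v) \<in> (E \<inter> S \<times> S)\<^sup>* \<Longrightarrow> (v, u) \<in> (E \<inter> S \<times> S)\<^sup>*"
    by (meson sym_rtrancl symD)
qed

lemma finite_subset_V: "S \<subseteq> V \<Longrightarrow> finite S"
  using finite_V finite_subset by blast

lemma finite_Image: "finite (E `` X)"
  by (rule finite_subset[OF _ finite_V]) (use E_sub in auto)

lemma connI_root:
  assumes "r \<in> S" "\<And>v. v \<in> S \<Longrightarrow> (r, v) \<in> (E \<inter> S \<times> S)\<^sup>*"
  shows "conn E S"
  unfolding conn_def using assms conn_sym by (metis empty_iff rtrancl_trans)

lemma conn_insert:
  assumes "conn E T" "x \<in> T" "(x, y) \<in> E"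
  shows "conn E (insert y T)"
proof (rule connI_root[of x])
  show "x \<in> insert y T" using assms by simp
  fix v assume v: "v \<in> insert y T"
  show "(x, v) \<in> (E \<inter> insert y T \<times> insert y T)\<^sup>*"
  proof (cases "v \<in> T")
    case True
    then have "(x, v) \<in> (E \<inter> T \<times> T)\<^sup>*" using assms by (simp add: conn_def)
    then show ?thesis by (rule rtrancl_restrict_mono) blast
  next
    case False
    then show ?thesis using v assms by auto
  qed
qed

lemma conn_boundary_edge:
  assumes "conn E S" "T \<subset> S" "T \<noteq> {}"
  shows "\<exists>x y. x \<in> T \<and> y \<in> S - T \<and> (x, y) \<in> E"
proof -
  obtain t s where "t \<in> T" "s \<in> S" "s \<notin> T" using assms by blast
  moreover have "(t, s) \<in> (E \<inter> S \<times> S)\<^sup>*" using assms calculation by (auto simp: conn_def)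
  ultimately show ?thesis using rtrancl_leaves_set[of t s _ T] by blast
qed

text \<open>Enlarging \<open>T\<close> across boundary edges keeps it connected; the vertex added
  last is one whose removal leaves \<open>S\<close> connected.\<close>

lemma conn_delete_one:
  assumes "finite S" "conn E S" "T \<subset> S" "conn E T"
  shows "\<exists>u\<in>S - T. conn E (S - {u})"
  using assms(3,4)
proof (induction "card (S - T)" arbitrary: T rule: less_induct)
  case less
  have "T \<noteq> {}" using less.prems by (simp add: conn_def)
  then obtain x y where xy: "x \<in> T" "y \<in> S - T" "(x, y) \<in> E"
    using conn_boundary_edge[OF assms(2) less.prems(1)] by blast
  show ?case
  proof (cases "insert y T = S")
    case True
    then have "S - {y} = T" using xy by auto
    then show ?thesis using less.prems xy by metis
  next
    case False
    then have s: "insert y T \<subset> S" using xy less.prems by auto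
    have "card (S - insert y T) < card (S - T)"
      using xy assms(1) by (intro psubset_card_mono) auto
    from less.hyps[OF this s conn_insert[OF less.prems(2) xy(1,3)]]
    show ?thesis by blast
  qed
qed

text \<open>Every added vertex hangs on \<open>T\<close> by an edge, because \<open>T\<close>
  dominates. Consequently minimality is decided by deleting single vertices, as
  \<open>mcds_iff\<close> records.\<close>

lemma cds_superset:
  assumes "cds V E T" "T \<subseteq> S" "S \<subseteq> V"
  shows "cds V E S"
proof -
  obtain r where r: "r \<in> T" using assms by (auto simp: cds_def conn_def)
  have "conn E S"
  proof (rule connI_root[of r])
    show "r \<in> S" using r assms by auto
    fix v assume v: "v \<in> S"
    have T: "(r, w) \<in> (E \<inter> S \<times> S)\<^sup>*" if "w \<in> T" for w
    proof -
      have "(r, w) \<in> (E \<inter> T \<times> T)\<^sup>*" using that r assms by (auto simp: cds_def conn_def)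
      then show ?thesis using assms(2) by (rule rtrancl_restrict_mono)
    qed
    show "(r, v) \<in> (E \<inter> S \<times> S)\<^sup>*"
    proof (cases "v \<in> T")
      case False
      then obtain w where "w \<in> T" "(w, v) \<in> E" using v assms by (auto simp: cds_def)
      then show ?thesis using T[of w] v assms
        by (meson IntI SigmaI rtrancl.rtrancl_into_rtrancl subsetD)
    qed (rule T)
  qed
  moreover have "V - S \<subseteq> E `` S" using assms unfolding cds_def by blast
  ultimately show ?thesis using assms by (auto simp: cds_def)
qed

lemma mcds_iff:
  "mcds V E S \<longleftrightarrow> cds V E S \<and> (\<forall>v\<in>S. \<not> cds V E (S - {v}))"
proof
  assume "mcds V E S" then show "cds V E S \<and> (\<forall>v\<in>S. \<not> cds V E (S - {v}))"
    unfolding mcds_def by (metis Diff_iff Diff_subset insertI1 psubsetI)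
next
  assume a: "cds V E S \<and> (\<forall>v\<in>S. \<not> cds V E (S - {v}))"
  have False if "T \<subset> S" "cds V E T" for T
  proof -
    obtain v where "v \<in> S" "v \<notin> T" using \<open>T \<subset> S\<close> by blast
    then have "cds V E (S - {v})"
      using cds_superset[of T "S - {v}"] that a by (auto simp: cds_def)
    then show False using a \<open>v \<in> S\<close> by blast
  qed
  then show "mcds V E S" using a by (auto simp: mcds_def)
qed

section \<open>Private neighbours and the coverage inequality\<close>

text \<open>\<open>lab\<close> assigns the vertices of \<open>K\<close> and of its neighbourhood to
  terminals in \<open>K\<close>. On a path inside \<open>S\<close> from \<open>M\<close> to
  \<open>K - M\<close>, two consecutive labelled vertices have labels on opposite sides; between
  them the path stays away from \<open>K\<close> and its neighbours.\<close>

lemma linking_pair: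
  assumes "conn E S" "K \<subseteq> S" "M \<subset> K" "M \<noteq> {}"
    and lab: "\<And>x. x \<in> K \<Longrightarrow> lab x = x" "\<And>x. x \<in> E `` K \<Longrightarrow> lab x \<in> K"
  shows "\<exists>x y z. x \<in> S \<inter> (K \<union> E `` K) \<and> y \<in> S \<inter> (K \<union> E `` K) \<and> lab x \<in> M \<and> lab y \<in> K - M \<and>
    (x, z) \<in> (E \<inter> S \<times> (S - (K \<union> E `` K)))\<^sup>* \<and> (z, y) \<in> E" (is "?goal")
proof (rule ccontr)
  assume neg: "\<not> ?goal"
  obtain k k' where k: "k \<in> M" "k' \<in> K - M" using assms by blast
  have "k \<in> S" "k' \<in> S" using k assms by auto
  then have "(k, k') \<in> (E \<inter> S \<times> S)\<^sup>*" using assms(1) unfolding conn_def by blast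
  \<comment> \<open>Invariant as long as no switch of sides occurs: the most recent labelled vertex
    on the path has its label in \<open>M\<close>. The relation restricts only the targets of its
    steps, so the start \<open>x\<close> may itself be labelled.\<close>
  then have "\<exists>x. x \<in> S \<inter> (K \<union> E `` K) \<and> lab x \<in> M \<and>
      (x, k') \<in> (E \<inter> S \<times> (S - (K \<union> E `` K)))\<^sup>*"
  proof (induction rule: rtrancl_induct)
    case base
    show ?case using k assms by (intro exI[of _ k]) auto
  next
    case (step y z)
    then obtain x where x: "x \<in> S \<inter> (K \<union> E `` K)" "lab x \<in> M"
      "(x, y) \<in> (E \<inter> S \<times> (S - (K \<union> E `` K)))\<^sup>*" by blast
    have yz: "(y, z) \<in> E" "y \<in> S" "z \<in> S" using step by auto
    show ?case
    proof (cases "z \<in> K \<union> E `` K")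
      case True
      have "lab z \<in> K" using True lab by auto
      moreover have "\<not> lab z \<in> K - M" using neg x yz True by blast
      ultimately have "lab z \<in> M" by blast
      then show ?thesis using True yz by (intro exI[of _ z]) auto
    next
      case False
      then show ?thesis using x yz
        by (intro exI[of _ x]) (auto intro: rtrancl.rtrancl_into_rtrancl)
    qed
  qed
  then obtain x where x: "x \<in> S \<inter> (K \<union> E `` K)" "lab x \<in> M"
      "(x, k') \<in> (E \<inter> S \<times> (S - (K \<union> E `` K)))\<^sup>*" by blast
  from x(3) show False
  proof (cases rule: rtrancl.cases)
    case rtrancl_refl
    then show ?thesis using x k lab by auto
  next
    case (rtrancl_into_rtrancl b)
    then show ?thesis using k by auto
  qed
qed

text \<open>As in growing a spanning tree on the terminals, the vertices of \<open>K\<close> are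
  joined one at a time by the links of \<open>linking_pair\<close>. The interior of a link avoids
  the neighbourhood of \<open>K\<close>, so each join depends on at most two of its vertices, the
  ends \<open>x\<close> and \<open>y\<close>; \<open>Q\<close> collects these.\<close>

lemma few_terminal_connectors:
  assumes "conn E S" "K \<subseteq> S" "finite K"
  shows "\<exists>Q. finite Q \<and> card Q \<le> 2 * card K \<and>
    (\<forall>v\<in>S \<inter> E `` K - K - Q. \<forall>k\<in>K. \<forall>k'\<in>K. (k, k') \<in> (E \<inter> (S - {v}) \<times> (S - {v}))\<^sup>*)"
proof -
  define lab where "lab x = (if x \<in> K then x else SOME k. k \<in> K \<and> (k, x) \<in> E)" for x
  have labK: "lab x = x" if "x \<in> K" for x using that by (simp add: lab_def)
  have labE: "lab x \<in> K \<and> (lab x, x) \<in> E" if "x \<in> E `` K" "x \<notin> K" for x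
  proof -
    have "\<exists>k. k \<in> K \<and> (k, x) \<in> E" using that by auto
    from someI_ex[OF this] show ?thesis using that by (simp add: lab_def)
  qed
  have labE': "lab x \<in> K" if "x \<in> E `` K" for x using that labK labE by metis
  have "\<exists>M Q. M \<subseteq> K \<and> card M = m \<and> finite Q \<and> card Q \<le> 2 * m \<and>
    (\<forall>v\<in>S \<inter> E `` K - K - Q. \<forall>k\<in>M. \<forall>k'\<in>M. (k, k') \<in> (E \<inter> (S - {v}) \<times> (S - {v}))\<^sup>*)"
    if "m \<le> card K" for m
    using that
  proof (induction m)
    case 0
    show ?case by (intro exI[of _ "{}"]) auto
  next
    case (Suc m)
    then obtain M Q where MQ: "M \<subseteq> K" "card M = m" "finite Q" "card Q \<le> 2 * m"
      "\<And>v k k'. v \<in> S \<inter> E `` K - K - Q \<Longrightarrow> k \<in> M \<Longrightarrow> k' \<in> M \<Longrightarrow>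
         (k, k') \<in> (E \<inter> (S - {v}) \<times> (S - {v}))\<^sup>*" by auto
    show ?case
    proof (cases "M = {}")
      case True
      obtain k where "k \<in> K" using Suc.prems by fastforce
      then show ?thesis using True MQ by (intro exI[of _ "{k}"] exI[of _ "{}"]) auto
    next
      case False
      have "M \<subset> K" using MQ Suc.prems by auto
      from linking_pair[OF assms(1,2) this False labK labE']
      obtain x y z where xyz: "x \<in> S \<inter> (K \<union> E `` K)" "y \<in> S \<inter> (K \<union> E `` K)" "lab x \<in> M"
        "lab y \<in> K - M" "(x, z) \<in> (E \<inter> S \<times> (S - (K \<union> E `` K)))\<^sup>*" "(z, y) \<in> E" by blast
      let ?Q = "insert x (insert y Q)" and ?M = "insert (lab y) M"
      have fM: "finite M" using MQ assms finite_subset by blast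
      \<comment> \<open>Deleting \<open>v\<close> spares the link: its ends are in
        \<open>?Q\<close>, its interior misses the neighbourhood of \<open>K\<close>, which contains
        \<open>v\<close>, and the labels lie in \<open>K\<close>, which does not.\<close>
      have link: "(lab x, lab y) \<in> (E \<inter> (S - {v}) \<times> (S - {v}))\<^sup>*"
        if v: "v \<in> S \<inter> E `` K - K - ?Q" for v
      proof -
        let ?R = "(E \<inter> (S - {v}) \<times> (S - {v}))\<^sup>*"
        have star: "(lab w, w) \<in> ?R" if "w \<in> S \<inter> (K \<union> E `` K)" "w \<noteq> v" for w
        proof (cases "w \<in> K")
          case False
          then have "lab w \<in> K" "(lab w, w) \<in> E" using that labE by auto
          moreover from this have "lab w \<in> S - {v}" using v assms by auto
          ultimately show ?thesis using that by blast
        qed (simp add: labK)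
        from xyz(5) have "z \<in> S - {v} \<and> (x, z) \<in> ?R"
        proof (induction rule: rtrancl_induct)
          case base then show ?case using xyz v by auto
        next
          case (step a b)
          then have "b \<in> S - {v}" "(a, b) \<in> E" using v by auto
          then show ?case using step.IH by (auto intro: rtrancl.rtrancl_into_rtrancl)
        qed
        moreover have "y \<in> S - {v}" using xyz v by auto
        ultimately have "(x, y) \<in> ?R" using xyz(6) by (auto intro: rtrancl.rtrancl_into_rtrancl)
        moreover have "(lab x, x) \<in> ?R" "(lab y, y) \<in> ?R" using star xyz v by auto
        ultimately show ?thesis using conn_sym by (meson rtrancl_trans)
      qed
      have "card ?Q \<le> 2 * Suc m" using MQ by (simp add: card_insert_if)
      moreover have "card ?M = Suc m" using MQ xyz fM by simp
      moreover have "?M \<subseteq> K" using MQ xyz by auto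
      moreover have "(k, k') \<in> (E \<inter> (S - {v}) \<times> (S - {v}))\<^sup>*"
        if "v \<in> S \<inter> E `` K - K - ?Q" "k \<in> ?M" "k' \<in> ?M" for v k k'
      proof -
        have "(lab x, l) \<in> (E \<inter> (S - {v}) \<times> (S - {v}))\<^sup>*" if "l \<in> ?M" for l
          using that link[of v] MQ(5)[of v "lab x" l] xyz(3) \<open>v \<in> S \<inter> E `` K - K - ?Q\<close> by auto
        from this[OF that(2)] this[OF that(3)] show ?thesis
          using conn_sym by (meson rtrancl_trans)
      qed
      ultimately show ?thesis using MQ(3)
        by (intro exI[of _ ?M] exI[of _ ?Q]) auto
    qed
  qed
  from this[of "card K"] obtain M Q where "M \<subseteq> K" "card M = card K" "finite Q" "card Q \<le> 2 * card K"
    "\<forall>v\<in>S \<inter> E `` K - K - Q. \<forall>k\<in>M. \<forall>k'\<in>M. (k, k') \<in> (E \<inter> (S - {v}) \<times> (S - {v}))\<^sup>*" by auto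
  moreover from this have "M = K" using assms by (simp add: card_subset_eq)
  ultimately show ?thesis by blast
qed

text \<open>Let \<open>C\<close> be the component of \<open>S - {v}\<close> around \<open>K\<close>.
  Together with \<open>v\<close> it is connected but not all of \<open>S\<close>, so
  \<open>conn_delete_one\<close> finds a vertex behind \<open>v\<close> whose removal keeps
  \<open>S\<close> connected.\<close>

lemma cut_off_leaf:
  assumes fin: "finite S" and S: "conn E S" and K: "K \<subseteq> S" and v: "v \<in> S \<inter> E `` K - K"
    and K_conn: "\<forall>k\<in>K. \<forall>k'\<in>K. (k, k') \<in> (E \<inter> (S - {v}) \<times> (S - {v}))\<^sup>*"
    and disc: "\<not> conn E (S - {v})"
  shows "\<exists>u\<in>S - {v}. conn E (S - {u}) \<and> (\<forall>k\<in>K. (k, u) \<notin> (E \<inter> (S - {v}) \<times> (S - {v}))\<^sup>*)"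
proof -
  obtain k where k: "k \<in> K" "(k, v) \<in> E" using v by auto
  let ?R = "(E \<inter> (S - {v}) \<times> (S - {v}))\<^sup>*"
  define C where "C = {w \<in> S - {v}. (k, w) \<in> ?R}"
  have kS: "k \<in> S - {v}" using k K v by auto
  have kC: "k \<in> C" using kS by (simp add: C_def)
  have inC: "(k, w) \<in> (E \<inter> C \<times> C)\<^sup>*" if "(k, w) \<in> ?R" for w
    using that
  proof (induction rule: rtrancl_induct)
    case (step a b)
    then have "a \<in> C" "b \<in> C" "(a, b) \<in> E"
      by (auto simp: C_def intro: rtrancl.rtrancl_into_rtrancl)
    then show ?case using step.IH by (auto intro: rtrancl.rtrancl_into_rtrancl)
  qed simp
  have "conn E C" by (rule connI_root[OF kC]) (rule inC, simp add: C_def)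
  then have "conn E (insert v C)" using conn_insert kC k by blast
  moreover have "insert v C \<noteq> S"
  proof
    assume "insert v C = S"
    then have "S - {v} = C" by (auto simp: C_def)
    then show False using disc \<open>conn E C\<close> by simp
  qed
  moreover have "insert v C \<subseteq> S" using v by (auto simp: C_def)
  ultimately obtain u where u: "u \<in> S - insert v C" "conn E (S - {u})"
    using conn_delete_one[OF fin S, of "insert v C"] by blast
  have "(k', u) \<notin> ?R" if "k' \<in> K" for k'
  proof
    assume "(k', u) \<in> ?R"
    then have "(k, u) \<in> ?R" using K_conn k that by (meson rtrancl_trans)
    then show False using u by (auto simp: C_def)
  qed
  then show ?thesis using u by blast
qed

text \<open>Removing \<open>u\<close> keeps connectivity, so it must destroy domination. The
  undominated vertex is not \<open>u\<close>, which has the neighbour \<open>w\<close>; hence it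
  lies outside \<open>S\<close> and sees only \<open>u\<close> there.\<close>

lemma private_nonmember:
  assumes "cds V E S" "u \<in> S" "conn E (S - {u})" "\<not> cds V E (S - {u})" "w \<in> S - {u}" "(w, u) \<in> E"
  shows "\<exists>p\<in>V - S. E `` {p} \<inter> S = {u}"
proof -
  obtain p where p: "p \<in> V - (S - {u})" "p \<notin> E `` (S - {u})"
    using assms unfolding cds_def by blast
  have "p \<noteq> u" using p assms by blast
  then have "p \<in> V - S" using p by blast
  moreover from this have "p \<in> E `` S" using assms by (auto simp: cds_def)
  ultimately show ?thesis using p by (intro bexI[of _ p]) (auto dest: E_swap)
qed

text \<open>A charging argument: a vertex of \<open>B\<close> that is not a cut vertex of
  \<open>S\<close> is charged to a private neighbour of its own, a cut vertex to a private neighbour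
  of some vertex that it separates from \<open>K\<close>. The charge is injective, and at most
  \<open>|K| + |Q| <= 3|K|\<close> vertices remain uncharged.\<close>

lemma mcds_private_bound:
  assumes S: "mcds V E S" and K: "K \<subseteq> S"
  shows "card (S \<inter> E `` K) \<le> 3 * card K + card {p \<in> V - S. p \<notin> E `` K \<and> card (E `` {p} \<inter> S) = 1}"
    (is "_ \<le> _ + card ?U")
proof -
  have cS: "cds V E S" and min: "\<And>v. v \<in> S \<Longrightarrow> \<not> cds V E (S - {v})"
    using S mcds_iff by auto
  have SV: "S \<subseteq> V" and con: "conn E S" using cS by (auto simp: cds_def)
  have fS: "finite S" using SV finite_subset_V by blast
  have fK: "finite K" using K fS finite_subset by blast
  obtain Q where Q: "finite Q" "card Q \<le> 2 * card K"
    "\<And>v. v \<in> S \<inter> E `` K - K - Q \<Longrightarrow>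
      \<forall>k\<in>K. \<forall>k'\<in>K. (k, k') \<in> (E \<inter> (S - {v}) \<times> (S - {v}))\<^sup>*"
    using few_terminal_connectors[OF con K fK] by blast
  define B where "B = S \<inter> E `` K - K - Q"
  \<comment> \<open>The private neighbour charged to \<open>v\<close> belongs to some
    \<open>u\<close>, which is \<open>v\<close> itself or can be reached from \<open>K\<close>
    inside \<open>S\<close> only through \<open>v\<close>.\<close>
  define cut where "cut v u \<longleftrightarrow> u = v \<or> (u \<in> S - {v} \<and> (\<forall>k\<in>K. (k, u) \<notin> (E \<inter> (S - {v}) \<times> (S - {v}))\<^sup>*))"
    for v u
  have ex: "\<exists>p u. p \<in> ?U \<and> E `` {p} \<inter> S = {u} \<and> cut v u" if v: "v \<in> B" for v
  proof -
    obtain k where k: "k \<in> K" "(k, v) \<in> E" "k \<in> S" "k \<noteq> v" using v K by (auto simp: B_def)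
    have vS: "v \<in> S" "v \<notin> K" using v by (auto simp: B_def)
    show ?thesis
    proof (cases "conn E (S - {v})")
      case True
      from private_nonmember[OF cS vS(1) True min[OF vS(1)], of k] k
      obtain p where "p \<in> V - S" "E `` {p} \<inter> S = {v}" by auto
      moreover from this have "p \<notin> E `` K" using K vS by (auto dest: E_swap)
      ultimately have "p \<in> ?U \<and> E `` {p} \<inter> S = {v}" by simp
      moreover have "cut v v" by (simp add: cut_def)
      ultimately show ?thesis by blast
    next
      case False
      have "v \<in> S \<inter> E `` K - K" "v \<in> S \<inter> E `` K - K - Q" using v by (auto simp: B_def)
      from cut_off_leaf[OF fS con K this(1) Q(3)[OF this(2)] False]
      obtain u where u: "u \<in> S - {v}" "conn E (S - {u})"
        "\<forall>k\<in>K. (k, u) \<notin> (E \<inter> (S - {v}) \<times> (S - {v}))\<^sup>*" by blast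
      have uK: "u \<notin> K" using u by auto
      have "{u} \<subset> S" using u vS by auto
      then obtain w where "w \<in> S - {u}" "(u, w) \<in> E"
        using conn_boundary_edge[OF con, of "{u}"] by auto
      then obtain p where "p \<in> V - S" "E `` {p} \<inter> S = {u}"
        using private_nonmember[OF cS _ u(2) min, of w] u E_swap by blast
      moreover from this have "p \<notin> E `` K" using K uK by (auto dest: E_swap)
      ultimately have "p \<in> ?U \<and> E `` {p} \<inter> S = {u}" by simp
      moreover have "cut v u" unfolding cut_def using u(1,3) by blast
      ultimately show ?thesis by blast
    qed
  qed
  \<comment> \<open>Nonmember and owner are packed into a pair, so that a single choice over
    \<open>B\<close> fixes both.\<close>
  define good where "good v q \<longleftrightarrow> fst q \<in> ?U \<and> E `` {fst q} \<inter> S = {snd q} \<and> cut v (snd q)" for v q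
  have "\<forall>v\<in>B. \<exists>q. good v q" using ex by (force simp: good_def)
  from bchoice[OF this] obtain q where q: "\<forall>v\<in>B. good v (q v)" by (rule exE)
  define p u where "p v = fst (q v)" and "u v = snd (q v)" for v
  have pu: "\<forall>v\<in>B. p v \<in> ?U \<and> E `` {p v} \<inter> S = {u v} \<and> cut v (u v)"
    using q by (simp add: p_def u_def good_def)
  \<comment> \<open>Follow a path in \<open>S\<close> from \<open>x\<close> towards
    \<open>K\<close>, and let \<open>b\<close> be its first vertex in \<open>K\<close> or its
    neighbourhood. A vertex \<open>y\<close> of \<open>B\<close> that cuts off \<open>x\<close> must
    be \<open>b\<close>: otherwise \<open>x\<close> reaches \<open>b\<close> and then
    \<open>K\<close> without \<open>y\<close>; and if \<open>y\<close> is \<open>x\<close>, then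
    \<open>x\<close> already lies in the neighbourhood of \<open>K\<close>. So \<open>x\<close>
    determines \<open>v\<close>.\<close>
  have cut_unique: "v = v'" if c: "cut v x" "cut v' x" "v \<in> B" "v' \<in> B" for v v' x
  proof -
    have xS: "x \<in> S" using c by (auto simp: cut_def B_def)
    obtain k where k: "k \<in> K" using c by (auto simp: B_def)
    have "(x, k) \<in> (E \<inter> S \<times> S)\<^sup>*" using con xS k K by (auto simp: conn_def)
    then have "\<exists>b. b \<in> S \<inter> (K \<union> E `` K) \<and> (x = b \<or>
       (\<exists>a. (x, a) \<in> (E \<inter> (S - (K \<union> E `` K)) \<times> (S - (K \<union> E `` K)))\<^sup>*
         \<and> a \<in> S - (K \<union> E `` K) \<and> (a, b) \<in> E))"
    proof (induction rule: converse_rtrancl_induct)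
      case base
      then show ?case using k K by blast
    next
      case (step y z)
      then obtain b where b: "b \<in> S \<inter> (K \<union> E `` K)" "z = b \<or>
       (\<exists>a. (z, a) \<in> (E \<inter> (S - (K \<union> E `` K)) \<times> (S - (K \<union> E `` K)))\<^sup>*
         \<and> a \<in> S - (K \<union> E `` K) \<and> (a, b) \<in> E)" by blast
      have yz: "(y, z) \<in> E" "y \<in> S" "z \<in> S" using step by auto
      show ?case
      proof (cases "y \<in> K \<union> E `` K \<or> z \<in> K \<union> E `` K")
        case True then show ?thesis using yz by blast
      next
        case False
        then obtain a where "(z, a) \<in> (E \<inter> (S - (K \<union> E `` K)) \<times> (S - (K \<union> E `` K)))\<^sup>*"
         "a \<in> S - (K \<union> E `` K)" "(a, b) \<in> E" using b by blast
        moreover have "(y, z) \<in> E \<inter> (S - (K \<union> E `` K)) \<times> (S - (K \<union> E `` K))"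
          using False yz by auto
        ultimately show ?thesis using b(1) by (meson converse_rtrancl_into_rtrancl)
      qed
    qed
    then obtain b where b: "b \<in> S \<inter> (K \<union> E `` K)" "x = b \<or>
       (\<exists>a. (x, a) \<in> (E \<inter> (S - (K \<union> E `` K)) \<times> (S - (K \<union> E `` K)))\<^sup>*
         \<and> a \<in> S - (K \<union> E `` K) \<and> (a, b) \<in> E)" by blast
    have "b = y" if y: "y \<in> B" "cut y x" for y
    proof (rule ccontr)
      assume "b \<noteq> y"
      have yB: "y \<in> S" "y \<in> E `` K" "y \<notin> K" using y by (auto simp: B_def)
      have "(x, b) \<in> (E \<inter> (S - {y}) \<times> (S - {y}))\<^sup>*"
      proof (cases "x = b")
        case False
        then obtain a where a: "(x, a) \<in> (E \<inter> (S - (K \<union> E `` K)) \<times> (S - (K \<union> E `` K)))\<^sup>*"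
          "a \<in> S - (K \<union> E `` K)" "(a, b) \<in> E" using b by blast
        from a(1) have "(x, a) \<in> (E \<inter> (S - {y}) \<times> (S - {y}))\<^sup>*"
          by (rule rtrancl_restrict_mono) (use yB in auto)
        moreover have "(a, b) \<in> E \<inter> (S - {y}) \<times> (S - {y})" using a b \<open>b \<noteq> y\<close> yB by auto
        ultimately show ?thesis by (rule rtrancl.rtrancl_into_rtrancl)
      qed simp
      moreover have "\<exists>k\<in>K. (k, b) \<in> (E \<inter> (S - {y}) \<times> (S - {y}))\<^sup>*"
      proof (cases "b \<in> K")
        case False
        then obtain k where "k \<in> K" "(k, b) \<in> E" using b by auto
        then show ?thesis using K yB b \<open>b \<noteq> y\<close> by (intro bexI[of _ k]) auto
      qed auto
      ultimately have "\<exists>k\<in>K. (k, x) \<in> (E \<inter> (S - {y}) \<times> (S - {y}))\<^sup>*"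
        using conn_sym[of x b] by (blast intro: rtrancl_trans)
      then have "x = y" using y by (auto simp: cut_def)
      then have "x \<noteq> b" "x \<in> E `` K" using yB \<open>b \<noteq> y\<close> by auto
      then obtain a where a: "(x, a) \<in> (E \<inter> (S - (K \<union> E `` K)) \<times> (S - (K \<union> E `` K)))\<^sup>*"
        "a \<in> S - (K \<union> E `` K)" using b by blast
      from a(1) show False
      proof (cases rule: converse_rtranclE)
        case base then show ?thesis using a \<open>x \<in> E `` K\<close> by auto
      next
        case (step z) then show ?thesis using \<open>x \<in> E `` K\<close> by auto
      qed
    qed
    then show ?thesis using c by metis
  qed
  have "inj_on p B"
  proof (rule inj_onI)
    fix v v' assume a: "v \<in> B" "v' \<in> B" "p v = p v'"
    have "E `` {p v} \<inter> S = {u v}" "E `` {p v'} \<inter> S = {u v'}" using pu a(1,2) by blast+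
    then have "{u v} = {u v'}" using a(3) by (simp only:)
    then have "u v = u v'" by (rule singleton_inject)
    moreover have "cut v (u v)" "cut v' (u v')" using pu a by auto
    ultimately show "v = v'" using cut_unique[of v "u v" v'] a by simp
  qed
  moreover have "p ` B \<subseteq> ?U" using pu by blast
  moreover have "finite ?U" using finite_V by simp
  ultimately have "card B \<le> card ?U" by (rule card_inj_on_le)
  moreover have "card (S \<inter> E `` K) \<le> card (B \<union> (K \<union> Q))"
    using fK Q fS by (intro card_mono) (auto simp: B_def)
  moreover have "card (B \<union> (K \<union> Q)) \<le> card B + (card K + card Q)"
    by (meson card_Un_le add_left_mono order_trans)
  ultimately show ?thesis using Q(2) by linarith
qed

text \<open>The inequality about the unknown \<open>S\<close> becomes one about a known part
  \<open>S'\<close>: members can only disappear, and the nonmembers counted before are sparse for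
  \<open>S'\<close>. Adding the sparse nonmembers in the neighbourhood of \<open>K\<close> to both
  sides completes the right-hand side to all of them.\<close>

lemma mcds_coverage_bound:
  assumes S: "mcds V E S" and "S' \<subseteq> S" and K: "K \<subseteq> S'"
  shows "card (E `` K \<inter> (S' \<union> sparse_nonmembers V E S')) \<le> 3 * card K + card (sparse_nonmembers V E S')"
proof -
  let ?P = "sparse_nonmembers V E S'"
  have SV: "S \<subseteq> V" using S by (auto simp: mcds_def cds_def)
  have fP: "finite ?P" and fS: "finite S" "finite S'"
    using finite_V SV assms finite_subset_V by (auto simp: sparse_nonmembers_def)
  have sub: "{p \<in> V - S. p \<notin> E `` K \<and> card (E `` {p} \<inter> S) = 1} \<subseteq> ?P - E `` K"
  proof
    fix p assume p: "p \<in> {p \<in> V - S. p \<notin> E `` K \<and> card (E `` {p} \<inter> S) = 1}"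
    have "card (E `` {p} \<inter> S') \<le> card (E `` {p} \<inter> S)"
      using assms fS by (intro card_mono) auto
    then show "p \<in> ?P - E `` K" using p assms by (auto simp: sparse_nonmembers_def)
  qed
  have "card (S' \<inter> E `` K) \<le> card (S \<inter> E `` K)"
    using assms fS by (intro card_mono) auto
  also have "\<dots> \<le> 3 * card K + card (?P - E `` K)"
    using mcds_private_bound[OF S, of K] card_mono[OF _ sub] fP assms by fastforce
  finally have "card (S' \<inter> E `` K) + card (?P \<inter> E `` K) \<le> 3 * card K + (card (?P - E `` K) + card (?P \<inter> E `` K))"
    by simp
  also have "card (?P - E `` K) + card (?P \<inter> E `` K) = card ?P"
    using fP by (metis add.commute card_Int_Diff)
  finally have "card (S' \<inter> E `` K) + card (?P \<inter> E `` K) \<le> 3 * card K + card ?P" .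
  moreover have "E `` K \<inter> (S' \<union> ?P) = (S' \<inter> E `` K) \<union> (?P \<inter> E `` K)" by blast
  ultimately show ?thesis
    using card_Un_le[of "S' \<inter> E `` K" "?P \<inter> E `` K"] by simp
qed

end

section \<open>Concentration on the cube\<close>

text \<open>A bound on the hyperbolic cosine with a convenient rather than optimal exponent.
  Quadratic bounds serve for \<open>0 <= x <= 1\<close>; beyond that, \<open>x <= x^2\<close>
  suffices.\<close>

lemma exp_plus_exp_minus_le: "exp x + exp (- x) \<le> 2 * exp (x\<^sup>2)" for x :: real
proof -
  have pos: "exp x + exp (- x) \<le> 2 * exp (x\<^sup>2)" if "0 \<le> x" for x :: real
  proof (cases "x \<le> 1")
    case True
    have "exp x \<le> 1 + x + x\<^sup>2" using exp_bound that True by blast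
    moreover have "exp (- x) \<le> 1 - x + x\<^sup>2"
    proof -
      \<comment> \<open>The product equals \<open>1 + x^3\<close>.\<close>
      have "1 \<le> (1 - x + x\<^sup>2) * (1 + x)" using that by (simp add: algebra_simps power2_eq_square)
      also have "\<dots> \<le> (1 - x + x\<^sup>2) * exp x"
      proof (rule mult_left_mono)
        show "0 \<le> 1 - x + x\<^sup>2" using True by (simp add: add_nonneg_nonneg)
      qed (rule exp_ge_add_one_self)
      finally show ?thesis by (simp add: exp_minus field_simps)
    qed
    moreover have "1 + x\<^sup>2 \<le> exp (x\<^sup>2)" by (rule exp_ge_add_one_self)
    ultimately show ?thesis by linarith
  next
    case False
    then have "x \<le> x\<^sup>2" by (simp add: power2_eq_square)
    then have "exp x \<le> exp (x\<^sup>2)" "exp (- x) \<le> exp (x\<^sup>2)" using that by auto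
    then show ?thesis by linarith
  qed
  show ?thesis using pos[of x] pos[of "- x"] by (cases "0 \<le> x") auto
qed

lemma sum_Pow_insert:
  assumes "finite A" "a \<notin> A"
  shows "(\<Sum>T\<in>Pow (insert a A). g T) = (\<Sum>T\<in>Pow A. g T + g (insert a T) :: real)"
proof -
  have "inj_on (insert a) (Pow A)"
    using assms by (intro inj_onI) (metis PowD insert_ident subsetD)
  moreover have "Pow A \<inter> insert a ` Pow A = {}" using assms by auto
  ultimately show ?thesis using assms
    by (simp add: Pow_insert sum.union_disjoint sum.reindex sum.distrib)
qed

text \<open>One coordinate is averaged out at a time. With \<open>g\<close> the mean over coordinate
  \<open>a\<close>, the two values of \<open>f\<close> are \<open>g - d\<close> and
  \<open>g + d\<close> with \<open>|d| <= c/2\<close>, which costs a factor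
  \<open>exp (c^2/4)\<close>. Averaging preserves the difference bound, so the induction hypothesis
  applies to \<open>g\<close>.\<close>

lemma cube_mgf:
  fixes f :: "'a set \<Rightarrow> real"
  assumes "finite A" "\<And>T a. T \<subseteq> A \<Longrightarrow> a \<in> A \<Longrightarrow> a \<notin> T \<Longrightarrow> \<bar>f (insert a T) - f T\<bar> \<le> c"
  shows "(\<Sum>T\<in>Pow A. exp (f T))
    \<le> 2 ^ card A * exp ((\<Sum>T\<in>Pow A. f T) / 2 ^ card A + c\<^sup>2 / 4 * card A)"
  using assms
proof (induction A arbitrary: f rule: finite_induct)
  case empty
  then show ?case by simp
next
  case (insert a A)
  define g where "g T = (f T + f (insert a T)) / 2" for T
  have step: "exp (f T) + exp (f (insert a T)) \<le> 2 * exp (c\<^sup>2 / 4) * exp (g T)" if "T \<in> Pow A" for T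
  proof -
    define d where "d = (f (insert a T) - f T) / 2"
    have f: "f T = g T - d" "f (insert a T) = g T + d" by (auto simp: g_def d_def field_simps)
    have "\<bar>f (insert a T) - f T\<bar> \<le> c" using that insert.hyps by (intro insert.prems) auto
    then have "\<bar>d\<bar> \<le> c / 2" by (simp add: d_def)
    then have "d\<^sup>2 \<le> (c / 2)\<^sup>2" by (metis abs_ge_zero power2_abs power_mono)
    then have "exp (d\<^sup>2) \<le> exp (c\<^sup>2 / 4)" by (simp add: power_divide)
    then have "exp d + exp (- d) \<le> 2 * exp (c\<^sup>2 / 4)"
      using exp_plus_exp_minus_le[of d] by linarith
    then have "exp (g T) * (exp d + exp (- d)) \<le> exp (g T) * (2 * exp (c\<^sup>2 / 4))"
      by (intro mult_left_mono) auto
    then show ?thesis unfolding f by (simp add: exp_add exp_diff exp_minus field_simps)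
  qed
  have IH: "(\<Sum>T\<in>Pow A. exp (g T))
    \<le> 2 ^ card A * exp ((\<Sum>T\<in>Pow A. g T) / 2 ^ card A + c\<^sup>2 / 4 * card A)"
  proof (rule insert.IH)
    fix T b assume Tb: "T \<subseteq> A" "b \<in> A" "b \<notin> T"
    have "\<bar>f (insert b T) - f T\<bar> \<le> c" using Tb by (intro insert.prems) auto
    moreover have "\<bar>f (insert b (insert a T)) - f (insert a T)\<bar> \<le> c"
      using Tb insert.hyps by (intro insert.prems) auto
    ultimately show "\<bar>g (insert b T) - g T\<bar> \<le> c"
      by (simp add: g_def insert_commute abs_le_iff field_simps)
  qed
  have mean: "(\<Sum>T\<in>Pow A. g T) / 2 ^ card A = (\<Sum>T\<in>Pow (insert a A). f T) / 2 ^ card (insert a A)"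
    using insert.hyps by (simp add: sum_Pow_insert g_def flip: sum_divide_distrib)
  have "(\<Sum>T\<in>Pow (insert a A). exp (f T)) = (\<Sum>T\<in>Pow A. exp (f T) + exp (f (insert a T)))"
    using insert.hyps by (simp add: sum_Pow_insert)
  also have "\<dots> \<le> (\<Sum>T\<in>Pow A. 2 * exp (c\<^sup>2 / 4) * exp (g T))"
    by (rule sum_mono) (rule step)
  also have "\<dots> = 2 * exp (c\<^sup>2 / 4) * (\<Sum>T\<in>Pow A. exp (g T))"
    by (simp add: sum_distrib_left)
  also have "\<dots> \<le> 2 * exp (c\<^sup>2 / 4) *
      (2 ^ card A * exp ((\<Sum>T\<in>Pow A. g T) / 2 ^ card A + c\<^sup>2 / 4 * card A))"
    by (intro mult_left_mono IH) auto
  also have "\<dots> = 2 ^ card (insert a A) *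
      (exp (c\<^sup>2 / 4) * exp ((\<Sum>T\<in>Pow A. g T) / 2 ^ card A + c\<^sup>2 / 4 * card A))"
    using insert.hyps by simp
  also have "exp (c\<^sup>2 / 4) * exp ((\<Sum>T\<in>Pow A. g T) / 2 ^ card A + c\<^sup>2 / 4 * card A)
    = exp ((\<Sum>T\<in>Pow A. g T) / 2 ^ card A + c\<^sup>2 / 4 * card (insert a A))"
    using insert.hyps by (simp add: exp_add[symmetric] algebra_simps)
  finally show ?case unfolding mean .
qed

text \<open>Markov's inequality for \<open>exp (- l * f)\<close>, where \<open>l\<close> minimises
  the resulting exponent \<open>- l * g + l^2 * c^2 * n / 4\<close>.\<close>

lemma cube_lower_tail:
  fixes f :: "'a set \<Rightarrow> real"
  assumes "finite A" "\<And>T a. T \<subseteq> A \<Longrightarrow> a \<in> A \<Longrightarrow> a \<notin> T \<Longrightarrow> \<bar>f (insert a T) - f T\<bar> \<le> c"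
    and "c > 0" "real (card A) \<le> n" "n > 0" "g \<ge> 0"
    and mean: "(\<mu> + g) * 2 ^ card A \<le> (\<Sum>T\<in>Pow A. f T)"
  shows "real (card {T \<in> Pow A. f T \<le> \<mu>}) \<le> 2 ^ card A * exp (- (g\<^sup>2 / (c\<^sup>2 * n)))"
proof -
  define l where "l = 2 * g / (c\<^sup>2 * n)"
  have l: "l \<ge> 0" using assms by (simp add: l_def)
  let ?B = "{T \<in> Pow A. f T \<le> \<mu>}"
  have "real (card ?B) * exp (- l * \<mu>) = (\<Sum>T\<in>?B. exp (- l * \<mu>))" by simp
  also have "\<dots> \<le> (\<Sum>T\<in>?B. exp (- l * f T))"
    using l by (intro sum_mono) (auto simp: mult_left_mono)
  also have "\<dots> \<le> (\<Sum>T\<in>Pow A. exp (- l * f T))"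
    using assms by (intro sum_mono2) auto
  also have "\<dots> \<le> 2 ^ card A * exp ((\<Sum>T\<in>Pow A. - l * f T) / 2 ^ card A + (l * c)\<^sup>2 / 4 * card A)"
  proof (rule cube_mgf[OF assms(1)])
    fix T a assume Ta: "T \<subseteq> A" "a \<in> A" "a \<notin> T"
    have "\<bar>- l * f (insert a T) - - l * f T\<bar> = l * \<bar>f (insert a T) - f T\<bar>"
      using l by (simp add: abs_mult flip: right_diff_distrib) (simp add: abs_minus_commute)
    also have "\<dots> \<le> l * c" using assms(2)[OF Ta] l by (rule mult_left_mono)
    finally show "\<bar>- l * f (insert a T) - - l * f T\<bar> \<le> l * c" .
  qed
  also have "\<dots> \<le> 2 ^ card A * exp (- l * (\<mu> + g) + (l * c)\<^sup>2 / 4 * n)"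
  proof -
    have "(\<Sum>T\<in>Pow A. - l * f T) / 2 ^ card A = - l * ((\<Sum>T\<in>Pow A. f T) / 2 ^ card A)"
      by (simp add: sum_distrib_left sum_negf)
    moreover have "\<mu> + g \<le> (\<Sum>T\<in>Pow A. f T) / 2 ^ card A" using mean by (simp add: field_simps)
    then have "l * (\<mu> + g) \<le> l * ((\<Sum>T\<in>Pow A. f T) / 2 ^ card A)" using l by (rule mult_left_mono)
    moreover have "(l * c)\<^sup>2 / 4 * card A \<le> (l * c)\<^sup>2 / 4 * n" using assms by (intro mult_left_mono) auto
    ultimately show ?thesis by simp
  qed
  finally have "real (card ?B) * exp (- l * \<mu>) \<le>
     2 ^ card A * exp (- l * (\<mu> + g) + (l * c)\<^sup>2 / 4 * n)" .
  also have "- l * (\<mu> + g) + (l * c)\<^sup>2 / 4 * n = - l * \<mu> - g\<^sup>2 / (c\<^sup>2 * n)"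
    using assms by (simp add: l_def power2_eq_square field_simps)
  also have "exp (- l * \<mu> - g\<^sup>2 / (c\<^sup>2 * n)) = exp (- (g\<^sup>2 / (c\<^sup>2 * n))) * exp (- l * \<mu>)"
    by (simp flip: exp_add)
  finally show ?thesis by simp
qed

section \<open>Uniformly random subsets, treated by counting\<close>

lemma sum_card_swap:
  assumes "finite F" "finite A"
  shows "(\<Sum>T\<in>A. real (card {p \<in> F. \<Phi> p T})) = (\<Sum>p\<in>F. real (card {T \<in> A. \<Phi> p T}))"
proof -
  have c: "real (card {x \<in> X. Q x}) = (\<Sum>x\<in>X. if Q x then 1 else 0)" if "finite X" for X and Q :: "'c \<Rightarrow> bool"
    using that by (simp add: sum.If_cases Int_def)
  show ?thesis using assms by (simp add: c sum.swap[of _ F A])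
qed

lemma card_diff_le_card_changed:
  assumes "finite F" "card {p \<in> F. \<Phi> p \<noteq> \<Psi> p} \<le> d"
  shows "\<bar>real (card {p \<in> F. \<Phi> p}) - real (card {p \<in> F. \<Psi> p})\<bar> \<le> real d"
proof -
  have a: "card {p \<in> F. P p} \<le> card {p \<in> F. P p \<noteq> Q p} + card {p \<in> F. Q p}" for P Q
  proof -
    have "card {p \<in> F. P p} \<le> card ({p \<in> F. P p \<noteq> Q p} \<union> {p \<in> F. Q p})"
      using assms by (intro card_mono) auto
    also have "\<dots> \<le> card {p \<in> F. P p \<noteq> Q p} + card {p \<in> F. Q p}" by (rule card_Un_le)
    finally show ?thesis .
  qed
  have "{p \<in> F. \<Psi> p \<noteq> \<Phi> p} = {p \<in> F. \<Phi> p \<noteq> \<Psi> p}" by auto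
  then show ?thesis using a[of \<Phi> \<Psi>] a[of \<Psi> \<Phi>] assms(2) by simp
qed

lemma card_Pow_containing:
  assumes "finite Z" "p \<in> Z"
  shows "2 * card {T \<in> Pow Z. p \<in> T} = 2 ^ card Z"
proof -
  have "{T \<in> Pow Z. p \<in> T} = insert p ` Pow (Z - {p})"
  proof
    show "{T \<in> Pow Z. p \<in> T} \<subseteq> insert p ` Pow (Z - {p})"
    proof
      fix T assume "T \<in> {T \<in> Pow Z. p \<in> T}"
      then have "T = insert p (T - {p})" "T - {p} \<in> Pow (Z - {p})" by auto
      then show "T \<in> insert p ` Pow (Z - {p})" by blast
    qed
  qed (use assms in auto)
  moreover have "inj_on (insert p) (Pow (Z - {p}))"
    by (intro inj_onI) (metis Diff_iff PowD insertI1 insert_ident subsetD)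
  ultimately have "card {T \<in> Pow Z. p \<in> T} = 2 ^ (card Z - 1)"
    using assms by (simp add: card_image card_Pow)
  moreover have "card Z > 0" using assms card_gt_0_iff by blast
  ultimately show ?thesis by (metis Suc_diff_1 power_Suc)
qed

lemma card_Pow_avoiding:
  assumes "finite Z" "B \<subseteq> Z" "card B \<le> k"
  shows "2 ^ card Z \<le> 2 ^ k * card {T \<in> Pow Z. B \<inter> T = {}}"
proof -
  have "{T \<in> Pow Z. B \<inter> T = {}} = Pow (Z - B)" by auto
  then have "card {T \<in> Pow Z. B \<inter> T = {}} = 2 ^ (card Z - card B)"
    using assms by (simp add: card_Pow card_Diff_subset finite_subset)
  moreover have "card Z \<le> k + (card Z - card B)" using assms by simp
  then have "(2::nat) ^ card Z \<le> 2 ^ (k + (card Z - card B))" by (rule power_increasing) simp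
  ultimately show ?thesis by (simp add: power_add)
qed

text \<open>\<open>T\<close> is determined by its trace on \<open>B\<close>, with at most
  \<open>card B + 1\<close> choices, and by \<open>T - B\<close>. For \<open>b = card B\<close> this
  is a probability of at most \<open>(b + 1) / 2^b\<close>.\<close>

lemma card_Pow_meeting_once:
  assumes "finite Z" "B \<subseteq> Z"
  shows "2 ^ card B * card {T \<in> Pow Z. card (B \<inter> T) \<le> 1} \<le> (card B + 1) * 2 ^ card Z"
proof -
  have fB: "finite B" using assms finite_subset by blast
  let ?X = "{X. X \<subseteq> B \<and> card X \<le> 1}"
  have "?X \<subseteq> insert {} ((\<lambda>x. {x}) ` B)"
  proof
    fix X assume X: "X \<in> ?X"
    then have "card X = 0 \<or> card X = 1" by auto
    then show "X \<in> insert {} ((\<lambda>x. {x}) ` B)"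
      using X fB by (auto simp: card_1_singleton_iff dest: finite_subset)
  qed
  then have "card ?X \<le> card (insert {} ((\<lambda>x. {x}) ` B))" using fB by (intro card_mono) auto
  also have "\<dots> \<le> card B + 1" using fB card_image_le[OF fB, of "\<lambda>x. {x}"] by (simp add: card_insert_if)
  finally have cX: "card ?X \<le> card B + 1" .
  have "inj_on (\<lambda>T. (B \<inter> T, T - B)) {T \<in> Pow Z. card (B \<inter> T) \<le> 1}"
    by (intro inj_onI) (metis Int_Diff_Un Int_commute prod.inject)
  moreover have "(\<lambda>T. (B \<inter> T, T - B)) ` {T \<in> Pow Z. card (B \<inter> T) \<le> 1} \<subseteq> ?X \<times> Pow (Z - B)" by auto
  moreover have "finite (?X \<times> Pow (Z - B))" using assms fB by auto
  ultimately have "card {T \<in> Pow Z. card (B \<inter> T) \<le> 1} \<le> card (?X \<times> Pow (Z - B))"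
    by (rule card_inj_on_le)
  also have "\<dots> \<le> (card B + 1) * 2 ^ (card Z - card B)"
    using mult_le_mono1[OF cX] assms fB
    by (simp add: card_cartesian_product card_Pow card_Diff_subset)
  finally have "2 ^ card B * card {T \<in> Pow Z. card (B \<inter> T) \<le> 1}
    \<le> 2 ^ card B * ((card B + 1) * 2 ^ (card Z - card B))" by (rule mult_le_mono2)
  also have "\<dots> = (card B + 1) * 2 ^ (card B + (card Z - card B))" by (simp add: power_add algebra_simps)
  also have "card B + (card Z - card B) = card Z" using card_mono[OF assms] by simp
  finally show ?thesis .
qed

section \<open>Selecting neighbourhoods with bounded overlap\<close>

text \<open>\<open>F\<close> is a largest subfamily that admits truncated sets \<open>s p\<close> of
  multiplicity at most \<open>D\<close>, and \<open>X\<close> consists of the elements of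
  multiplicity exactly \<open>D\<close>. Double counting bounds \<open>X\<close>; a set outside
  \<open>F\<close> with enough elements off \<open>X\<close> could still be added.\<close>

lemma bounded_overlap_selection:
  fixes N :: "'a \<Rightarrow> 'b set"
  assumes "finite U" "\<And>p. p \<in> U \<Longrightarrow> finite (N p)" "D > 0"
  shows "\<exists>F s X. F \<subseteq> U \<and> (\<forall>p\<in>F. s p \<subseteq> N p \<and> card (s p) = min k (card (N p))) \<and>
    (\<forall>x. card {p \<in> F. x \<in> s p} \<le> D) \<and> X \<subseteq> \<Union>(N ` U) \<and> D * card X \<le> k * card U \<and>
    (\<forall>p\<in>U - F. card (N p - X) < min k (card (N p)))"
proof -
  define ok where "ok F s \<longleftrightarrow> F \<subseteq> U \<and> (\<forall>p\<in>F. s p \<subseteq> N p \<and> card (s p) = min k (card (N p))) \<and>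
    (\<forall>x. card {p \<in> F. x \<in> s p} \<le> D)" for F and s :: "'a \<Rightarrow> 'b set"
  have "ok {} (\<lambda>_. {})" by (simp add: ok_def)
  then have "\<exists>s. ok {} s" by blast
  moreover have "\<forall>F. (\<exists>s. ok F s) \<longrightarrow> card F < Suc (card U)"
    using assms by (auto simp: ok_def less_Suc_eq_le intro: card_mono)
  ultimately obtain F s where Fs: "ok F s" and max: "\<And>F' s'. ok F' s' \<Longrightarrow> card F' \<le> card F"
    using ex_has_greatest_nat[of "\<lambda>F. \<exists>s. ok F s" "{}" card "Suc (card U)"] by blast
  have FU: "F \<subseteq> U" and s: "\<And>p. p \<in> F \<Longrightarrow> s p \<subseteq> N p" "\<And>p. p \<in> F \<Longrightarrow> card (s p) = min k (card (N p))"
    and D: "\<And>x. card {p \<in> F. x \<in> s p} \<le> D" using Fs by (auto simp: ok_def)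
  have fF: "finite F" using FU assms finite_subset by blast
  define X where "X = {x \<in> \<Union>(N ` U). card {p \<in> F. x \<in> s p} = D}"
  have fX: "finite X" using assms by (simp add: X_def)
  have "real (D * card X) = (\<Sum>x\<in>X. real (card {p \<in> F. x \<in> s p}))" by (simp add: X_def)
  also have "\<dots> = (\<Sum>p\<in>F. real (card {x \<in> X. x \<in> s p}))" by (rule sum_card_swap[OF fF fX])
  also have "\<dots> \<le> (\<Sum>p\<in>F. real k)"
  proof (rule sum_mono)
    fix p assume p: "p \<in> F"
    have "finite (s p)" using s(1)[OF p] assms(2) FU p finite_subset by blast
    then have "card {x \<in> X. x \<in> s p} \<le> card (s p)" by (intro card_mono) auto
    then show "real (card {x \<in> X. x \<in> s p}) \<le> real k" using s(2)[OF p] by simp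
  qed
  also have "\<dots> = real (k * card F)" by simp
  finally have "D * card X \<le> k * card F" by linarith
  also have "\<dots> \<le> k * card U" using FU assms by (simp add: card_mono)
  finally have DX: "D * card X \<le> k * card U" .
  have "card (N p - X) < min k (card (N p))" if p: "p \<in> U - F" for p
  proof (rule ccontr)
    assume "\<not> ?thesis"
    then obtain t where t: "t \<subseteq> N p - X" "card t = min k (card (N p))"
      by (metis not_less obtain_subset_with_card_n)
    let ?s = "s(p := t)"
    have "card {q \<in> insert p F. x \<in> ?s q} \<le> D" for x
    proof (cases "x \<in> t")
      case True
      then have "x \<in> \<Union>(N ` U)" "x \<notin> X" using t p by auto
      then have "card {q \<in> F. x \<in> s q} < D" using D[of x] by (auto simp: X_def)
      moreover have "{q \<in> insert p F. x \<in> ?s q} = insert p {q \<in> F. x \<in> s q}" using True p by auto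
      ultimately show ?thesis using fF p by (simp add: card_insert_if)
    next
      case False
      then have "{q \<in> insert p F. x \<in> ?s q} = {q \<in> F. x \<in> s q}" using p by auto
      then show ?thesis using D[of x] by simp
    qed
    then have "ok (insert p F) ?s" using p FU s t by (auto simp: ok_def)
    then have "card (insert p F) \<le> card F" by (rule max)
    then show False using p fF by simp
  qed
  moreover have "X \<subseteq> \<Union>(N ` U)" by (auto simp: X_def)
  ultimately show ?thesis using FU s D DX
    by (intro exI[of _ F] exI[of _ s] exI[of _ X] conjI) blast+
qed

context fin_graph
begin

text \<open>\<open>H'\<close> minimises the potential \<open>\<Psi>\<close>, which charges
  \<open>C\<close> per deleted vertex and adds up the truncated degrees that remain. Comparison with
  \<open>H\<close> bounds the growth of \<open>H'\<close>. Comparison with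
  \<open>H' \<union> X\<close> shows that deleting \<open>X\<close> lowers few truncated degrees,
  since each drop saves at least one.\<close>

lemma saturated_superset:
  assumes "H \<subseteq> V"
  shows "\<exists>H'. H \<subseteq> H' \<and> H' \<subseteq> V \<and> C * card (H' - H) \<le> k * card V \<and>
    (\<forall>X\<subseteq>V. card {p \<in> V. min k (card (E `` {p} - H' - X)) < min k (card (E `` {p} - H'))} \<le> C * card X)"
proof -
  define \<Psi> where "\<Psi> X = C * card X + (\<Sum>p\<in>V. min k (card (E `` {p} - X)))" for X
  obtain H' where H': "H \<subseteq> H' \<and> H' \<subseteq> V" and least: "\<And>X. H \<subseteq> X \<and> X \<subseteq> V \<Longrightarrow> \<Psi> H' \<le> \<Psi> X"
    using ex_has_least_nat[of "\<lambda>X. H \<subseteq> X \<and> X \<subseteq> V" H \<Psi>] assms by auto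
  have fin: "finite H'" "finite H" using H' assms finite_subset_V by auto
  have "\<Psi> H' \<le> \<Psi> H" using least assms by blast
  also have "\<Psi> H \<le> C * card H + k * card V"
    using sum_bounded_above[of V "\<lambda>p. min k (card (E `` {p} - H))" k] by (simp add: \<Psi>_def mult.commute)
  finally have "C * card H' \<le> C * card H + k * card V" by (simp add: \<Psi>_def)
  moreover have "card H' = card H + card (H' - H)"
    using fin H' card_mono[of H' H] by (simp add: card_Diff_subset)
  ultimately have 1: "C * card (H' - H) \<le> k * card V" by (simp add: algebra_simps)
  have 2: "card {p \<in> V. min k (card (E `` {p} - H' - X)) < min k (card (E `` {p} - H'))} \<le> C * card X"
    (is "card ?B \<le> _") if X: "X \<subseteq> V" for X
  proof -
    have m: "min k (card (E `` {p} - H' - X)) + (if p \<in> ?B then 1 else 0) \<le> min k (card (E `` {p} - H'))"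
      if "p \<in> V" for p
    proof -
      have "card (E `` {p} - H' - X) \<le> card (E `` {p} - H')"
        using finite_Image by (intro card_mono) auto
      then show ?thesis using that by auto
    qed
    have "(\<Sum>p\<in>V. min k (card (E `` {p} - H' - X))) + card ?B
      = (\<Sum>p\<in>V. min k (card (E `` {p} - H' - X)) + (if p \<in> ?B then 1 else 0))"
      using finite_V by (simp add: sum.distrib sum.If_cases Int_def)
    also have "\<dots> \<le> (\<Sum>p\<in>V. min k (card (E `` {p} - H')))" by (rule sum_mono) (rule m)
    finally have "(\<Sum>p\<in>V. min k (card (E `` {p} - H' - X))) + card ?B \<le> (\<Sum>p\<in>V. min k (card (E `` {p} - H')))" .
    moreover have "\<Psi> H' \<le> \<Psi> (H' \<union> X)" using H' X by (intro least) auto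
    moreover have "C * card (H' \<union> X) \<le> C * card H' + C * card X"
      using card_Un_le[of H' X] by (metis add_mult_distrib2 mult_le_mono2)
    ultimately show ?thesis by (simp add: \<Psi>_def Diff_Un Diff_eq Int_assoc)
  qed
  show ?thesis using H' 1 2 by blast
qed

end

section \<open>Counting the sets that pass the necessary conditions\<close>

context fin_graph
begin

text \<open>
  The constants come from the greedy choice of \<open>K\<close> with threshold 23: if \<open>a\<close> vertices are covered by
  \<open>K\<close>, then \<open>23|K| \<le> a\<close> and \<open>a \<le> 3|K| + |P|\<close> give \<open>20a \<le> 23|P|\<close>, and every vertex that is not in \<open>K\<close>
  covers at most \<open>23 = 460 / 20\<close> further ones.
\<close>

definition passing :: "'a set \<Rightarrow> 'a set \<Rightarrow> bool" where
  "passing W S \<longleftrightarrow> V - (S \<union> W) \<subseteq> E `` (S \<union> W) \<and>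
    (\<forall>K\<subseteq>S. 20 * card (E `` K \<inter> (S \<union> sparse_nonmembers V E S))
      \<le> 460 * card K + 23 * card (sparse_nonmembers V E S))"

section \<open>A random set outside a fixed core rarely passes\<close>

text \<open>The condition for \<open>K = h\<close>, turned into a bound on the part of
  \<open>Lo1\<close> inside \<open>T\<close>. Sparse nonmembers in \<open>Lo1\<close> are neighbours
  of \<open>h\<close>, so they occur on both sides with weights 20 and 23 and cost only 3; all
  others lie in \<open>A\<close> and cost at most 23.\<close>

lemma passing_bound:
  assumes pass: "passing W (h \<union> T)" and V: "h \<subseteq> V" "T \<subseteq> V" and T: "T \<inter> h = {}"
    and Lo1: "Lo1 \<subseteq> E `` h" "Lo1 \<inter> h = {}"
    and cover: "sparse_nonmembers V E (h \<union> T) \<subseteq> A \<union> Lo1" and fin: "finite A" "finite Lo1"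
  shows "23 * card {p \<in> Lo1. p \<in> T} \<le> 460 * card h + 3 * card Lo1 + 23 * card A"
proof -
  let ?S = "h \<union> T"
  let ?P = "sparse_nonmembers V E ?S"
  have fP: "finite ?P" using finite_V by (simp add: sparse_nonmembers_def)
  have fT: "finite T" using V finite_subset_V by blast
  have PS: "?P \<inter> ?S = {}" by (auto simp: sparse_nonmembers_def)
  define N a b where "N = E `` h" and "a = card (?P \<inter> N)" and "b = card (?P - N)"
  define Q where "Q = ?P \<inter> Lo1"
  have "card (T \<inter> Lo1) + a = card ((T \<inter> Lo1) \<union> (?P \<inter> N))"
    unfolding a_def using PS fT fP by (intro card_Un_disjoint[symmetric]) auto
  also have "\<dots> \<le> card (N \<inter> (?S \<union> ?P))"
    using Lo1 finite_Image by (intro card_mono) (auto simp: N_def)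
  finally have "20 * (card (T \<inter> Lo1) + a) \<le> 20 * card (N \<inter> (?S \<union> ?P))" by simp
  also have "\<dots> \<le> 460 * card h + 23 * card ?P"
    using pass unfolding passing_def N_def by blast
  also have P: "card ?P = a + b" unfolding a_def b_def using fP by (rule card_Int_Diff)
  finally have 1: "20 * card (T \<inter> Lo1) \<le> 460 * card h + 3 * (a + b) + 20 * b" by simp
  define c where "c = card (?P - Q)"
  have "b \<le> c" unfolding b_def c_def Q_def using Lo1 fP by (intro card_mono) (auto simp: N_def)
  moreover have "card ?P = card Q + c"
    using card_Int_Diff[OF fP, of Lo1] by (simp add: Q_def c_def Diff_Int)
  moreover have "c \<le> card A"
    unfolding c_def using cover fin by (intro card_mono) (auto simp: Q_def)
  ultimately have "a + b = card Q + c" "b \<le> c" "c \<le> card A" using P by simp_all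
  then have 2: "3 * (a + b) + 20 * b \<le> 3 * card Q + 23 * card A" by simp
  \<comment> \<open>Members of \<open>T\<close> are not sparse nonmembers, so they drop out of the
    term \<open>3 * card Q\<close>; moving their share to the left turns the factor 20 into
    23.\<close>
  have "card Q \<le> card (Lo1 - T)"
    using fin PS by (intro card_mono) (auto simp: Q_def)
  moreover have "card Lo1 = card (T \<inter> Lo1) + card (Lo1 - T)"
    using card_Int_Diff[OF fin(2), of T] by (simp add: Int_commute)
  moreover have "{p \<in> Lo1. p \<in> T} = T \<inter> Lo1" by blast
  ultimately show ?thesis using 1 2 by simp
qed

text \<open>For a fixed trace \<open>h\<close> on \<open>H'\<close>, a passing \<open>T\<close> has
  \<open>f T <= \<mu>\<close>, while the mean of \<open>f\<close> over all \<open>T\<close> exceeds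
  \<open>\<mu>\<close> by at least \<open>n/50\<close>; the tail bound does the rest.
  \<open>F\<close> avoids \<open>W\<close> and its neighbours, so the sampled sets
  \<open>s p\<close> lie entirely in the random part \<open>Z\<close>.\<close>

lemma passing_count_fixed_core:
  assumes H': "H' \<subseteq> V" and W: "W \<subseteq> V" and h: "h \<subseteq> H' - W"
    and F: "F \<subseteq> V - H' - (W \<union> E `` W)"
    and s: "\<And>p. p \<in> F \<Longrightarrow> s p \<subseteq> E `` {p} - H'"
      "\<And>p. p \<in> F \<Longrightarrow> card (s p) = min 14 (card (E `` {p} - H'))"
    and D: "\<And>x. card {p \<in> F. x \<in> s p} \<le> 2 * 10 ^ 11"
    and V0: "card V > 0"
    and num: "483 * real (card H') + 23 * real (card (V - H' - F)) + 345 / 2 ^ 14 * card V + card V / 50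
      \<le> 8.5 * real (card {p \<in> F. card (E `` {p} - H') < 14})"
  shows "real (card {T \<in> Pow (V - W - H'). passing W (h \<union> T)})
    \<le> 2 ^ card (V - W - H') * exp (- (real (card V) / 10 ^ 38))"
proof -
  define n where "n = real (card V)"
  define Z where "Z = V - W - H'"
  define Hi where "Hi = {p \<in> F. 14 \<le> card (E `` {p} - H')}"
  define Lo where "Lo = {p \<in> F. card (E `` {p} - H') < 14}"
  define Lo0 where "Lo0 = Lo - E `` h"
  define Lo1 where "Lo1 = Lo \<inter> E `` h"
  define y where "y T = card {p \<in> Hi. card (s p \<inter> T) \<le> 1}" for T
  define z where "z T = card {u \<in> Lo0. insert u (s u) \<inter> T = {}}" for T
  define a where "a T = card {p \<in> Lo1. p \<in> T}" for T
  \<comment> \<open>A vertex of \<open>Lo0\<close> counts in \<open>z\<close> with probability at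
    least \<open>2^-14\<close>, so the weight \<open>2^19\<close> gives it a mean of at least 32,
    against 23 in \<open>\<mu>\<close>. A vertex of \<open>Lo1\<close> contributes
    \<open>23/2\<close> against 3. Either way the surplus is at least 8.5.\<close>
  define f where "f T = 23 * real (a T) - 23 * real (y T) + 2 ^ 19 * real (z T)" for T
  \<comment> \<open>\<open>483 = 460 + 23\<close>: a vertex of \<open>H'\<close> may occur in
    \<open>h\<close> and also belongs to the set \<open>A\<close> below.\<close>
  define \<mu> where "\<mu> = 483 * real (card H') + 3 * real (card Lo1) + 23 * real (card (V - H' - F)) + 23 * real (card Lo0)"
  have n: "n > 0" using V0 by (simp add: n_def)
  have fZ: "finite Z" "finite F" "finite Hi" "finite Lo" "finite Lo0" "finite Lo1"
  proof -
    show "finite F" using F by (intro finite_subset_V) auto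
    then show "finite Hi" "finite Lo" "finite Lo0" "finite Lo1"
      by (auto simp: Hi_def Lo_def Lo0_def Lo1_def)
    show "finite Z" using finite_V by (simp add: Z_def)
  qed
  have hV: "h \<subseteq> V" "h \<subseteq> H'" using h H' by auto
  have fH: "finite h" "finite H'" using finite_subset_V hV H' by auto
  have sZ: "s p \<subseteq> Z" if "p \<in> F" for p
    using s(1)[OF that] that F E_sub E_swap by (fastforce simp: Z_def)
  have FZ: "F \<subseteq> Z" using F by (auto simp: Z_def)
  have sLo: "s p = E `` {p} - H'" "card (s p) \<le> 13" if "p \<in> Lo" for p
  proof -
    have p: "p \<in> F" "card (E `` {p} - H') < 14" using that by (auto simp: Lo_def)
    show "s p = E `` {p} - H'"
      by (rule card_subset_eq) (use s[OF p(1)] p finite_Image in auto)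
    then show "card (s p) \<le> 13" using p by simp
  qed
  have sHi: "card (s p) = 14" if "p \<in> Hi" for p using that s(2) by (auto simp: Hi_def)
  have f_le: "f T \<le> \<mu>" if T: "T \<in> Pow Z" and pass: "passing W (h \<union> T)" for T
  proof -
    \<comment> \<open>Such a \<open>u\<close> would be undominated: it has no neighbour in
      \<open>h\<close> or \<open>W\<close>, and for degree below 14 the set \<open>s u\<close> is
      its whole neighbourhood outside \<open>H'\<close>.\<close>
    have "z T = 0"
    proof -
      have False if u: "u \<in> Lo0" "insert u (s u) \<inter> T = {}" for u
      proof -
        have uF: "u \<in> F" "u \<in> Lo" using u by (auto simp: Lo0_def Lo_def)
        then have "u \<in> V - (h \<union> T \<union> W)" using u F hV by auto
        then obtain x where x: "x \<in> h \<union> T \<union> W" "(x, u) \<in> E"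
          using pass unfolding passing_def by blast
        then have "x \<in> T" using u uF F by (auto simp: Lo0_def)
        moreover from this have "x \<in> s u" using sLo[OF uF(2)] x T E_swap by (auto simp: Z_def)
        ultimately show False using u by blast
      qed
      then have "{u \<in> Lo0. insert u (s u) \<inter> T = {}} = {}" by blast
      then show ?thesis by (simp only: z_def card.empty)
    qed
    define A where "A = H' \<union> ((V - H' - F) \<union> ({p \<in> Hi. card (s p \<inter> T) \<le> 1} \<union> Lo0))"
    have "card A \<le> card H' + (card (V - H' - F) + (y T + card Lo0))"
      unfolding A_def y_def by (meson card_Un_le add_left_mono order_trans)
    moreover have "23 * card {p \<in> Lo1. p \<in> T} \<le> 460 * card h + 3 * card Lo1 + 23 * card A"
    proof (rule passing_bound[OF pass])
      show "h \<subseteq> V" by (rule hV)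
      show "T \<subseteq> V" "T \<inter> h = {}" using T hV by (auto simp: Z_def)
      show "Lo1 \<subseteq> E `` h" "Lo1 \<inter> h = {}" using F hV by (auto simp: Lo1_def Lo_def)
      show "finite A" "finite Lo1" using fZ fH finite_V by (auto simp: A_def)
      show "sparse_nonmembers V E (h \<union> T) \<subseteq> A \<union> Lo1"
      proof
        fix p assume p: "p \<in> sparse_nonmembers V E (h \<union> T)"
        then have pV: "p \<in> V" "card (E `` {p} \<inter> (h \<union> T)) \<le> 1" by (auto simp: sparse_nonmembers_def)
        show "p \<in> A \<union> Lo1"
        proof (cases "p \<in> Hi")
          case True
          then have "p \<in> F" by (simp add: Hi_def)
          have "card (s p \<inter> T) \<le> card (E `` {p} \<inter> (h \<union> T))"
            using s(1)[OF \<open>p \<in> F\<close>] finite_Image by (intro card_mono) auto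
          then have "card (s p \<inter> T) \<le> 1" using pV by linarith
          then show ?thesis using True by (simp add: A_def)
        next
          case False
          then show ?thesis using pV by (auto simp: A_def Hi_def Lo_def Lo0_def Lo1_def)
        qed
      qed
    qed
    moreover have "card h \<le> card H'" using hV fH by (intro card_mono) auto
    ultimately have "23 * a T \<le> 483 * card H' + 3 * card Lo1 + 23 * card (V - H' - F) + 23 * y T + 23 * card Lo0"
      unfolding a_def by linarith
    then have "real (23 * a T) \<le> real (483 * card H' + 3 * card Lo1 + 23 * card (V - H' - F) + 23 * y T + 23 * card Lo0)"
      by (rule of_nat_mono)
    then show ?thesis using \<open>z T = 0\<close> by (simp add: f_def \<mu>_def)
  qed
  \<comment> \<open>The dominant term is the change of \<open>z\<close>, about
    \<open>2^19 * 2 * 10^11\<close>.\<close>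
  have diff: "\<bar>f (insert x T) - f T\<bar> \<le> 2 * 10 ^ 17" if "T \<subseteq> Z" "x \<in> Z" "x \<notin> T" for T x
  proof -
    have D': "card {p \<in> X. x \<in> s p} \<le> 2 * 10 ^ 11" if "X \<subseteq> F" for X
    proof -
      have "card {p \<in> X. x \<in> s p} \<le> card {p \<in> F. x \<in> s p}"
        using that fZ by (intro card_mono) auto
      then show ?thesis using D[of x] by linarith
    qed
    have "\<bar>real (a (insert x T)) - real (a T)\<bar> \<le> real 1" unfolding a_def
    proof (rule card_diff_le_card_changed[OF fZ(6)])
      have "card {p \<in> Lo1. (p \<in> insert x T) \<noteq> (p \<in> T)} \<le> card {x}" by (intro card_mono) auto
      then show "card {p \<in> Lo1. (p \<in> insert x T) \<noteq> (p \<in> T)} \<le> 1" by simp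
    qed
    moreover have "\<bar>real (y (insert x T)) - real (y T)\<bar> \<le> real (2 * 10 ^ 11)" unfolding y_def
    proof (rule card_diff_le_card_changed[OF fZ(3)])
      have "card {p \<in> Hi. (card (s p \<inter> insert x T) \<le> 1) \<noteq> (card (s p \<inter> T) \<le> 1)} \<le> card {p \<in> Hi. x \<in> s p}"
        using fZ by (intro card_mono) (auto simp: Int_insert_right split: if_splits)
      also have "\<dots> \<le> 2 * 10 ^ 11" by (rule D') (auto simp: Hi_def)
      finally show "card {p \<in> Hi. (card (s p \<inter> insert x T) \<le> 1) \<noteq> (card (s p \<inter> T) \<le> 1)} \<le> 2 * 10 ^ 11" .
    qed
    moreover have "\<bar>real (z (insert x T)) - real (z T)\<bar> \<le> real (2 * 10 ^ 11 + 1)" unfolding z_def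
    proof (rule card_diff_le_card_changed[OF fZ(5)])
      have "card {u \<in> Lo0. (insert u (s u) \<inter> insert x T = {}) \<noteq> (insert u (s u) \<inter> T = {})}
        \<le> card (insert x {p \<in> Lo0. x \<in> s p})"
        using fZ by (intro card_mono) auto
      also have "\<dots> \<le> card {p \<in> Lo0. x \<in> s p} + 1" using fZ by (simp add: card_insert_if)
      also have "\<dots> \<le> 2 * 10 ^ 11 + 1" by (intro add_right_mono D') (auto simp: Lo0_def Lo_def)
      finally show "card {u \<in> Lo0. (insert u (s u) \<inter> insert x T = {}) \<noteq> (insert u (s u) \<inter> T = {})}
        \<le> 2 * 10 ^ 11 + 1" .
    qed
    ultimately show ?thesis by (simp add: f_def abs_le_iff)
  qed
  define N where "N = (2::real) ^ card Z"
  have N: "N > 0" by (simp add: N_def)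
  have fPow: "finite (Pow Z)" using fZ by simp
  have mean_a: "(\<Sum>T\<in>Pow Z. real (a T)) = card Lo1 * (N / 2)"
  proof -
    have "(\<Sum>T\<in>Pow Z. real (a T)) = (\<Sum>p\<in>Lo1. real (card {T \<in> Pow Z. p \<in> T}))"
      unfolding a_def by (rule sum_card_swap[OF fZ(6) fPow])
    also have "\<dots> = (\<Sum>p\<in>Lo1. N / 2)"
    proof (rule sum.cong)
      fix p assume "p \<in> Lo1"
      then have "p \<in> Z" using FZ by (auto simp: Lo1_def Lo_def)
      from card_Pow_containing[OF fZ(1) this] have "real (2 * card {T \<in> Pow Z. p \<in> T}) = real (2 ^ card Z)"
        by (simp only:)
      then show "real (card {T \<in> Pow Z. p \<in> T}) = N / 2" by (simp add: N_def)
    qed simp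
    finally show ?thesis by simp
  qed
  have mean_y: "(\<Sum>T\<in>Pow Z. real (y T)) \<le> card Hi * (15 / 2 ^ 14 * N)"
  proof -
    have "(\<Sum>T\<in>Pow Z. real (y T)) = (\<Sum>p\<in>Hi. real (card {T \<in> Pow Z. card (s p \<inter> T) \<le> 1}))"
      unfolding y_def by (rule sum_card_swap[OF fZ(3) fPow])
    also have "\<dots> \<le> (\<Sum>p\<in>Hi. 15 / 2 ^ 14 * N)"
    proof (rule sum_mono)
      fix p assume p: "p \<in> Hi"
      then have "s p \<subseteq> Z" using sZ by (auto simp: Hi_def)
      from card_Pow_meeting_once[OF fZ(1) this]
      have "2 ^ 14 * card {T \<in> Pow Z. card (s p \<inter> T) \<le> 1} \<le> 15 * 2 ^ card Z"
        using sHi[OF p] by simp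
      then have "real (2 ^ 14 * card {T \<in> Pow Z. card (s p \<inter> T) \<le> 1}) \<le> real (15 * 2 ^ card Z)"
        by (rule of_nat_mono)
      then show "real (card {T \<in> Pow Z. card (s p \<inter> T) \<le> 1}) \<le> 15 / 2 ^ 14 * N" by (simp add: N_def)
    qed
    finally show ?thesis by simp
  qed
  have mean_z: "card Lo0 * (N / 2 ^ 14) \<le> (\<Sum>T\<in>Pow Z. real (z T))"
  proof -
    have "card Lo0 * (N / 2 ^ 14) = (\<Sum>u\<in>Lo0. N / 2 ^ 14)" by simp
    also have "\<dots> \<le> (\<Sum>u\<in>Lo0. real (card {T \<in> Pow Z. insert u (s u) \<inter> T = {}}))"
    proof (rule sum_mono)
      fix u assume "u \<in> Lo0"
      then have u: "u \<in> Lo" "u \<in> F" by (auto simp: Lo0_def Lo_def)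
      have "insert u (s u) \<subseteq> Z" using u FZ sZ by auto
      moreover have "card (insert u (s u)) \<le> 14"
        using sLo(2)[OF u(1)] card_insert_le_m1[of 14 "s u" u] by simp
      ultimately have "2 ^ card Z \<le> 2 ^ 14 * card {T \<in> Pow Z. insert u (s u) \<inter> T = {}}"
        by (rule card_Pow_avoiding[OF fZ(1)])
      then have "real (2 ^ card Z) \<le> real (2 ^ 14 * card {T \<in> Pow Z. insert u (s u) \<inter> T = {}})"
        by (rule of_nat_mono)
      then show "N / 2 ^ 14 \<le> real (card {T \<in> Pow Z. insert u (s u) \<inter> T = {}})" by (simp add: N_def)
    qed
    also have "\<dots> = (\<Sum>T\<in>Pow Z. real (z T))"
      unfolding z_def by (rule sum_card_swap[OF fZ(5) fPow, symmetric])
    finally show ?thesis .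
  qed
  have cLo: "card Lo = card Lo0 + card Lo1"
    using card_Int_Diff[OF fZ(4), of "E `` h"] by (simp add: Lo0_def Lo1_def)
  have cHi: "real (card Hi) \<le> n"
    using F finite_V by (auto simp: n_def Hi_def intro!: card_mono)
  have "\<mu> + n / 50 \<le> 11.5 * card Lo1 - 345 / 2 ^ 14 * card Hi + 32 * card Lo0"
    using num cLo cHi unfolding \<mu>_def Lo_def[symmetric] n_def[symmetric] by simp
  then have "(\<mu> + n / 50) * N \<le> (11.5 * card Lo1 - 345 / 2 ^ 14 * card Hi + 32 * card Lo0) * N"
    using N by (simp add: mult_right_mono)
  also have "\<dots> = 23 * (card Lo1 * (N / 2)) - 23 * (card Hi * (15 / 2 ^ 14 * N)) + 2 ^ 19 * (card Lo0 * (N / 2 ^ 14))"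
    by (simp add: algebra_simps)
  also have "\<dots> \<le> 23 * (\<Sum>T\<in>Pow Z. real (a T)) - 23 * (\<Sum>T\<in>Pow Z. real (y T)) + 2 ^ 19 * (\<Sum>T\<in>Pow Z. real (z T))"
    using mean_a mean_y mean_z by (intro add_mono diff_mono mult_left_mono) auto
  also have "\<dots> = (\<Sum>T\<in>Pow Z. f T)"
    by (simp add: f_def sum.distrib sum_subtractf sum_distrib_left)
  finally have mean: "(\<mu> + n / 50) * 2 ^ card Z \<le> (\<Sum>T\<in>Pow Z. f T)" by (simp add: N_def)
  have "real (card {T \<in> Pow Z. passing W (h \<union> T)}) \<le> real (card {T \<in> Pow Z. f T \<le> \<mu>})"
    using f_le fPow by (intro of_nat_mono card_mono) auto
  also have "\<dots> \<le> 2 ^ card Z * exp (- ((n / 50)\<^sup>2 / ((2 * 10 ^ 17)\<^sup>2 * n)))"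
  proof (rule cube_lower_tail[OF fZ(1) diff])
    show "real (card Z) \<le> n" unfolding n_def Z_def using finite_V by (intro of_nat_mono card_mono) auto
  qed (use n mean in auto)
  also have "(n / 50)\<^sup>2 / ((2 * 10 ^ 17)\<^sup>2 * n) = n / 10 ^ 38"
    using n by (simp add: power2_eq_square field_simps)
  finally show ?thesis by (simp add: Z_def n_def)
qed

text \<open>Summing the fixed-core estimate over all traces on \<open>H'\<close> loses nothing, as
  the powers of two recombine. It remains to choose \<open>H'\<close> and \<open>F\<close> such that
  almost all of \<open>L\<close> consists of low-degree vertices in \<open>F\<close>.\<close>

lemma passing_count:
  assumes L: "L \<subseteq> V" "L \<inter> H = {}" and H: "H \<subseteq> V" and W: "W \<subseteq> L"
    and cL: "card V \<le> 60 * card L" and cH: "10 ^ 4 * card H \<le> card V" and cW: "50000 * card W \<le> card V"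
    and low: "\<And>v. v \<in> L \<Longrightarrow> card (E `` {v} - H) < 14" and V0: "card V > 0"
  shows "real (card {S \<in> Pow (V - W). passing W S}) \<le> 2 ^ card (V - W) * exp (- (real (card V) / 10 ^ 38))"
proof -
  obtain H' where H': "H \<subseteq> H'" "H' \<subseteq> V" and cH': "10 ^ 6 * card (H' - H) \<le> 14 * card V"
    and sat: "\<forall>X\<subseteq>V. card {p \<in> V. min 14 (card (E `` {p} - H' - X)) < min 14 (card (E `` {p} - H'))} \<le> 10 ^ 6 * card X"
    using saturated_superset[OF H, of "10 ^ 6" 14] by (elim exE conjE)
  define U where "U = V - H' - (W \<union> E `` W)"
  have fU: "finite U" using finite_V by (simp add: U_def)
  \<comment> \<open>With \<open>D = 2 * 10^11\<close>, the at most \<open>10^6 * card X\<close>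
    vertices that the selection rejects number at most \<open>7n / 10^5\<close>.\<close>
  have D0: "(0::nat) < 2 * 10 ^ 11" by simp
  have fN: "finite (E `` {p} - H')" for p using finite_Image by blast
  obtain F s X where F: "F \<subseteq> U"
    and s0: "\<forall>p\<in>F. s p \<subseteq> E `` {p} - H' \<and> card (s p) = min 14 (card (E `` {p} - H'))"
    and D: "\<forall>x. card {p \<in> F. x \<in> s p} \<le> 2 * 10 ^ 11" and X: "X \<subseteq> \<Union>((\<lambda>p. E `` {p} - H') ` U)"
    and cX: "2 * 10 ^ 11 * card X \<le> 14 * card U"
    and rest: "\<forall>p\<in>U - F. card (E `` {p} - H' - X) < min 14 (card (E `` {p} - H'))"
    using bounded_overlap_selection[where N = "\<lambda>p. E `` {p} - H'" and k = 14, OF fU fN D0]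
    by (elim exE conjE)
  have s: "\<And>p. p \<in> F \<Longrightarrow> s p \<subseteq> E `` {p} - H'"
    "\<And>p. p \<in> F \<Longrightarrow> card (s p) = min 14 (card (E `` {p} - H'))" using s0 by blast+
  have XV: "X \<subseteq> V" using X E_sub by auto
  \<comment> \<open>Deleting \<open>X\<close> lowers the truncated degree of every rejected vertex,
    so the saturation of \<open>H'\<close> applies to \<open>X\<close>.\<close>
  have "card (U - F) \<le> card {p \<in> V. min 14 (card (E `` {p} - H' - X)) < min 14 (card (E `` {p} - H'))}"
    using rest finite_V by (intro card_mono) (auto simp: U_def min_less_iff_disj)
  also have "\<dots> \<le> 10 ^ 6 * card X" using sat XV by blast
  finally have cUF: "card (U - F) \<le> 10 ^ 6 * card X" .
  have fW: "finite W" and WV: "W \<subseteq> V" using W L finite_subset_V by auto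
  have cEW: "card (E `` W - H) \<le> 13 * card W"
  proof -
    have "E `` W - H = (\<Union>w\<in>W. E `` {w} - H)" by blast
    then have "card (E `` W - H) \<le> (\<Sum>w\<in>W. card (E `` {w} - H))"
      using card_UN_le[OF fW, of "\<lambda>w. E `` {w} - H"] by (simp only:)
    also have "\<dots> \<le> (\<Sum>w\<in>W. 13)" using low W by (intro sum_mono) fastforce
    finally show ?thesis by (simp add: mult.commute)
  qed
  define B where "B = V - H' - F"
  have "card B \<le> card ((U - F) \<union> (W \<union> (E `` W - H)))"
    using finite_V fW finite_Image H' by (intro card_mono) (auto simp: B_def U_def)
  also have "\<dots> \<le> card (U - F) + (card W + card (E `` W - H))"
    by (meson card_Un_le add_left_mono order_trans)
  finally have cB: "card B \<le> 10 ^ 6 * card X + 14 * card W" using cUF cEW by linarith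
  have cU: "card U \<le> card V" using finite_V by (intro card_mono) (auto simp: U_def)
  define Lo where "Lo = {p \<in> F. card (E `` {p} - H') < 14}"
  have "L \<subseteq> Lo \<union> ((H' - H) \<union> B)"
  proof
    fix v assume v: "v \<in> L"
    have "card (E `` {v} - H') \<le> card (E `` {v} - H)" using H' finite_Image by (intro card_mono) auto
    then have "card (E `` {v} - H') < 14" using low[OF v] by linarith
    then show "v \<in> Lo \<union> ((H' - H) \<union> B)" using v L by (auto simp: Lo_def B_def)
  qed
  then have "card L \<le> card (Lo \<union> ((H' - H) \<union> B))"
    using finite_V F finite_subset_V[OF H'(2)] fU
    by (intro card_mono) (auto simp: Lo_def B_def intro: finite_subset)
  also have "\<dots> \<le> card Lo + (card (H' - H) + card B)"
    by (meson card_Un_le add_left_mono order_trans)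
  finally have cLo: "card L \<le> card Lo + (card (H' - H) + card B)" .
  have cHH: "card H' = card H + card (H' - H)"
    using H' finite_subset_V[OF H] finite_subset_V[OF H'(2)] card_mono[of H' H] by (simp add: card_Diff_subset)
  define n where "n = real (card V)"
  have nums: "n \<le> 60 * real (card L)" "10 ^ 4 * real (card H) \<le> n" "50000 * real (card W) \<le> n"
    "10 ^ 6 * real (card (H' - H)) \<le> 14 * n" "2 * 10 ^ 11 * real (card X) \<le> 14 * n"
    "real (card B) \<le> 10 ^ 6 * real (card X) + 14 * real (card W)"
    "real (card L) \<le> real (card Lo) + (real (card (H' - H)) + real (card B))"
    "real (card H') = real (card H) + real (card (H' - H))"
    using of_nat_mono[OF cL, where 'a = real] of_nat_mono[OF cH, where 'a = real]
      of_nat_mono[OF cW, where 'a = real] of_nat_mono[OF cH', where 'a = real]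
      of_nat_mono[OF cX, where 'a = real] of_nat_mono[OF cU, where 'a = real]
      of_nat_mono[OF cB, where 'a = real] of_nat_mono[OF cLo, where 'a = real] cHH
    by (simp_all add: n_def)
  have n0: "0 \<le> n" by (simp add: n_def)
  \<comment> \<open>Divided by \<open>n\<close>, the left side is below 0.11, while the right side
    exceeds \<open>8.5 * 0.016 = 0.136\<close>.\<close>
  have num: "483 * real (card H') + 23 * real (card (V - H' - F)) + 345 / 2 ^ 14 * card V + card V / 50
      \<le> 8.5 * real (card {p \<in> F. card (E `` {p} - H') < 14})"
    using nums n0 unfolding B_def[symmetric] Lo_def[symmetric] n_def[symmetric] by simp
  define e where "e = exp (- (real (card V) / 10 ^ 38))"
  have fixed: "real (card {T \<in> Pow (V - W - H'). passing W (h \<union> T)}) \<le> 2 ^ card (V - W - H') * e"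
    if "h \<in> Pow (H' - W)" for h
    unfolding e_def
    by (rule passing_count_fixed_core[OF H'(2) WV _ F[unfolded U_def] s spec[OF D] V0 num]) (use that in auto)
  have fHW: "finite (H' - W)" "finite (V - W - H')" using H' finite_V finite_subset_V[OF H'(2)] by auto
  have "{S \<in> Pow (V - W). passing W S} \<subseteq>
    (\<Union>h\<in>Pow (H' - W). (\<lambda>T. h \<union> T) ` {T \<in> Pow (V - W - H'). passing W (h \<union> T)})"
  proof
    fix S assume S: "S \<in> {S \<in> Pow (V - W). passing W S}"
    have "S = (S \<inter> H') \<union> (S - H')" by blast
    then show "S \<in> (\<Union>h\<in>Pow (H' - W). (\<lambda>T. h \<union> T) ` {T \<in> Pow (V - W - H'). passing W (h \<union> T)})"
      using S by (intro UN_I[of "S \<inter> H'"] image_eqI[of _ _ "S - H'"]) auto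
  qed
  then have "card {S \<in> Pow (V - W). passing W S} \<le>
    card (\<Union>h\<in>Pow (H' - W). (\<lambda>T. h \<union> T) ` {T \<in> Pow (V - W - H'). passing W (h \<union> T)})"
    using fHW by (intro card_mono) auto
  also have "\<dots> \<le> (\<Sum>h\<in>Pow (H' - W). card ((\<lambda>T. h \<union> T) ` {T \<in> Pow (V - W - H'). passing W (h \<union> T)}))"
    using fHW by (intro card_UN_le) auto
  also have "\<dots> \<le> (\<Sum>h\<in>Pow (H' - W). card {T \<in> Pow (V - W - H'). passing W (h \<union> T)})"
    using fHW by (intro sum_mono card_image_le) auto
  finally have "real (card {S \<in> Pow (V - W). passing W S}) \<le>
    (\<Sum>h\<in>Pow (H' - W). real (card {T \<in> Pow (V - W - H'). passing W (h \<union> T)}))"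
    unfolding of_nat_sum[symmetric] by (rule of_nat_mono)
  also have "\<dots> \<le> (\<Sum>h\<in>Pow (H' - W). 2 ^ card (V - W - H') * e)" by (rule sum_mono) (rule fixed)
  also have "\<dots> = 2 ^ (card (H' - W) + card (V - W - H')) * e"
    using fHW by (simp add: card_Pow power_add)
  also have "card (H' - W) + card (V - W - H') = card (V - W)"
  proof -
    have "(V - W) \<inter> H' = H' - W" using H' by blast
    then show ?thesis using finite_V card_Int_Diff[of "V - W" H'] by simp
  qed
  finally show ?thesis by (simp add: e_def)
qed

lemma mcds_passing:
  assumes "mcds V E S"
  shows "passing {} S"
proof -
  have "V - S \<subseteq> E `` S" using assms by (auto simp: mcds_def cds_def)
  moreover have "20 * card (E `` K \<inter> (S \<union> sparse_nonmembers V E S))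
      \<le> 460 * card K + 23 * card (sparse_nonmembers V E S)" if "K \<subseteq> S" for K
    using mcds_coverage_bound[OF assms order_refl that] by linarith
  ultimately show ?thesis by (auto simp: passing_def)
qed

text \<open>Minimal sets form an antichain, so deleting a fixed vertex \<open>v\<close> from each of
  them is injective.\<close>

lemma mcds_count_half:
  assumes "V \<noteq> {}"
  shows "2 * card {S. mcds V E S} \<le> 2 ^ card V"
proof -
  obtain v where v: "v \<in> V" using assms by blast
  let ?M = "{S. mcds V E S}"
  have MV: "?M \<subseteq> Pow V" by (auto simp: mcds_def cds_def)
  have "inj_on (\<lambda>S. S - {v}) ?M"
  proof (rule inj_onI)
    have no: "S \<subset> T \<Longrightarrow> False" if "S \<in> ?M" "T \<in> ?M" for S T
      using that by (auto simp: mcds_def)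
    fix S T assume ST: "S \<in> ?M" "T \<in> ?M" "S - {v} = T - {v}"
    show "S = T"
    proof (rule ccontr)
      assume "S \<noteq> T"
      then have "S \<subset> T \<or> T \<subset> S" using ST(3) by blast
      then show False using no ST by blast
    qed
  qed
  moreover have "(\<lambda>S. S - {v}) ` ?M \<subseteq> Pow (V - {v})" using MV by auto
  ultimately have "card ?M \<le> card (Pow (V - {v}))"
    using finite_V by (intro card_inj_on_le) auto
  then have "card ?M \<le> 2 ^ (card V - 1)" using finite_V v by (simp add: card_Pow)
  moreover have "card V > 0" using v finite_V card_gt_0_iff by blast
  ultimately show ?thesis by (metis Suc_diff_1 mult_le_mono2 power_Suc)
qed

end

section \<open>Executing programs\<close>

text \<open>Evaluation is deterministic, so the relation is a partial function. In this form
  programs can be executed by rewriting.\<close>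

definition res :: "program \<Rightarrow> sexp list \<Rightarrow> expr \<Rightarrow> (sexp \<times> nat) option" where
  "res P env e = (if \<exists>r. eval P env e (fst r) (snd r) then Some (SOME r. eval P env e (fst r) (snd r)) else None)"

definition ress :: "program \<Rightarrow> sexp list \<Rightarrow> expr list \<Rightarrow> (sexp list \<times> nat) option" where
  "ress P env es = (if \<exists>r. evals P env es (fst r) (snd r) then Some (SOME r. evals P env es (fst r) (snd r)) else None)"

text \<open>The evaluation equations reduce calls to \<open>run\<close> and leave it folded, so a
  recursive function is unfolded only where its body is inserted explicitly.\<close>

definition run :: "program \<Rightarrow> nat \<Rightarrow> sexp list \<Rightarrow> (sexp \<times> nat) option" where
  "run P f vs = (if f < length P then res P vs (P ! f) else None)"

lemma res_eq_Some: "res P env e = Some (v, t) \<longleftrightarrow> eval P env e v t"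
proof
  assume a: "res P env e = Some (v, t)"
  then have ex: "\<exists>r. eval P env e (fst r) (snd r)" by (auto simp: res_def split: if_splits)
  from someI_ex[OF this] show "eval P env e v t" using a ex by (simp add: res_def)
next
  assume a: "eval P env e v t"
  then have ex: "\<exists>r. eval P env e (fst r) (snd r)" by (intro exI[of _ "(v, t)"]) simp
  from someI_ex[OF this] eval_deterministic(1)[OF a]
  have "(SOME r. eval P env e (fst r) (snd r)) = (v, t)" by (simp add: prod_eq_iff)
  then show "res P env e = Some (v, t)" using ex by (simp add: res_def)
qed

lemma ress_eq_Some: "ress P env es = Some (vs, t) \<longleftrightarrow> evals P env es vs t"
proof
  assume a: "ress P env es = Some (vs, t)"
  then have ex: "\<exists>r. evals P env es (fst r) (snd r)" by (auto simp: ress_def split: if_splits)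
  from someI_ex[OF this] show "evals P env es vs t" using a ex by (simp add: ress_def)
next
  assume a: "evals P env es vs t"
  then have ex: "\<exists>r. evals P env es (fst r) (snd r)" by (intro exI[of _ "(vs, t)"]) simp
  from someI_ex[OF this] eval_deterministic(2)[OF a]
  have "(SOME r. evals P env es (fst r) (snd r)) = (vs, t)" by (simp add: prod_eq_iff)
  then show "ress P env es = Some (vs, t)" using ex by (simp add: ress_def)
qed

lemma option_pair_eqI: "(\<And>v t. x = Some (v, t) \<longleftrightarrow> y = Some (v, t)) \<Longrightarrow> x = y"
  by (cases x; cases y) auto

lemma res_Var: "res P env (Var i) = (if i < length env then Some (env ! i, 1) else None)"
proof (rule option_pair_eqI)
  fix v t
  have inv: "res P env (Var i) = Some (v, t) \<longleftrightarrow> i < length env \<and> v = env ! i \<and> t = 1"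
    unfolding res_eq_Some by (rule iffI, erule eval_VarE, simp) (use eval_Var in blast)
  show "res P env (Var i) = Some (v, t) \<longleftrightarrow> (if i < length env then Some (env ! i, 1) else None) = Some (v, t)"
    unfolding inv by (auto split: option.splits)
qed

lemma res_AtomE: "res P env AtomE = Some (Atom, 1)"
  unfolding res_eq_Some by (rule eval_Atom)

lemma res_PairE: "res P env (PairE a b) = (case res P env a of None \<Rightarrow> None | Some (v, t) \<Rightarrow>
    (case res P env b of None \<Rightarrow> None | Some (w, u) \<Rightarrow> Some (Pair v w, t + u + 1)))"
proof (rule option_pair_eqI)
  fix v t
  have inv: "res P env (PairE a b) = Some (v, t) \<longleftrightarrow> (\<exists>w u w' u'. res P env a = Some (w, u) \<and>
    res P env b = Some (w', u') \<and> v = Pair w w' \<and> t = u + u' + 1)"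
    unfolding res_eq_Some by (rule iffI, erule eval_PairE, simp, blast?) (blast intro: eval_Pair)
  show "res P env (PairE a b) = Some (v, t) \<longleftrightarrow> (case res P env a of None \<Rightarrow> None | Some (v, t) \<Rightarrow>
    (case res P env b of None \<Rightarrow> None | Some (w, u) \<Rightarrow> Some (Pair v w, t + u + 1))) = Some (v, t)"
    unfolding inv by (auto split: option.splits)
qed

lemma res_FstE: "res P env (FstE a) = (case res P env a of None \<Rightarrow> None | Some (v, t) \<Rightarrow> Some (fst_sexp v, t + 1))"
proof (rule option_pair_eqI)
  fix v t
  have inv: "res P env (FstE a) = Some (v, t) \<longleftrightarrow> (\<exists>w u. res P env a = Some (w, u) \<and> v = fst_sexp w \<and> t = u + 1)"
    unfolding res_eq_Some by (rule iffI, erule eval_FstE, simp, blast?) (blast intro: eval_Fst)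
  show "res P env (FstE a) = Some (v, t) \<longleftrightarrow> (case res P env a of None \<Rightarrow> None
     | Some (v, t) \<Rightarrow> Some (fst_sexp v, t + 1)) = Some (v, t)"
    unfolding inv by (auto split: option.splits)
qed

lemma res_SndE: "res P env (SndE a) = (case res P env a of None \<Rightarrow> None | Some (v, t) \<Rightarrow> Some (snd_sexp v, t + 1))"
proof (rule option_pair_eqI)
  fix v t
  have inv: "res P env (SndE a) = Some (v, t) \<longleftrightarrow> (\<exists>w u. res P env a = Some (w, u) \<and> v = snd_sexp w \<and> t = u + 1)"
    unfolding res_eq_Some by (rule iffI, erule eval_SndE, simp, blast?) (blast intro: eval_Snd)
  show "res P env (SndE a) = Some (v, t) \<longleftrightarrow> (case res P env a of None \<Rightarrow> None
     | Some (v, t) \<Rightarrow> Some (snd_sexp v, t + 1)) = Some (v, t)"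
    unfolding inv by (auto split: option.splits)
qed

lemma res_IfE: "res P env (IfE b x y) = (case res P env b of None \<Rightarrow> None | Some (w, u) \<Rightarrow>
    (case res P env (if w = Atom then y else x) of None \<Rightarrow> None | Some (v, t) \<Rightarrow> Some (v, u + t + 1)))"
proof (rule option_pair_eqI)
  fix v t
  have inv: "res P env (IfE b x y) = Some (v, t) \<longleftrightarrow> (\<exists>w u t'. res P env b = Some (w, u) \<and>
    res P env (if w = Atom then y else x) = Some (v, t') \<and> t = u + t' + 1)" (is "?L \<longleftrightarrow> ?R")
  proof
    assume ?L
    then have "eval P env (IfE b x y) v t" by (simp only: res_eq_Some)
    then show ?R
    proof (rule eval_IfE)
      fix p q t1 t2
      assume "t = Suc (t1 + t2)" "eval P env b (Pair p q) t1" "eval P env x v t2"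
      then show ?R unfolding res_eq_Some by (intro exI[of _ "Pair p q"] exI[of _ t1] exI[of _ t2]) simp
    next
      fix t1 t2
      assume "t = Suc (t1 + t2)" "eval P env b Atom t1" "eval P env y v t2"
      then show ?R unfolding res_eq_Some by (intro exI[of _ Atom] exI[of _ t1] exI[of _ t2]) simp
    qed
  next
    assume ?R
    then obtain w u t' where w: "eval P env b w u" "eval P env (if w = Atom then y else x) v t'" "t = u + t' + 1"
      unfolding res_eq_Some by blast
    show ?L unfolding res_eq_Some w(3)
    proof (cases w)
      case Atom
      then show "eval P env (IfE b x y) v (u + t' + 1)" using w by (intro eval_IfFalse) auto
    next
      case (Pair p q)
      then show "eval P env (IfE b x y) v (u + t' + 1)" using w by (intro eval_IfTrue[of _ _ _ p q]) auto
    qed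
  qed
  show "res P env (IfE b x y) = Some (v, t) \<longleftrightarrow> (case res P env b of None \<Rightarrow> None | Some (w, u) \<Rightarrow>
    (case res P env (if w = Atom then y else x) of None \<Rightarrow> None | Some (v, t) \<Rightarrow> Some (v, u + t + 1))) = Some (v, t)"
    unfolding inv by (auto split: option.splits)
qed

lemma res_LetE: "res P env (LetE a b) = (case res P env a of None \<Rightarrow> None | Some (v, t) \<Rightarrow>
    (case res P (v # env) b of None \<Rightarrow> None | Some (w, u) \<Rightarrow> Some (w, t + u + 1)))"
proof (rule option_pair_eqI)
  fix v t
  have inv: "res P env (LetE a b) = Some (v, t) \<longleftrightarrow> (\<exists>w u t'. res P env a = Some (w, u) \<and>
    res P (w # env) b = Some (v, t') \<and> t = u + t' + 1)"
    unfolding res_eq_Some by (rule iffI, erule eval_LetE, simp, blast?) (blast intro: eval_Let)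
  show "res P env (LetE a b) = Some (v, t) \<longleftrightarrow> (case res P env a of None \<Rightarrow> None | Some (v, t) \<Rightarrow>
    (case res P (v # env) b of None \<Rightarrow> None | Some (w, u) \<Rightarrow> Some (w, t + u + 1))) = Some (v, t)"
    unfolding inv by (auto split: option.splits)
qed

lemma res_CallE: "res P env (CallE f es) = (case ress P env es of None \<Rightarrow> None | Some (vs, t) \<Rightarrow>
    (case run P f vs of None \<Rightarrow> None | Some (w, u) \<Rightarrow> Some (w, t + u + 1)))"
proof (rule option_pair_eqI)
  fix v t
  have inv: "res P env (CallE f es) = Some (v, t) \<longleftrightarrow> (\<exists>vs u t'. ress P env es = Some (vs, u) \<and>
    run P f vs = Some (v, t') \<and> t = u + t' + 1)"
  proof -
    have "run P f vs = Some (v, t') \<longleftrightarrow> f < length P \<and> eval P vs (P ! f) v t'" for vs t'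
      by (simp add: run_def res_eq_Some)
    then show ?thesis unfolding res_eq_Some ress_eq_Some
      by (simp only:) (rule iffI, erule eval_CallE, simp, blast?, blast intro: eval_Call)
  qed
  show "res P env (CallE f es) = Some (v, t) \<longleftrightarrow> (case ress P env es of None \<Rightarrow> None | Some (vs, t) \<Rightarrow>
    (case run P f vs of None \<Rightarrow> None | Some (w, u) \<Rightarrow> Some (w, t + u + 1))) = Some (v, t)"
    unfolding inv by (auto split: option.splits)
qed

lemma ress_Nil: "ress P env [] = Some ([], 0)"
  by (simp add: ress_eq_Some evals_Nil)

lemma ress_Cons: "ress P env (e # es) = (case res P env e of None \<Rightarrow> None | Some (v, t) \<Rightarrow>
    (case ress P env es of None \<Rightarrow> None | Some (vs, u) \<Rightarrow> Some (v # vs, t + u)))"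
proof (rule option_pair_eqI)
  fix vs t
  have inv: "ress P env (e # es) = Some (vs, t) \<longleftrightarrow> (\<exists>v u ws t'. res P env e = Some (v, u) \<and>
    ress P env es = Some (ws, t') \<and> vs = v # ws \<and> t = u + t')"
    unfolding res_eq_Some ress_eq_Some by (rule iffI, erule evals_ConsE, simp, blast?) (blast intro: evals_Cons)
  show "ress P env (e # es) = Some (vs, t) \<longleftrightarrow> (case res P env e of None \<Rightarrow> None | Some (v, t) \<Rightarrow>
    (case ress P env es of None \<Rightarrow> None | Some (vs, u) \<Rightarrow> Some (v # vs, t + u))) = Some (vs, t)"
    unfolding inv by (auto split: option.splits)
qed

lemmas res_simps = res_Var res_AtomE res_PairE res_FstE res_SndE res_IfE res_LetE res_CallE ress_Nil ress_Cons

section \<open>Encodings of numbers, sets and graphs\<close>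

primrec un :: "nat \<Rightarrow> sexp" where
  "un 0 = Atom"
| "un (Suc k) = Pair Atom (un k)"

declare un.simps [simp del]

primrec lit :: "nat \<Rightarrow> expr" where
  "lit 0 = AtomE"
| "lit (Suc k) = PairE AtomE (lit k)"

declare lit.simps [simp del]

lemma res_lit: "res P env (lit k) = Some (un k, 2 * k + 1)"
  by (induction k) (simp_all add: lit.simps un.simps res_simps)

text \<open>Sets are listed along an arbitrary vertex list, so that the suffixes met in recursions
  have the same form. Likewise \<open>mat\<close> separates columns from rows, because recursion
  over the rows keeps the full columns.\<close>

definition vec :: "'v list \<Rightarrow> 'v set \<Rightarrow> sexp" where
  "vec zs S = enc_list (map (\<lambda>v. enc_bool (v \<in> S)) zs)"

definition mat :: "('v \<times> 'v) set \<Rightarrow> 'v list \<Rightarrow> 'v list \<Rightarrow> sexp" where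
  "mat E zs us = enc_list (map (\<lambda>u. vec zs (E `` {u})) us)"

lemma enc_list_simps [simp]: "enc_list [] = Atom" "enc_list (x # xs) = Pair x (enc_list xs)"
  by (simp_all add: enc_list_def)

lemma vec_simps [simp]: "vec [] S = Atom" "vec (z # zs) S = Pair (enc_bool (z \<in> S)) (vec zs S)"
  by (simp_all add: vec_def)

lemma mat_simps [simp]: "mat E zs [] = Atom" "mat E zs (u # us) = Pair (vec zs (E `` {u})) (mat E zs us)"
  by (simp_all add: mat_def)

lemma enc_bool_simps [simp]: "enc_bool True = Pair Atom Atom" "enc_bool False = Atom"
  "enc_bool b = Atom \<longleftrightarrow> \<not> b"
  by (simp_all add: enc_bool_def)

lemma un_eq_Atom [simp]: "un k = Atom \<longleftrightarrow> k = 0"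
  by (cases k) (simp_all add: un.simps)

lemma vec_cong: "(\<And>v. v \<in> set zs \<Longrightarrow> v \<in> S \<longleftrightarrow> v \<in> T) \<Longrightarrow> vec zs S = vec zs T"
  by (simp add: vec_def cong: map_cong)

section \<open>The enumeration program\<close>

text \<open>
  The function numbers in calls are positions in \<open>prog\<close>. Sets are characteristic vectors, numbers are
  unary, and a graph is its adjacency matrix.
\<close>

abbreviation "TrueE \<equiv> PairE AtomE AtomE"
abbreviation "tl0 \<equiv> SndE (Var 0)"
abbreviation "tl1 \<equiv> SndE (Var 1)"
abbreviation "tl2 \<equiv> SndE (Var 2)"
abbreviation "hd0 \<equiv> FstE (Var 0)"
abbreviation "hd1 \<equiv> FstE (Var 1)"
abbreviation "hd2 \<equiv> FstE (Var 2)"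

text \<open>99999 is the start and the reset value of the counter in \<open>pick_body\<close>, so
  every 100000th vertex of \<open>L\<close> enters \<open>W\<close>. This is sparse enough for
  \<open>passing_count\<close> and still linear in \<open>card L\<close> up to rounding.\<close>

definition "main_body = LetE (lit 99999)
  (CallE 22 [FstE (Var 1), CallE 20 [FstE (SndE (Var 1)), Var 0, Var 0]])"

definition "count_body = IfE (Var 0)
  (IfE hd0 (IfE hd1 (PairE AtomE (CallE 1 [tl0, tl1])) (CallE 1 [tl0, tl1])) (CallE 1 [tl0, tl1]))
  AtomE"

definition "le_body = IfE (Var 0) (IfE (Var 1) (CallE 2 [tl0, tl1]) AtomE) TrueE"

definition "or_body = IfE (Var 0)
  (PairE (IfE hd0 TrueE (IfE hd1 TrueE AtomE)) (CallE 3 [tl0, tl1])) AtomE"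

definition "diff_body = IfE (Var 0) (PairE (IfE hd1 AtomE hd0) (CallE 4 [tl0, tl1])) AtomE"

definition "zero_body = IfE (Var 0) (PairE AtomE (CallE 5 [tl0])) AtomE"

definition "first_body = IfE (Var 0)
  (IfE hd0 (PairE TrueE (CallE 5 [tl0])) (PairE AtomE (CallE 6 [tl0]))) AtomE"

text \<open>One round of breadth-first search inside the second argument. The third argument is the
  copy of the reached set that is consumed along the rows, the fourth the full copy in which
  neighbours are counted.\<close>

definition "step_body = IfE (Var 0)
  (PairE (IfE hd2 TrueE (IfE hd1 (IfE (CallE 1 [hd0, Var 3]) TrueE AtomE) AtomE))
    (CallE 7 [tl0, tl1, tl2, Var 3])) AtomE"

text \<open>The first argument is a clock with one round per list element. \<open>cds_body\<close>
  passes the adjacency matrix, which has one row per vertex.\<close>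

definition "iter_body = IfE (Var 0)
  (CallE 8 [tl0, Var 1, Var 2, CallE 7 [Var 1, Var 2, Var 3, Var 3]]) (Var 3)"

definition "dom_body = IfE (Var 0)
  (IfE hd1 (CallE 9 [tl0, tl1, Var 2])
    (IfE (CallE 1 [hd0, Var 2]) (CallE 9 [tl0, tl1, Var 2]) AtomE)) TrueE"

text \<open>The first test excludes the empty set. Connectivity is tested by a search from the first
  member of the set; that everything is reached is checked by comparing cardinalities.\<close>

definition "cds_body = IfE (CallE 1 [Var 1, Var 1])
  (IfE (CallE 9 [Var 0, Var 1, Var 1])
    (CallE 2 [CallE 1 [Var 1, Var 1],
      CallE 1 [Var 1, CallE 8 [Var 0, Var 0, Var 1, CallE 6 [Var 1]]]]) AtomE) AtomE"

definition "mapcons_body = IfE (Var 1)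
  (PairE (PairE (Var 0) hd1) (CallE 11 [Var 0, tl1, Var 2])) (Var 2)"

definition "deletions_body = IfE (Var 0)
  (CallE 11 [hd0, CallE 12 [tl0], IfE hd0 (PairE (PairE AtomE tl0) AtomE) AtomE]) AtomE"

definition "any_cds_body = IfE (Var 1)
  (IfE (CallE 10 [Var 0, hd1]) TrueE (CallE 13 [Var 0, tl1])) AtomE"

definition "mcds_body = IfE (CallE 10 [Var 0, Var 1])
  (IfE (CallE 13 [Var 0, CallE 12 [Var 1]]) AtomE TrueE) AtomE"

text \<open>Positions marked in the first argument take both values, the others are copied from the
  second. Inside \<open>LetE\<close> the two arguments have become \<open>Var 1\<close> and
  \<open>Var 2\<close>.\<close>

definition "gen_body = IfE (Var 0)
  (LetE (CallE 15 [tl0, tl1])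
    (IfE hd1 (CallE 11 [TrueE, Var 0, CallE 11 [AtomE, Var 0, AtomE]])
      (CallE 11 [hd2, Var 0, AtomE]))) TrueE"

definition "filter_body = IfE (Var 1)
  (IfE (CallE 14 [Var 0, hd1]) (PairE hd1 (CallE 16 [Var 0, tl1, Var 2])) (CallE 16 [Var 0, tl1, Var 2]))
  (Var 2)"

text \<open>Members are kept whatever their neighbours; with both set arguments equal to
  \<open>S\<close> the result is \<open>S\<close> together with its sparse nonmembers.\<close>

definition "amplify_body = IfE (Var 0)
  (PairE (IfE hd1 TrueE (CallE 2 [CallE 1 [hd0, Var 2], lit 1])) (CallE 17 [tl0, tl1, Var 2])) AtomE"

text \<open>
  The last argument starts as \<open>|S|\<close> and loses 3 for every vertex that is added to \<open>K\<close>; the third one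
  is the part of \<open>S \<union> P\<close> that is not yet covered. One pass suffices because gains only decrease.
\<close>

definition "greedy_body = IfE (Var 0)
  (IfE hd1
    (IfE (CallE 2 [lit 23, CallE 1 [hd0, Var 2]])
      (CallE 18 [tl0, tl1, CallE 4 [Var 2, hd0], SndE (SndE (SndE (Var 3)))])
      (CallE 18 [tl0, tl1, Var 2, Var 3]))
    (CallE 18 [tl0, tl1, Var 2, Var 3]))
  (CallE 2 [Var 3, CallE 1 [Var 2, Var 2]])"

text \<open>The result for the remaining sets is computed first and serves as the accumulator of the
  filter. Only a set that passes both tests is extended by the subsets of \<open>W\<close>.\<close>

definition "loop_body = IfE (Var 2)
  (LetE (CallE 19 [Var 0, Var 1, tl2])
    (IfE (CallE 9 [Var 1, CallE 3 [FstE (Var 3), Var 2], CallE 3 [FstE (Var 3), Var 2]])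
      (IfE (CallE 18 [Var 1, FstE (Var 3), CallE 17 [Var 1, FstE (Var 3), FstE (Var 3)],
          CallE 1 [FstE (Var 3), FstE (Var 3)]])
        (CallE 16 [Var 1, CallE 15 [Var 2, FstE (Var 3)], Var 0]) (Var 0)) (Var 0))) AtomE"

text \<open>The second argument counts the members of \<open>L\<close> still to be skipped, the
  third is its reset value.\<close>

definition "pick_body = IfE (Var 0)
  (IfE hd0
    (IfE (Var 1) (PairE AtomE (CallE 20 [tl0, tl1, Var 2])) (PairE TrueE (CallE 20 [tl0, Var 2, Var 2])))
    (PairE AtomE (CallE 20 [tl0, Var 1, Var 2]))) AtomE"

definition "not_body = IfE (Var 0) (PairE (IfE hd0 AtomE TrueE) (CallE 21 [tl0])) AtomE"

definition "search_body = CallE 19 [Var 0, Var 1, CallE 15 [CallE 21 [Var 1], CallE 5 [Var 1]]]"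

definition prog :: program where
  "prog = [main_body, count_body, le_body, or_body, diff_body, zero_body, first_body, step_body,
    iter_body, dom_body, cds_body, mapcons_body, deletions_body, any_cds_body, mcds_body, gen_body,
    filter_body, amplify_body, greedy_body, loop_body, pick_body, not_body, search_body]"

lemma run_prog:
  "run prog 1 vs = res prog vs count_body" "run prog 2 vs = res prog vs le_body"
  "run prog 3 vs = res prog vs or_body" "run prog 4 vs = res prog vs diff_body"
  "run prog 5 vs = res prog vs zero_body" "run prog 6 vs = res prog vs first_body"
  "run prog 7 vs = res prog vs step_body" "run prog 8 vs = res prog vs iter_body"
  "run prog 9 vs = res prog vs dom_body" "run prog 10 vs = res prog vs cds_body"
  "run prog 11 vs = res prog vs mapcons_body" "run prog 12 vs = res prog vs deletions_body"
  "run prog 13 vs = res prog vs any_cds_body" "run prog 14 vs = res prog vs mcds_body"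
  "run prog 15 vs = res prog vs gen_body" "run prog 16 vs = res prog vs filter_body"
  "run prog 17 vs = res prog vs amplify_body" "run prog 18 vs = res prog vs greedy_body"
  "run prog 19 vs = res prog vs loop_body" "run prog 20 vs = res prog vs pick_body"
  "run prog 21 vs = res prog vs not_body" "run prog 22 vs = res prog vs search_body"
  by (simp_all add: run_def prog_def)

section \<open>Values and costs of the basic subroutines\<close>

definition does :: "nat \<Rightarrow> sexp list \<Rightarrow> sexp \<Rightarrow> nat \<Rightarrow> bool" where
  "does f vs v T \<longleftrightarrow> (\<exists>t\<le>T. run prog f vs = Some (v, t))"

lemma does_mono: "does f vs v T \<Longrightarrow> T \<le> T' \<Longrightarrow> does f vs v T'"
  unfolding does_def by (meson order_trans)

lemma doesE:
  assumes "does f vs v T"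
  obtains t where "t \<le> T" "run prog f vs = Some (v, t)"
  using assms by (auto simp: does_def)

lemma does_count:
  "does 1 [vec zs S, vec zs T] (un (length (filter (\<lambda>v. v \<in> S \<inter> T) zs))) (30 * length zs + 10)"
proof (induction zs)
  case Nil
  show ?case unfolding does_def run_prog count_body_def by (simp add: res_simps un.simps)
next
  case (Cons z zs)
  then obtain t where "t \<le> 30 * length zs + 10"
    "run prog 1 [vec zs S, vec zs T] = Some (un (length (filter (\<lambda>v. v \<in> S \<inter> T) zs)), t)"
    by (rule doesE)
  then show ?case unfolding does_def
    by (subst run_prog) (cases "z \<in> S"; cases "z \<in> T"; simp add: count_body_def res_simps un.simps)
qed

lemma does_le: "does 2 [un a, un b] (enc_bool (a \<le> b)) (20 * a + 20)"
proof (induction a arbitrary: b)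
  case 0
  show ?case unfolding does_def run_prog le_body_def by (simp add: res_simps)
next
  case (Suc a)
  show ?case
  proof (cases b)
    case 0
    then show ?thesis unfolding does_def run_prog le_body_def by (simp add: res_simps)
  next
    case (Suc c)
    obtain t where "t \<le> 20 * a + 20" "run prog 2 [un a, un c] = Some (enc_bool (a \<le> c), t)"
      using Suc.IH by (rule doesE)
    then show ?thesis unfolding does_def Suc
      by (subst run_prog) (simp add: le_body_def res_simps un.simps)
  qed
qed

lemma does_or: "does 3 [vec zs S, vec zs T] (vec zs (S \<union> T)) (30 * length zs + 10)"
proof (induction zs)
  case Nil
  show ?case unfolding does_def run_prog or_body_def by (simp add: res_simps)
next
  case (Cons z zs)
  then obtain t where "t \<le> 30 * length zs + 10"
    "run prog 3 [vec zs S, vec zs T] = Some (vec zs (S \<union> T), t)"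
    by (rule doesE)
  then show ?case unfolding does_def
    by (subst run_prog) (cases "z \<in> S"; cases "z \<in> T"; simp add: or_body_def res_simps)
qed

lemma does_diff: "does 4 [vec zs S, vec zs T] (vec zs (S - T)) (30 * length zs + 10)"
proof (induction zs)
  case Nil
  show ?case unfolding does_def run_prog diff_body_def by (simp add: res_simps)
next
  case (Cons z zs)
  then obtain t where "t \<le> 30 * length zs + 10"
    "run prog 4 [vec zs S, vec zs T] = Some (vec zs (S - T), t)"
    by (rule doesE)
  then show ?case unfolding does_def
    by (subst run_prog) (cases "z \<in> S"; cases "z \<in> T"; simp add: diff_body_def res_simps)
qed

lemma does_zero: "does 5 [vec zs S] (vec zs {}) (30 * length zs + 10)"
proof (induction zs)
  case Nil
  show ?case unfolding does_def run_prog zero_body_def by (simp add: res_simps)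
next
  case (Cons z zs)
  then obtain t where "t \<le> 30 * length zs + 10" "run prog 5 [vec zs S] = Some (vec zs {}, t)"
    by (rule doesE)
  then show ?case unfolding does_def
    by (subst run_prog) (simp add: zero_body_def res_simps)
qed

lemma does_not: "does 21 [vec zs S] (vec zs (- S)) (30 * length zs + 10)"
proof (induction zs)
  case Nil
  show ?case unfolding does_def run_prog not_body_def by (simp add: res_simps)
next
  case (Cons z zs)
  then obtain t where "t \<le> 30 * length zs + 10" "run prog 21 [vec zs S] = Some (vec zs (- S), t)"
    by (rule doesE)
  then show ?case unfolding does_def
    by (subst run_prog) (cases "z \<in> S"; simp add: not_body_def res_simps)
qed

lemma does_first:
  assumes "distinct zs"
  shows "does 6 [vec zs S] (vec zs (set (take 1 (filter (\<lambda>v. v \<in> S) zs)))) (60 * length zs + 20)"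
  using assms
proof (induction zs)
  case Nil
  show ?case unfolding does_def run_prog first_body_def by (simp add: res_simps)
next
  case (Cons z zs)
  show ?case
  proof (cases "z \<in> S")
    case True
    obtain t where t: "t \<le> 30 * length zs + 10" "run prog 5 [vec zs S] = Some (vec zs {}, t)"
      using does_zero by (rule doesE)
    have "vec zs {z} = vec zs {}" using Cons.prems by (intro vec_cong) auto
    then show ?thesis using True t unfolding does_def
      by (subst run_prog) (simp add: first_body_def res_simps)
  next
    case False
    have "distinct zs" using Cons.prems by simp
    from Cons.IH[OF this] obtain t where t: "t \<le> 60 * length zs + 20"
      "run prog 6 [vec zs S] = Some (vec zs (set (take 1 (filter (\<lambda>v. v \<in> S) zs))), t)" by (rule doesE)
    have "z \<notin> set (take 1 (filter (\<lambda>v. v \<in> S) zs))" using Cons.prems by (auto dest: in_set_takeD)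
    then show ?thesis using False t unfolding does_def
      by (subst run_prog) (simp add: first_body_def res_simps)
  qed
qed

lemma does_step:
  "does 7 [mat E zs us, vec us S, vec us R', vec zs R]
    (vec us (R' \<union> {u \<in> S. E `` {u} \<inter> R \<inter> set zs \<noteq> {}})) ((30 * length zs + 60) * length us + 10)"
proof (induction us)
  case Nil
  show ?case unfolding does_def run_prog step_body_def by (simp add: res_simps)
next
  case (Cons u us)
  obtain t where t: "t \<le> (30 * length zs + 60) * length us + 10" "run prog 7 [mat E zs us, vec us S, vec us R', vec zs R] =
    Some (vec us (R' \<union> {u \<in> S. E `` {u} \<inter> R \<inter> set zs \<noteq> {}}), t)" using Cons.IH by (rule doesE)
  obtain k where k: "k \<le> 30 * length zs + 10" "run prog 1 [vec zs (E `` {u}), vec zs R] =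
    Some (un (length (filter (\<lambda>v. v \<in> E `` {u} \<inter> R) zs)), k)" using does_count by (rule doesE)
  have c: "length (filter (\<lambda>v. v \<in> E `` {u} \<inter> R) zs) = 0 \<longleftrightarrow> E `` {u} \<inter> R \<inter> set zs = {}"
    by (auto simp: filter_empty_conv)
  define l where "l = length (filter (\<lambda>v. v \<in> E `` {u} \<inter> R) zs)"
  show ?case using t k c unfolding does_def l_def[symmetric]
    by (subst run_prog) (cases "u \<in> R'"; cases "u \<in> S"; cases "l = 0"; simp add: step_body_def res_simps)
qed

lemma does_iter:
  assumes step_def: "\<And>R. step R = R \<union> {u \<in> S. E `` {u} \<inter> R \<inter> set zs \<noteq> {}}"
  shows "does 8 [enc_list C, mat E zs zs, vec zs S, vec zs R] (vec zs ((step ^^ length C) R))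
    (((30 * length zs + 60) * length zs + 40) * length C + 10)"
proof (induction C arbitrary: R)
  case Nil
  show ?case unfolding does_def run_prog iter_body_def by (simp add: res_simps)
next
  case (Cons c C)
  obtain t where t: "t \<le> ((30 * length zs + 60) * length zs + 40) * length C + 10"
    "run prog 8 [enc_list C, mat E zs zs, vec zs S, vec zs (step R)] = Some (vec zs ((step ^^ length C) (step R)), t)"
    using Cons.IH by (rule doesE)
  obtain k where k: "k \<le> (30 * length zs + 60) * length zs + 10"
    "run prog 7 [mat E zs zs, vec zs S, vec zs R, vec zs R] = Some (vec zs (step R), k)"
    using does_step unfolding step_def by (rule doesE)
  show ?case using t k unfolding does_def
    by (subst run_prog) (simp add: iter_body_def res_simps funpow_swap1)
qed

lemma does_dom:
  "does 9 [mat E zs us, vec us S', vec zs S] (enc_bool (\<forall>u\<in>set us. u \<in> S' \<or> E `` {u} \<inter> S \<inter> set zs \<noteq> {}))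
    ((30 * length zs + 60) * length us + 10)"
proof (induction us)
  case Nil
  show ?case unfolding does_def run_prog dom_body_def by (simp add: res_simps)
next
  case (Cons u us)
  define b where "b \<longleftrightarrow> (\<forall>u\<in>set us. u \<in> S' \<or> E `` {u} \<inter> S \<inter> set zs \<noteq> {})"
  obtain t where t: "t \<le> (30 * length zs + 60) * length us + 10" "run prog 9 [mat E zs us, vec us S', vec zs S] =
    Some (enc_bool b, t)" using Cons.IH unfolding b_def by (rule doesE)
  define l where "l = length (filter (\<lambda>v. v \<in> E `` {u} \<inter> S) zs)"
  obtain k where k: "k \<le> 30 * length zs + 10" "run prog 1 [vec zs (E `` {u}), vec zs S] =
    Some (un l, k)" using does_count unfolding l_def by (rule doesE)
  have c: "E `` {u} \<inter> S \<inter> set zs = {} \<longleftrightarrow> l = 0"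
    by (auto simp: l_def filter_empty_conv)
  have eq: "(\<forall>u\<in>set (u # us). u \<in> S' \<or> E `` {u} \<inter> S \<inter> set zs \<noteq> {}) \<longleftrightarrow> (u \<in> S' \<or> l \<noteq> 0) \<and> b"
    unfolding b_def using c by simp
  show ?case using t k unfolding does_def eq
    by (subst run_prog) (cases "u \<in> S'"; cases "l = 0"; simp add: dom_body_def res_simps)
qed

lemma does_mapcons:
  "does 11 [b, enc_list l, enc_list acc] (enc_list (map (Pair b) l @ acc)) (20 * length l + 10)"
proof (induction l)
  case Nil
  show ?case unfolding does_def run_prog mapcons_body_def by (simp add: res_simps)
next
  case (Cons x l)
  then obtain t where "t \<le> 20 * length l + 10"
    "run prog 11 [b, enc_list l, enc_list acc] = Some (enc_list (map (Pair b) l @ acc), t)" by (rule doesE)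
  then show ?case unfolding does_def
    by (subst run_prog) (simp add: mapcons_body_def res_simps)
qed

text \<open>\<open>N\<close> bounds the length of the whole list, so that the cost per position
  stays the same throughout the induction.\<close>

lemma does_deletions:
  assumes "distinct zs" "length zs \<le> N"
  shows "does 12 [vec zs S] (enc_list (map (\<lambda>v. vec zs (S - {v})) (rev (filter (\<lambda>v. v \<in> S) zs))))
    ((20 * N + 60) * length zs + 10)"
  using assms
proof (induction zs)
  case Nil
  show ?case unfolding does_def run_prog deletions_body_def by (simp add: res_simps)
next
  case (Cons z zs)
  define l where "l = map (\<lambda>v. vec zs (S - {v})) (rev (filter (\<lambda>v. v \<in> S) zs))"
  obtain t where t: "t \<le> (20 * N + 60) * length zs + 10" "run prog 12 [vec zs S] = Some (enc_list l, t)"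
    using Cons unfolding l_def by (auto elim: doesE)
  have len: "length l \<le> N"
    using Cons.prems order_trans[OF length_filter_le[of "\<lambda>v. v \<in> S" zs], of N] by (simp add: l_def)
  define a where "a = (if z \<in> S then [Pair Atom (vec zs S)] else [])"
  obtain k where k: "k \<le> 20 * length l + 10"
    "run prog 11 [enc_bool (z \<in> S), enc_list l, enc_list a] = Some (enc_list (map (Pair (enc_bool (z \<in> S))) l @ a), k)"
    using does_mapcons by (rule doesE)
  have "map (\<lambda>v. vec (z # zs) (S - {v})) (rev (filter (\<lambda>v. v \<in> S) zs)) = map (Pair (enc_bool (z \<in> S))) l"
    using Cons.prems by (auto simp: l_def intro!: arg_cong[where f = enc_bool])
  moreover have "vec zs (S - {z}) = vec zs S" using Cons.prems by (intro vec_cong) auto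
  ultimately have "map (\<lambda>v. vec (z # zs) (S - {v})) (rev (filter (\<lambda>v. v \<in> S) (z # zs)))
    = map (Pair (enc_bool (z \<in> S))) l @ a" by (cases "z \<in> S") (simp_all add: a_def)
  then show ?case using t k len unfolding does_def
    by (subst run_prog) (cases "z \<in> S"; simp add: deletions_body_def res_simps a_def)
qed

lemma does_any_cds:
  assumes "\<And>S. S \<in> set Ss \<Longrightarrow> does 10 [M, vec zs S] (enc_bool (p S)) T"
  shows "does 13 [M, enc_list (map (vec zs) Ss)] (enc_bool (\<exists>S\<in>set Ss. p S)) ((T + 30) * length Ss + 10)"
  using assms
proof (induction Ss)
  case Nil
  show ?case unfolding does_def run_prog any_cds_body_def by (simp add: res_simps)
next
  case (Cons S Ss)
  obtain t where t: "t \<le> (T + 30) * length Ss + 10"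
    "run prog 13 [M, enc_list (map (vec zs) Ss)] = Some (enc_bool (\<exists>S\<in>set Ss. p S), t)"
    using Cons by (auto elim: doesE)
  obtain k where k: "k \<le> T" "run prog 10 [M, vec zs S] = Some (enc_bool (p S), k)"
    using Cons.prems by (auto elim: doesE)
  show ?case using t k unfolding does_def
    by (subst run_prog) (cases "p S"; simp add: any_cds_body_def res_simps)
qed

lemma does_filter:
  assumes "\<And>S. S \<in> set Ss \<Longrightarrow> does 14 [M, vec zs S] (enc_bool (p S)) T"
  shows "does 16 [M, enc_list (map (vec zs) Ss), enc_list acc] (enc_list (map (vec zs) (filter p Ss) @ acc))
    ((T + 40) * length Ss + 10)"
  using assms
proof (induction Ss)
  case Nil
  show ?case unfolding does_def run_prog filter_body_def by (simp add: res_simps)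
next
  case (Cons S Ss)
  obtain t where t: "t \<le> (T + 40) * length Ss + 10"
    "run prog 16 [M, enc_list (map (vec zs) Ss), enc_list acc] = Some (enc_list (map (vec zs) (filter p Ss) @ acc), t)"
    using Cons by (auto elim: doesE)
  obtain k where k: "k \<le> T" "run prog 14 [M, vec zs S] = Some (enc_bool (p S), k)"
    using Cons.prems by (auto elim: doesE)
  show ?case using t k unfolding does_def
    by (subst run_prog) (cases "p S"; simp add: filter_body_def res_simps)
qed

lemma does_amplify:
  "does 17 [mat E zs us, vec us S', vec zs S]
    (vec us (S' \<union> {u. length (filter (\<lambda>v. v \<in> E `` {u} \<inter> S) zs) \<le> 1})) ((50 * length zs + 100) * length us + 10)"
proof (induction us)
  case Nil
  show ?case unfolding does_def run_prog amplify_body_def by (simp add: res_simps)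
next
  case (Cons u us)
  define X where "X = S' \<union> {u. length (filter (\<lambda>v. v \<in> E `` {u} \<inter> S) zs) \<le> 1}"
  obtain t where t: "t \<le> (50 * length zs + 100) * length us + 10" "run prog 17 [mat E zs us, vec us S', vec zs S] =
    Some (vec us X, t)" using Cons.IH unfolding X_def by (rule doesE)
  define l where "l = length (filter (\<lambda>v. v \<in> E `` {u} \<inter> S) zs)"
  obtain k where k: "k \<le> 30 * length zs + 10" "run prog 1 [vec zs (E `` {u}), vec zs S] =
    Some (un l, k)" using does_count unfolding l_def by (rule doesE)
  obtain j where j: "j \<le> 20 * l + 20" "run prog 2 [un l, un 1] = Some (enc_bool (l \<le> 1), j)"
    using does_le by (rule doesE)
  have "l \<le> length zs" by (simp add: l_def)
  moreover have "u \<in> X \<longleftrightarrow> u \<in> S' \<or> l \<le> 1" by (simp add: X_def l_def)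
  ultimately show ?case using t k j unfolding does_def X_def[symmetric]
    by (subst run_prog) (cases "u \<in> S'"; simp add: amplify_body_def res_simps res_lit)
qed


section \<open>Listing the sets that are free on \<open>M\<close> and agree with \<open>B\<close>
  elsewhere\<close>

primrec candidates :: "'v list \<Rightarrow> 'v set \<Rightarrow> 'v set \<Rightarrow> 'v set list" where
  "candidates [] M B = [{}]"
| "candidates (z # zs) M B = (if z \<in> M then map (insert z) (candidates zs M B) @ candidates zs M B
    else if z \<in> B then map (insert z) (candidates zs M B) else candidates zs M B)"

lemma candidates_subset: "S \<in> set (candidates zs M B) \<Longrightarrow> S \<subseteq> set zs"
  by (induction zs arbitrary: S) (fastforce split: if_splits)+

lemma length_candidates: "distinct zs \<Longrightarrow> length (candidates zs M B) = 2 ^ card (M \<inter> set zs)"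
proof (induction zs)
  case (Cons z zs)
  then show ?case by (cases "z \<in> M") (simp_all add: Int_insert_right)
qed simp

lemma mem_candidates:
  "distinct zs \<Longrightarrow> S \<in> set (candidates zs M B) \<longleftrightarrow> S \<subseteq> set zs \<and> (\<forall>v\<in>set zs - M. v \<in> S \<longleftrightarrow> v \<in> B)"
proof (induction zs arbitrary: S)
  case (Cons z zs)
  define X where "X = set (candidates zs M B)"
  have z: "z \<notin> set zs" "distinct zs" using Cons.prems by auto
  have X: "z \<notin> T" if "T \<in> X" for T using candidates_subset that z by (fastforce simp: X_def)
  have ins: "S \<in> insert z ` X \<longleftrightarrow> z \<in> S \<and> S - {z} \<in> X"
  proof
    assume "S \<in> insert z ` X"
    then obtain T where "S = insert z T" "T \<in> X" by blast
    moreover from this have "S - {z} = T" using X by auto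
    ultimately show "z \<in> S \<and> S - {z} \<in> X" by simp
  next
    assume "z \<in> S \<and> S - {z} \<in> X"
    moreover from this have "S = insert z (S - {z})" by blast
    ultimately show "S \<in> insert z ` X" by blast
  qed
  have noins: "S \<in> X \<longleftrightarrow> z \<notin> S \<and> S - {z} \<in> X" using X[of S] by (cases "z \<in> S") auto
  have "S - {z} \<subseteq> set zs \<longleftrightarrow> S \<subseteq> set (z # zs)" by auto
  moreover have "(\<forall>v\<in>set zs - M. v \<in> S - {z} \<longleftrightarrow> v \<in> B) \<longleftrightarrow> (\<forall>v\<in>set zs - M. v \<in> S \<longleftrightarrow> v \<in> B)"
    by (rule ball_cong) (use z in auto)
  ultimately have rest: "S - {z} \<in> X \<longleftrightarrow> S \<subseteq> set (z # zs) \<and> (\<forall>v\<in>set zs - M. v \<in> S \<longleftrightarrow> v \<in> B)"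
    unfolding X_def using Cons.IH[OF z(2), of "S - {z}"] by simp
  have "S \<in> set (candidates (z # zs) M B) \<longleftrightarrow>
    (if z \<in> M then S \<in> insert z ` X \<or> S \<in> X else if z \<in> B then S \<in> insert z ` X else S \<in> X)"
    by (simp add: X_def)
  also have "\<dots> \<longleftrightarrow> S - {z} \<in> X \<and> (z \<in> M \<or> (z \<in> S \<longleftrightarrow> z \<in> B))" using ins noins by auto
  also have "\<dots> \<longleftrightarrow> S \<subseteq> set (z # zs) \<and> (\<forall>v\<in>set (z # zs) - M. v \<in> S \<longleftrightarrow> v \<in> B)"
    unfolding rest by auto
  finally show ?case .
qed auto

lemma distinct_candidates: "distinct zs \<Longrightarrow> distinct (candidates zs M B)"
proof (induction zs)
  case (Cons z zs)
  have z: "z \<notin> S" if "S \<in> set (candidates zs M B)" for S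
    using candidates_subset[OF that] Cons.prems by auto
  have "inj_on (insert z) (set (candidates zs M B))"
    by (rule inj_onI) (metis z insert_ident)
  moreover have "insert z ` set (candidates zs M B) \<inter> set (candidates zs M B) = {}" using z by auto
  ultimately show ?case using Cons by (simp add: distinct_map)
qed simp

text \<open>The cost is charged to the output: each position takes time linear in the current list,
  which is never longer than the final one.\<close>

lemma does_gen:
  assumes "distinct zs"
  shows "does 15 [vec zs M, vec zs B] (enc_list (map (vec zs) (candidates zs M B)))
    ((100 * length zs + 20) * length (candidates zs M B))"
  using assms
proof (induction zs)
  case Nil
  show ?case unfolding does_def run_prog gen_body_def by (simp add: res_simps)
next
  case (Cons z zs)
  define r where "r = candidates zs M B"
  have r1: "length r \<ge> 1" using Cons.prems by (simp add: r_def length_candidates)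
  obtain t where t: "t \<le> (100 * length zs + 20) * length r"
    "run prog 15 [vec zs M, vec zs B] = Some (enc_list (map (vec zs) r), t)"
    using Cons unfolding r_def by (auto elim: doesE)
  have z: "z \<notin> set zs" using Cons.prems by simp
  have ins: "map (vec (z # zs)) (map (insert z) r) = map (Pair (Pair Atom Atom)) (map (vec zs) r)"
  proof -
    have "vec zs (insert z S) = vec zs S" for S using z by (intro vec_cong) auto
    then show ?thesis by simp
  qed
  have noins: "map (vec (z # zs)) r = map (Pair Atom) (map (vec zs) r)"
    using candidates_subset z by (fastforce simp: r_def)
  show ?case
  proof (cases "z \<in> M")
    case True
    obtain j where j: "j \<le> 20 * length (map (vec zs) r) + 10"
      "run prog 11 [Atom, enc_list (map (vec zs) r), enc_list []] = Some (enc_list (map (Pair Atom) (map (vec zs) r) @ []), j)"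
      using does_mapcons by (rule doesE)
    obtain k where k: "k \<le> 20 * length (map (vec zs) r) + 10"
      "run prog 11 [Pair Atom Atom, enc_list (map (vec zs) r), enc_list (map (Pair Atom) (map (vec zs) r) @ [])] =
        Some (enc_list (map (Pair (Pair Atom Atom)) (map (vec zs) r) @ (map (Pair Atom) (map (vec zs) r) @ [])), k)"
      using does_mapcons by (rule doesE)
    have val: "map (vec (z # zs)) (candidates (z # zs) M B) =
      map (Pair (Pair Atom Atom)) (map (vec zs) r) @ (map (Pair Atom) (map (vec zs) r) @ [])"
      using True ins noins by (simp add: r_def)
    have len: "length (candidates (z # zs) M B) = 2 * length r" using True by (simp add: r_def)
    have "t + j + k + 40 \<le> (100 * length (z # zs) + 20) * (2 * length r)"
      using t j k r1 by (simp add: algebra_simps)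
    then show ?thesis using t(2) j(2) k(2) True unfolding does_def val len
      by (subst run_prog) (simp add: gen_body_def res_simps)
  next
    case False
    obtain j where j: "j \<le> 20 * length (map (vec zs) r) + 10"
      "run prog 11 [enc_bool (z \<in> B), enc_list (map (vec zs) r), enc_list []] =
        Some (enc_list (map (Pair (enc_bool (z \<in> B))) (map (vec zs) r) @ []), j)"
      using does_mapcons by (rule doesE)
    have val: "map (vec (z # zs)) (candidates (z # zs) M B) = map (Pair (enc_bool (z \<in> B))) (map (vec zs) r) @ []"
      using False ins noins by (simp add: r_def)
    have len: "length (candidates (z # zs) M B) = length r" using False by (simp add: r_def)
    have "t + j + 40 \<le> (100 * length (z # zs) + 20) * length r"
      using t j r1 by (simp add: algebra_simps)
    then show ?thesis using t(2) j(2) False unfolding does_def val len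
      by (subst run_prog) (simp add: gen_body_def res_simps)
  qed
qed

lemma length_filter_distinct:
  "distinct zs \<Longrightarrow> length (filter (\<lambda>v. v \<in> X) zs) = card (X \<inter> set zs)"
  by (metis distinct_card distinct_filter inf_commute inter_set_filter)

section \<open>The greedy test and the choice of spaced vertices\<close>

text \<open>\<open>K\<close> is the set of accepted vertices. Acceptance requires 23 newly covered
  elements, which gives the lower bound on what \<open>K\<close> covers. A rejected vertex gains
  fewer than 23, and gains only decrease, so after one pass the last property holds for all of
  \<open>S\<close>.\<close>

lemma does_greedy:
  assumes "distinct zs" "distinct us"
  shows "\<exists>K b. does 18 [mat E zs us, vec us S, vec zs A, un c] (enc_bool b)
      ((60 * length zs + 700) * length us + 20 * c + 30 * length zs + 50) \<and>
    K \<subseteq> S \<inter> set us \<and> (b \<longleftrightarrow> c - 3 * card K \<le> card ((A - E `` K) \<inter> set zs)) \<and>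
    23 * card K \<le> card (A \<inter> E `` K \<inter> set zs) \<and>
    (\<forall>x\<in>S \<inter> set us. card (E `` {x} \<inter> (A - E `` K) \<inter> set zs) < 23)"
  using assms(2)
proof (induction us arbitrary: A c)
  case Nil
  define l where "l = card (A \<inter> set zs)"
  have l: "length (filter (\<lambda>v. v \<in> A \<inter> A) zs) = l"
    using length_filter_distinct[OF assms(1), of A] by (simp add: l_def)
  obtain k where k: "k \<le> 30 * length zs + 10" "run prog 1 [vec zs A, vec zs A] = Some (un l, k)"
    using does_count[of zs A A] unfolding l by (rule doesE)
  obtain j where j: "j \<le> 20 * c + 20" "run prog 2 [un c, un l] = Some (enc_bool (c \<le> l), j)"
    using does_le by (rule doesE)
  have "does 18 [mat E zs [], vec [] S, vec zs A, un c] (enc_bool (c \<le> l)) (20 * c + 30 * length zs + 50)"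
    using k j unfolding does_def by (subst run_prog) (simp add: greedy_body_def res_simps)
  then show ?case by (intro exI[of _ "{}"] exI[of _ "c \<le> l"]) (simp add: l_def)
next
  case (Cons u us)
  define l where "l = length (filter (\<lambda>v. v \<in> E `` {u} \<inter> A) zs)"
  obtain k where k: "k \<le> 30 * length zs + 10" "run prog 1 [vec zs (E `` {u}), vec zs A] = Some (un l, k)"
    using does_count unfolding l_def by (rule doesE)
  obtain j where j: "j \<le> 20 * 23 + 20" "run prog 2 [un 23, un l] = Some (enc_bool (23 \<le> l), j)"
    using does_le by (rule doesE)
  have lc: "l = card (E `` {u} \<inter> A \<inter> set zs)" unfolding l_def by (rule length_filter_distinct[OF assms(1)])
  have u: "u \<notin> set us" "distinct us" using Cons.prems by auto
  show ?case
  proof (cases "u \<in> S \<and> 23 \<le> l")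
    case True
    define A1 where "A1 = A - E `` {u}"
    obtain K b where
      d: "does 18 [mat E zs us, vec us S, vec zs A1, un (c - 3)] (enc_bool b)
        ((60 * length zs + 700) * length us + 20 * (c - 3) + 30 * length zs + 50)"
      and K: "K \<subseteq> S \<inter> set us" "b \<longleftrightarrow> c - 3 - 3 * card K \<le> card ((A1 - E `` K) \<inter> set zs)"
        "23 * card K \<le> card (A1 \<inter> E `` K \<inter> set zs)"
        "\<And>x. x \<in> S \<inter> set us \<Longrightarrow> card (E `` {x} \<inter> (A1 - E `` K) \<inter> set zs) < 23"
      using Cons.IH[OF u(2), of A1 "c - 3"] by blast
    obtain t where t: "t \<le> (60 * length zs + 700) * length us + 20 * (c - 3) + 30 * length zs + 50"
      "run prog 18 [mat E zs us, vec us S, vec zs A1, un (c - 3)] = Some (enc_bool b, t)"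
      using d by (rule doesE)
    obtain i where i: "i \<le> 30 * length zs + 10" "run prog 4 [vec zs A, vec zs (E `` {u})] = Some (vec zs A1, i)"
      using does_diff unfolding A1_def by (rule doesE)
    \<comment> \<open>\<open>snd_sexp\<close> maps \<open>Atom\<close> to itself, so dropping three
      cells agrees with truncated subtraction.\<close>
    have c3: "snd_sexp (snd_sexp (snd_sexp (un c))) = un (c - 3)"
    proof -
      have "snd_sexp (un c) = un (c - 1)" for c by (cases c) (simp_all add: un.simps)
      then show ?thesis by (simp add: numeral_3_eq_3)
    qed
    have "does 18 [mat E zs (u # us), vec (u # us) S, vec zs A, un c] (enc_bool b)
      ((60 * length zs + 700) * length (u # us) + 20 * c + 30 * length zs + 50)"
      using t i k j True unfolding does_def
      by (subst run_prog) (simp add: greedy_body_def res_simps res_lit c3)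
    moreover have fK: "finite K" "u \<notin> K" using K(1) u finite_subset by auto
    have A1K: "A1 - E `` K = A - E `` insert u K" by (auto simp: A1_def)
    have "b \<longleftrightarrow> c - 3 * card (insert u K) \<le> card ((A - E `` insert u K) \<inter> set zs)"
      using K(2) fK unfolding A1K by simp
    moreover have "23 * card (insert u K) \<le> card (A \<inter> E `` insert u K \<inter> set zs)"
    proof -
      have "l + card (A1 \<inter> E `` K \<inter> set zs) = card ((E `` {u} \<inter> A \<inter> set zs) \<union> (A1 \<inter> E `` K \<inter> set zs))"
        unfolding lc by (intro card_Un_disjoint[symmetric]) (auto simp: A1_def)
      also have "\<dots> \<le> card (A \<inter> E `` insert u K \<inter> set zs)" by (intro card_mono) (auto simp: A1_def)
      finally show ?thesis using K(3) True fK by simp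
    qed
    moreover have "card (E `` {x} \<inter> (A - E `` insert u K) \<inter> set zs) < 23" if "x \<in> S \<inter> set (u # us)" for x
    proof (cases "x = u")
      case True
      then have "E `` {x} \<inter> (A - E `` insert u K) \<inter> set zs = {}" by auto
      then show ?thesis by simp
    next
      case False
      then show ?thesis using K(4)[of x] that unfolding A1K by simp
    qed
    moreover have "insert u K \<subseteq> S \<inter> set (u # us)" using K True by auto
    ultimately show ?thesis by (intro exI[of _ "insert u K"] exI[of _ b]) blast
  next
    case False
    obtain K b where
      d: "does 18 [mat E zs us, vec us S, vec zs A, un c] (enc_bool b)
        ((60 * length zs + 700) * length us + 20 * c + 30 * length zs + 50)"
      and K: "K \<subseteq> S \<inter> set us" "b \<longleftrightarrow> c - 3 * card K \<le> card ((A - E `` K) \<inter> set zs)"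
        "23 * card K \<le> card (A \<inter> E `` K \<inter> set zs)"
        "\<And>x. x \<in> S \<inter> set us \<Longrightarrow> card (E `` {x} \<inter> (A - E `` K) \<inter> set zs) < 23"
      using Cons.IH[OF u(2), of A c] by blast
    obtain t where t: "t \<le> (60 * length zs + 700) * length us + 20 * c + 30 * length zs + 50"
      "run prog 18 [mat E zs us, vec us S, vec zs A, un c] = Some (enc_bool b, t)"
      using d by (rule doesE)
    have "does 18 [mat E zs (u # us), vec (u # us) S, vec zs A, un c] (enc_bool b)
      ((60 * length zs + 700) * length (u # us) + 20 * c + 30 * length zs + 50)"
      using t k j False unfolding does_def
      by (subst run_prog) (cases "u \<in> S"; simp add: greedy_body_def res_simps res_lit)
    moreover have "card (E `` {x} \<inter> (A - E `` K) \<inter> set zs) < 23" if "x \<in> S \<inter> set (u # us)" for x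
    proof (cases "x = u")
      case True
      have "card (E `` {u} \<inter> (A - E `` K) \<inter> set zs) \<le> l" unfolding lc by (intro card_mono) auto
      then show ?thesis using True False that by auto
    next
      case False
      then show ?thesis using K(4)[of x] that by simp
    qed
    moreover have "K \<subseteq> S \<inter> set (u # us)" using K by auto
    ultimately show ?thesis using K by (intro exI[of _ K] exI[of _ b]) blast
  qed
qed

text \<open>The counter provides the error terms of the induction. Started at \<open>c = m\<close>,
  the two inequalities say that \<open>card W\<close> is the quotient of
  \<open>card (L \<inter> set zs)\<close> by \<open>m + 1\<close>, rounded down.\<close>

lemma does_pick:
  assumes "distinct zs" "c \<le> m"
  shows "\<exists>W. does 20 [vec zs L, un c, un m] (vec zs W) (30 * length zs + 10) \<and> W \<subseteq> L \<inter> set zs \<and>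
    (m + 1) * card W \<le> card (L \<inter> set zs) + (m - c) \<and> card (L \<inter> set zs) \<le> (m + 1) * card W + c"
  using assms
proof (induction zs arbitrary: c)
  case Nil
  have "does 20 [vec [] L, un c, un m] (vec [] {}) (30 * length [] + 10)"
    unfolding does_def run_prog pick_body_def by (simp add: res_simps)
  then show ?case by (intro exI[of _ "{}"]) simp
next
  case (Cons z zs)
  have z: "z \<notin> set zs" "distinct zs" using Cons.prems by auto
  define c' where "c' = (if z \<in> L then (if c = 0 then m else c - 1) else c)"
  have "c' \<le> m" using Cons.prems by (auto simp: c'_def)
  from Cons.IH[OF z(2) this] obtain W where
    d: "does 20 [vec zs L, un c', un m] (vec zs W) (30 * length zs + 10)" and W: "W \<subseteq> L \<inter> set zs"
    and lo: "(m + 1) * card W \<le> card (L \<inter> set zs) + (m - c')"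
    and hi: "card (L \<inter> set zs) \<le> (m + 1) * card W + c'" by blast
  obtain t where t: "t \<le> 30 * length zs + 10" "run prog 20 [vec zs L, un c', un m] = Some (vec zs W, t)"
    using d by (rule doesE)
  have fW: "finite W" "z \<notin> W" using W z finite_subset by auto
  define W' where "W' = (if z \<in> L \<and> c = 0 then insert z W else W)"
  have vW: "vec zs W' = vec zs W" using z by (intro vec_cong) (auto simp: W'_def)
  have "does 20 [vec (z # zs) L, un c, un m] (vec (z # zs) W') (30 * length (z # zs) + 10)"
  proof (cases "z \<in> L \<and> c \<noteq> 0")
    case True
    then obtain b where b: "c = Suc b" using not0_implies_Suc by blast
    have "z \<notin> W'" using True fW by (simp add: W'_def)
    then show ?thesis using t True vW unfolding does_def b
      by (subst run_prog) (simp add: pick_body_def res_simps un.simps c'_def b)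
  next
    case False
    then show ?thesis using t vW fW unfolding does_def
      by (subst run_prog) (cases "z \<in> L"; simp add: pick_body_def res_simps c'_def W'_def)
  qed
  moreover have "W' \<subseteq> L \<inter> set (z # zs)" using W by (auto simp: W'_def)
  moreover have cL: "card (L \<inter> set (z # zs)) = (if z \<in> L then Suc (card (L \<inter> set zs)) else card (L \<inter> set zs))"
    using z by (simp add: Int_insert_right)
  have "(m + 1) * card W' \<le> card (L \<inter> set (z # zs)) + (m - c)"
    using lo fW Cons.prems unfolding cL by (auto simp: W'_def c'_def split: if_splits)
  moreover have "card (L \<inter> set (z # zs)) \<le> (m + 1) * card W' + c"
    using hi fW Cons.prems unfolding cL by (auto simp: W'_def c'_def split: if_splits)
  ultimately show ?case by (intro exI[of _ W']) blast
qed

section \<open>Correctness of the search\<close>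

text \<open>Every round adds a vertex until the search becomes stationary, so \<open>card V\<close>
  rounds suffice.\<close>

lemma (in fin_graph) breadth_first_search:
  assumes S: "S \<subseteq> V" "x \<in> S" and step: "\<And>R. step R = R \<union> {u \<in> S. E `` {u} \<inter> R \<inter> V \<noteq> {}}"
  shows "S \<subseteq> (step ^^ card V) {x} \<longleftrightarrow> conn E S"
proof -
  define Rk where "Rk k = (step ^^ k) {x}" for k
  have Rk_Suc: "Rk (Suc k) = step (Rk k)" for k by (simp add: Rk_def)
  have sound: "Rk k \<subseteq> {v \<in> S. (x, v) \<in> (E \<inter> S \<times> S)\<^sup>*}" for k
  proof (induction k)
    case 0
    show ?case using S by (simp add: Rk_def)
  next
    case (Suc k)
    have "(x, u) \<in> (E \<inter> S \<times> S)\<^sup>*" if "u \<in> S" "v \<in> Rk k" "(u, v) \<in> E" for u v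
    proof -
      have "(x, v) \<in> (E \<inter> S \<times> S)\<^sup>*" "v \<in> S" using Suc that by auto
      then show ?thesis using that E_swap[of u v] by (auto intro: rtrancl.rtrancl_into_rtrancl)
    qed
    then show ?case using Suc by (auto simp: Rk_Suc step)
  qed
  have fin: "finite (Rk k)" "card (Rk k) \<le> card V" for k
    using sound[of k] S finite_subset_V[of "Rk k"] card_mono[OF finite_V, of "Rk k"] by auto
  have grow: "k < card (Rk k) \<or> step (Rk k) = Rk k" for k
  proof (induction k)
    case 0
    show ?case by (simp add: Rk_def)
  next
    case (Suc k)
    show ?case
    proof (cases "step (Rk k) = Rk k")
      case True
      then show ?thesis by (simp add: Rk_Suc)
    next
      case False
      then have "Rk k \<subset> Rk (Suc k)" by (auto simp: Rk_Suc step)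
      then have "card (Rk k) < card (Rk (Suc k))" by (rule psubset_card_mono[OF fin(1)])
      then show ?thesis using Suc False by auto
    qed
  qed
  have fix_step: "step (Rk (card V)) = Rk (card V)" using grow[of "card V"] fin(2)[of "card V"] by auto
  have x: "x \<in> Rk k" for k by (induction k) (auto simp: Rk_Suc step, simp add: Rk_def)
  have complete: "v \<in> Rk (card V)" if "(x, v) \<in> (E \<inter> S \<times> S)\<^sup>*" for v
    using that
  proof (induction rule: rtrancl_induct)
    case base
    show ?case by (rule x)
  next
    case (step a b)
    then have "b \<in> S" "a \<in> E `` {b} \<inter> Rk (card V) \<inter> V" using S E_swap by auto
    then have "b \<in> step (Rk (card V))" unfolding assms(3) by blast
    then show ?case by (simp add: fix_step)
  qed
  show ?thesis unfolding Rk_def[symmetric]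
  proof
    assume a: "S \<subseteq> Rk (card V)"
    show "conn E S" by (rule connI_root[OF S(2)]) (use a sound in blast)
  next
    assume "conn E S"
    then show "S \<subseteq> Rk (card V)" using S complete by (auto simp: conn_def)
  qed
qed

text \<open>The cubic cost comes from the search, with one quadratic round per vertex.\<close>

lemma does_cds:
  assumes G: "fin_graph (set zs) E" and zs: "distinct zs" and S: "S \<subseteq> set zs"
  shows "does 10 [mat E zs zs, vec zs S] (enc_bool (cds (set zs) E S)) (1000 * (length zs + 1) ^ 3)"
proof -
  interpret fin_graph "set zs" E by (rule G)
  define n where "n = length zs"
  define step where "step R = R \<union> {u \<in> S. E `` {u} \<inter> R \<inter> set zs \<noteq> {}}" for R
  define X where "X = set (take 1 (filter (\<lambda>v. v \<in> S) zs))"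
  define R where "R = (step ^^ n) X"
  define d where "d \<longleftrightarrow> (\<forall>u\<in>set zs. u \<in> S \<or> E `` {u} \<inter> S \<inter> set zs \<noteq> {})"
  have fS: "finite S" using S finite_subset by blast
  have nV: "n = card (set zs)" using distinct_card[OF zs] by (simp add: n_def)
  have cS: "length (filter (\<lambda>v. v \<in> S \<inter> S) zs) = card S"
    using length_filter_distinct[OF zs, of S] S by (simp add: Int_absorb2)
  have cR: "length (filter (\<lambda>v. v \<in> S \<inter> R) zs) = card (S \<inter> R)"
    using length_filter_distinct[OF zs, of "S \<inter> R"] S by (simp add: Int_absorb2 le_infI1)
  obtain t1 where t1: "t1 \<le> 30 * n + 10" "run prog 1 [vec zs S, vec zs S] = Some (un (card S), t1)"
    using does_count[of zs S S] unfolding cS n_def by (rule doesE)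
  obtain t2 where t2: "t2 \<le> (30 * n + 60) * n + 10" "run prog 9 [mat E zs zs, vec zs S, vec zs S] = Some (enc_bool d, t2)"
    using does_dom unfolding d_def n_def by (rule doesE)
  obtain t3 where t3: "t3 \<le> 60 * n + 20" "run prog 6 [vec zs S] = Some (vec zs X, t3)"
    using does_first[OF zs] unfolding X_def n_def by (rule doesE)
  obtain t4 where t4: "t4 \<le> ((30 * n + 60) * n + 40) * n + 10"
    "run prog 8 [mat E zs zs, mat E zs zs, vec zs S, vec zs X] = Some (vec zs R, t4)"
    using does_iter[of step S E zs "map (\<lambda>u. vec zs (E `` {u})) zs" X, OF step_def]
    unfolding mat_def[symmetric] R_def n_def length_map by (rule doesE)
  obtain t5 where t5: "t5 \<le> 30 * n + 10" "run prog 1 [vec zs S, vec zs R] = Some (un (card (S \<inter> R)), t5)"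
    using does_count[of zs S R] unfolding cR n_def by (rule doesE)
  obtain t6 where t6: "t6 \<le> 20 * card S + 20"
    "run prog 2 [un (card S), un (card (S \<inter> R))] = Some (enc_bool (card S \<le> card (S \<inter> R)), t6)"
    using does_le by (rule doesE)
  have cSn: "card S \<le> n" using S card_mono[of "set zs" S] by (simp add: nV)
  have d: "d \<longleftrightarrow> set zs - S \<subseteq> E `` S"
  proof
    assume "d" then show "set zs - S \<subseteq> E `` S" unfolding d_def using E_swap by blast
  next
    assume a: "set zs - S \<subseteq> E `` S"
    show d unfolding d_def
    proof
      fix u assume "u \<in> set zs"
      show "u \<in> S \<or> E `` {u} \<inter> S \<inter> set zs \<noteq> {}"
      proof (cases "u \<in> S")
        case False
        then obtain v where "v \<in> S" "(v, u) \<in> E" using a \<open>u \<in> set zs\<close> by blast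
        then show ?thesis using E_swap[of v u] S by blast
      qed simp
    qed
  qed
  have sub: "card S \<le> card (S \<inter> R) \<longleftrightarrow> S \<subseteq> R"
    using card_seteq[OF fS, of "S \<inter> R"] by (auto simp: Int_absorb2)
  have val: "cds (set zs) E S \<longleftrightarrow> card S \<noteq> 0 \<and> d \<and> card S \<le> card (S \<inter> R)"
  proof (cases "S = {}")
    case True
    then show ?thesis by (simp add: cds_def conn_def)
  next
    case False
    then have "filter (\<lambda>v. v \<in> S) zs \<noteq> []" using S by (auto simp: filter_empty_conv)
    then obtain x xs where x: "filter (\<lambda>v. v \<in> S) zs = x # xs" by (cases "filter (\<lambda>v. v \<in> S) zs") auto
    then have "x \<in> set (filter (\<lambda>v. v \<in> S) zs)" by simp
    then have xS: "x \<in> S" by simp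
    have X: "X = {x}" by (simp add: X_def x)
    have "S \<subseteq> R \<longleftrightarrow> conn E S"
      unfolding R_def X nV by (rule breadth_first_search[OF S xS step_def])
    then show ?thesis using S d sub False fS by (auto simp: cds_def)
  qed
  have "t1 + t2 + t1 + t3 + t4 + t5 + t6 + 60 \<le> 1000 * (n + 1) ^ 3"
    using t1(1) t2(1) t3(1) t4(1) t5(1) t6(1) cSn by (simp add: power3_eq_cube algebra_simps)
  then show ?thesis using t1(2) t2(2) t3(2) t4(2) t5(2) t6(2) unfolding does_def val n_def[symmetric]
    by (subst run_prog) (cases "card S = 0"; cases d; simp add: cds_body_def res_simps)
qed

text \<open>By \<open>mcds_iff\<close> only single deletions have to be tested, which adds one
  factor of the number of vertices.\<close>

lemma does_mcds:
  assumes G: "fin_graph (set zs) E" and zs: "distinct zs" and S: "S \<subseteq> set zs"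
  shows "does 14 [mat E zs zs, vec zs S] (enc_bool (mcds (set zs) E S)) (3000 * (length zs + 1) ^ 4)"
proof -
  interpret fin_graph "set zs" E by (rule G)
  define n where "n = length zs"
  define T where "T = 1000 * (n + 1) ^ 3"
  define Ss where "Ss = map (\<lambda>v. S - {v}) (rev (filter (\<lambda>v. v \<in> S) zs))"
  define b where "b \<longleftrightarrow> (\<exists>S\<in>set Ss. cds (set zs) E S)"
  obtain t1 where t1: "t1 \<le> T" "run prog 10 [mat E zs zs, vec zs S] = Some (enc_bool (cds (set zs) E S), t1)"
    using does_cds[OF assms] unfolding T_def n_def by (rule doesE)
  have "map (\<lambda>v. vec zs (S - {v})) (rev (filter (\<lambda>v. v \<in> S) zs)) = map (vec zs) Ss"
    by (simp add: Ss_def)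
  then obtain t2 where t2: "t2 \<le> (20 * n + 60) * n + 10" "run prog 12 [vec zs S] = Some (enc_list (map (vec zs) Ss), t2)"
    using does_deletions[OF zs order_refl, of S] unfolding n_def by (metis doesE)
  have "does 10 [mat E zs zs, vec zs S'] (enc_bool (cds (set zs) E S')) T" if "S' \<in> set Ss" for S'
    unfolding T_def n_def using that S by (intro does_cds[OF G zs]) (auto simp: Ss_def)
  from does_any_cds[of Ss, OF this]
  obtain t3 where t3: "t3 \<le> (T + 30) * length Ss + 10"
    "run prog 13 [mat E zs zs, enc_list (map (vec zs) Ss)] = Some (enc_bool b, t3)"
    unfolding b_def by (rule doesE)
  have len: "length Ss \<le> n" by (simp add: Ss_def n_def)
  have val: "mcds (set zs) E S \<longleftrightarrow> cds (set zs) E S \<and> \<not> b"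
    unfolding mcds_iff b_def using S by (auto simp: Ss_def)
  have "t1 + t2 + t3 + 40 \<le> 3000 * (n + 1) ^ 4"
  proof -
    have "t3 \<le> (T + 30) * n + 10" using t3(1) len by (meson add_right_mono mult_le_mono2 order_trans)
    then have "t1 + t2 + t3 + 40 \<le> T * (n + 1) + (20 * (n * n) + 90 * n + 70)"
      using t1(1) t2(1) by (simp add: algebra_simps)
    also have "T * (n + 1) = 1000 * (n + 1) ^ 4" by (simp add: T_def power4_eq_xxxx power3_eq_cube algebra_simps)
    also have "20 * (n * n) + 90 * n + 70 \<le> 90 * (n + 1) ^ 2" by (simp add: power2_eq_square algebra_simps)
    also have "90 * (n + 1) ^ 2 \<le> 90 * (n + 1) ^ 4" by (intro mult_le_mono2 power_increasing) auto
    finally show ?thesis by simp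
  qed
  then show ?thesis using t1(2) t2(2) t3(2) unfolding does_def val n_def[symmetric]
    by (subst run_prog) (cases "cds (set zs) E S"; cases b; simp add: mcds_body_def res_simps)
qed

text \<open>The cost separates the tests, paid for every set in \<open>Ss\<close>, from the factor
  \<open>2^card (W \<inter> set zs)\<close>, paid only for the sets that pass. The running time
  bound rests on this split.\<close>

lemma does_loop:
  fixes W :: "'v set" and zs :: "'v list"
  assumes zs: "distinct zs"
    and dom: "\<And>S. S \<in> set Ss \<Longrightarrow> does 9 [M, vec zs (S \<union> W), vec zs (S \<union> W)] (enc_bool (d S)) T"
    and amp: "\<And>S. S \<in> set Ss \<Longrightarrow> does 17 [M, vec zs S, vec zs S] (vec zs (A S)) T"
    and gre: "\<And>S. S \<in> set Ss \<Longrightarrow> does 18 [M, vec zs S, vec zs (A S), un (length (filter (\<lambda>v. v \<in> S \<inter> S) zs))] (enc_bool (g S)) T"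
    and mc: "\<And>S S'. S \<in> set Ss \<Longrightarrow> S' \<in> set (candidates zs W S) \<Longrightarrow> does 14 [M, vec zs S'] (enc_bool (p S')) T'"
  shows "does 19 [M, vec zs W, enc_list (map (vec zs) Ss)]
    (enc_list (map (vec zs) (concat (map (\<lambda>S. if d S \<and> g S then filter p (candidates zs W S) else []) Ss))))
    ((3 * T + 90 * length zs + 130) * length Ss
      + (100 * length zs + T' + 100) * 2 ^ card (W \<inter> set zs) * length (filter (\<lambda>S. d S \<and> g S) Ss) + 10)"
  using dom amp gre mc
proof (induction Ss)
  case Nil
  show ?case unfolding does_def run_prog loop_body_def by (simp add: res_simps)
next
  case (Cons S Ss)
  define n where "n = length zs"
  define w where "w = (2::nat) ^ card (W \<inter> set zs)"
  define r where "r = concat (map (\<lambda>S. if d S \<and> g S then filter p (candidates zs W S) else []) Ss)"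
  define c where "c = length (filter (\<lambda>v. v \<in> S \<inter> S) zs)"
  define B where "B = (3 * T + 90 * n + 130) * length Ss + (100 * n + T' + 100) * w * length (filter (\<lambda>S. d S \<and> g S) Ss) + 10"
  have "does 19 [M, vec zs W, enc_list (map (vec zs) Ss)] (enc_list (map (vec zs) r)) B"
    unfolding r_def B_def n_def w_def
  proof (rule Cons.IH)
    fix S1 assume S1: "S1 \<in> set Ss"
    show "does 9 [M, vec zs (S1 \<union> W), vec zs (S1 \<union> W)] (enc_bool (d S1)) T"
      by (rule Cons.prems(1)) (simp add: S1)
    show "does 17 [M, vec zs S1, vec zs S1] (vec zs (A S1)) T"
      by (rule Cons.prems(2)) (simp add: S1)
    show "does 18 [M, vec zs S1, vec zs (A S1), un (length (filter (\<lambda>v. v \<in> S1 \<inter> S1) zs))] (enc_bool (g S1)) T"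
      by (rule Cons.prems(3)) (simp add: S1)
    fix S2 assume S2: "S2 \<in> set (candidates zs W S1)"
    show "does 14 [M, vec zs S2] (enc_bool (p S2)) T'"
      by (rule Cons.prems(4)[OF _ S2]) (simp add: S1)
  qed
  then obtain t where t: "t \<le> B" "run prog 19 [M, vec zs W, enc_list (map (vec zs) Ss)] = Some (enc_list (map (vec zs) r), t)"
    by (rule doesE)
  obtain t1 where t1: "t1 \<le> 30 * n + 10" "run prog 3 [vec zs S, vec zs W] = Some (vec zs (S \<union> W), t1)"
    using does_or unfolding n_def by (rule doesE)
  have S: "S \<in> set (S # Ss)" by simp
  obtain t2 where t2: "t2 \<le> T" "run prog 9 [M, vec zs (S \<union> W), vec zs (S \<union> W)] = Some (enc_bool (d S), t2)"
    using Cons.prems(1)[OF S] by (rule doesE)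
  obtain t3 where t3: "t3 \<le> T" "run prog 17 [M, vec zs S, vec zs S] = Some (vec zs (A S), t3)"
    using Cons.prems(2)[OF S] by (rule doesE)
  obtain t4 where t4: "t4 \<le> T" "run prog 18 [M, vec zs S, vec zs (A S), un c] = Some (enc_bool (g S), t4)"
    using Cons.prems(3)[OF S] unfolding c_def by (rule doesE)
  obtain t5 where t5: "t5 \<le> 30 * n + 10" "run prog 1 [vec zs S, vec zs S] = Some (un c, t5)"
    using does_count unfolding n_def c_def by (rule doesE)
  have w: "length (candidates zs W S) = w" by (simp add: w_def length_candidates[OF zs])
  have w1: "w \<ge> 1" by (simp add: w_def)
  obtain t6 where t6: "t6 \<le> (100 * n + 20) * w"
    "run prog 15 [vec zs W, vec zs S] = Some (enc_list (map (vec zs) (candidates zs W S)), t6)"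
    using does_gen[OF zs, of W S] unfolding n_def w by (rule doesE)
  obtain t7 where t7: "t7 \<le> (T' + 40) * w + 10"
    "run prog 16 [M, enc_list (map (vec zs) (candidates zs W S)), enc_list (map (vec zs) r)] =
      Some (enc_list (map (vec zs) (filter p (candidates zs W S)) @ map (vec zs) r), t7)"
    using does_filter[of "candidates zs W S" M zs p T' "map (vec zs) r", OF Cons.prems(4)[OF S]] unfolding w by (rule doesE)
  let ?B' = "(3 * T + 90 * n + 130) * length (S # Ss) + (100 * n + T' + 100) * w * length (filter (\<lambda>S. d S \<and> g S) (S # Ss)) + 10"
  show ?case
  proof (cases "d S \<and> g S")
    case True
    have "t6 + t7 \<le> (100 * n + T' + 100) * w" using t6(1) t7(1) w1 by (simp add: algebra_simps)
    moreover have "?B' = B + (3 * T + 90 * n + 130) + (100 * n + T' + 100) * w"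
      using True by (simp add: B_def algebra_simps)
    ultimately have "t + 2 * t1 + t2 + t3 + t4 + t5 + t6 + t7 + 80 \<le> ?B'"
      using t(1) t1(1) t2(1) t3(1) t4(1) t5(1) by linarith
    moreover have "map (vec zs) (concat (map (\<lambda>S. if d S \<and> g S then filter p (candidates zs W S) else []) (S # Ss)))
      = map (vec zs) (filter p (candidates zs W S)) @ map (vec zs) r" using True by (simp add: r_def)
    ultimately show ?thesis using t(2) t1(2) t2(2) t3(2) t4(2) t5(2) t6(2) t7(2) True
      unfolding does_def n_def[symmetric] w_def[symmetric]
      by (subst run_prog) (simp add: loop_body_def res_simps del: concat.simps filter.simps)
  next
    case False
    have "?B' = B + (3 * T + 90 * n + 130)" using False by (auto simp: B_def algebra_simps)
    then have "t + 2 * t1 + t2 + t3 + t4 + t5 + 80 \<le> ?B'"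
      using t(1) t1(1) t2(1) t3(1) t4(1) t5(1) by linarith
    moreover have "map (vec zs) (concat (map (\<lambda>S. if d S \<and> g S then filter p (candidates zs W S) else []) (S # Ss)))
      = map (vec zs) r" using False by (auto simp: r_def)
    ultimately show ?thesis using t(2) t1(2) t2(2) t3(2) t4(2) t5(2) False
      unfolding does_def n_def[symmetric] w_def[symmetric]
      by (subst run_prog) (cases "d S"; simp add: loop_body_def res_simps del: concat.simps filter.simps)
  qed
qed


lemma distinct_concat_map:
  assumes "distinct xs" "\<And>x. x \<in> set xs \<Longrightarrow> distinct (f x)"
    "\<And>x y. x \<in> set xs \<Longrightarrow> y \<in> set xs \<Longrightarrow> x \<noteq> y \<Longrightarrow> set (f x) \<inter> set (f y) = {}"
  shows "distinct (concat (map f xs))"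
  using assms
proof (induction xs)
  case (Cons x xs)
  have "distinct (concat (map f xs))" by (rule Cons.IH) (use Cons.prems in auto)
  moreover have "set (f x) \<inter> set (f y) = {}" if "y \<in> set xs" for y
    using Cons.prems that by (intro Cons.prems(3)) auto
  ultimately show ?case using Cons.prems(2)[of x] by auto
qed simp

context fin_graph
begin

section \<open>Soundness and completeness of the search\<close>

text \<open>Let \<open>K\<close> cover \<open>a\<close> elements of \<open>A\<close>, and let
  \<open>P\<close> be the sparse nonmembers. The test gives \<open>a <= 3|K| + |P|\<close> and the
  gains give \<open>23|K| <= a\<close>, hence \<open>20a <= 23|P|\<close>. Any \<open>h\<close>
  covers at most \<open>23|h|\<close> elements beyond these.\<close>

lemma greedy_test_sound:
  assumes S: "S \<subseteq> V" and K: "K \<subseteq> S" and A: "A = S \<union> sparse_nonmembers V E S"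
    and test: "card S - 3 * card K \<le> card (A - E `` K)" and gain: "23 * card K \<le> card (A \<inter> E `` K)"
    and rest: "\<And>x. x \<in> S \<Longrightarrow> card (E `` {x} \<inter> (A - E `` K)) < 23" and h: "h \<subseteq> S"
  shows "20 * card (E `` h \<inter> A) \<le> 460 * card h + 23 * card (sparse_nonmembers V E S)"
proof -
  have fin: "finite S" "finite (sparse_nonmembers V E S)" "finite h"
    using S h finite_V finite_subset_V by (auto simp: sparse_nonmembers_def)
  have fA: "finite A" using fin A by simp
  have cA: "card A = card S + card (sparse_nonmembers V E S)"
    unfolding A using fin by (intro card_Un_disjoint) (auto simp: sparse_nonmembers_def)
  have cA': "card A = card (A \<inter> E `` K) + card (A - E `` K)" by (rule card_Int_Diff[OF fA])
  have "E `` h \<inter> A \<subseteq> (A \<inter> E `` K) \<union> (\<Union>x\<in>h. E `` {x} \<inter> (A - E `` K))" by blast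
  then have "card (E `` h \<inter> A) \<le> card ((A \<inter> E `` K) \<union> (\<Union>x\<in>h. E `` {x} \<inter> (A - E `` K)))"
    using fA fin by (intro card_mono) auto
  also have "\<dots> \<le> card (A \<inter> E `` K) + card (\<Union>x\<in>h. E `` {x} \<inter> (A - E `` K))" by (rule card_Un_le)
  also have "card (\<Union>x\<in>h. E `` {x} \<inter> (A - E `` K)) \<le> (\<Sum>x\<in>h. card (E `` {x} \<inter> (A - E `` K)))"
    by (rule card_UN_le[OF fin(3)])
  also have "\<dots> \<le> (\<Sum>x\<in>h. 23)" using rest h by (intro sum_mono) (meson less_imp_le subsetD)
  finally have "card (E `` h \<inter> A) \<le> card (A \<inter> E `` K) + 23 * card h" by simp
  then show ?thesis using cA cA' test gain by simp
qed

text \<open>Nothing about the greedy choice is involved: every \<open>K\<close> inside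
  \<open>S'\<close> obeys the coverage bound of a minimal set above \<open>S'\<close>. So the test
  never discards the trace of a solution.\<close>

lemma greedy_test_complete:
  assumes S: "mcds V E S" and S': "S' \<subseteq> S" and K: "K \<subseteq> S'" and A: "A = S' \<union> sparse_nonmembers V E S'"
  shows "card S' - 3 * card K \<le> card (A - E `` K)"
proof -
  have fin: "finite S'" "finite (sparse_nonmembers V E S')"
    using S S' finite_V finite_subset_V[of S'] by (auto simp: sparse_nonmembers_def mcds_def cds_def)
  have fA: "finite A" using fin A by simp
  have cA: "card A = card S' + card (sparse_nonmembers V E S')"
    unfolding A using fin by (intro card_Un_disjoint) (auto simp: sparse_nonmembers_def)
  have cA': "card A = card (A \<inter> E `` K) + card (A - E `` K)" by (rule card_Int_Diff[OF fA])
  have "card (A \<inter> E `` K) \<le> 3 * card K + card (sparse_nonmembers V E S')"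
    using mcds_coverage_bound[OF S S' K] unfolding A by (simp add: Int_commute)
  then show ?thesis using cA cA' by simp
qed

end

text \<open>\<open>c\<close> counts the traces off \<open>W\<close> that survive both tests; by
  soundness they satisfy \<open>passing\<close>. By completeness every minimal set extends a
  surviving trace, and it is found exactly once because that trace is unique.\<close>

lemma does_search:
  fixes zs :: "'v list"
  assumes G: "fin_graph (set zs) E" and zs: "distinct zs" and W: "W \<subseteq> set zs"
  shows "\<exists>Ss c. does 22 [mat E zs zs, vec zs W] (enc_list (map (vec zs) Ss))
      (5000 * (length zs + 1) ^ 4 * (2 ^ (length zs - card W) + 2 ^ card W * c + 1)) \<and>
    distinct Ss \<and> set Ss = {S. mcds (set zs) E S} \<and>
    c \<le> card {S \<in> Pow (set zs - W). fin_graph.passing (set zs) E W S}"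
proof -
  interpret fin_graph "set zs" E by (rule G)
  define n where "n = length zs"
  define M where "M = mat E zs zs"
  define T where "T = 1000 * (n + 1) ^ 2"
  define T' where "T' = 3000 * (n + 1) ^ 4"
  define A where "A S = S \<union> {u. length (filter (\<lambda>v. v \<in> E `` {u} \<inter> S) zs) \<le> 1}" for S
  define d where "d S \<longleftrightarrow> (\<forall>u\<in>set zs. u \<in> S \<union> W \<or> E `` {u} \<inter> (S \<union> W) \<inter> set zs \<noteq> {})" for S
  have A: "A S \<inter> set zs = S \<union> sparse_nonmembers (set zs) E S" if "S \<subseteq> set zs" for S
  proof -
    have "length (filter (\<lambda>v. v \<in> E `` {u} \<inter> S) zs) = card (E `` {u} \<inter> S)" for u
      using length_filter_distinct[OF zs, of "E `` {u} \<inter> S"] that by (simp add: Int_absorb2 le_infI2)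
    then show ?thesis using that by (auto simp: A_def sparse_nonmembers_def)
  qed
  have cn: "length (filter (\<lambda>v. v \<in> S \<inter> S) zs) = card S" if "S \<subseteq> set zs" for S
    using length_filter_distinct[OF zs, of S] that by (simp add: Int_absorb2)
  have nV: "n = card (set zs)" using distinct_card[OF zs] by (simp add: n_def)
  have T: "(30 * n + 60) * n + 10 \<le> T" "(50 * n + 100) * n + 10 \<le> T"
    "(60 * n + 700) * n + 20 * n + 30 * n + 50 \<le> T"
    by (simp_all add: T_def power2_eq_square algebra_simps)
  \<comment> \<open>The greedy function yields some \<open>K\<close> and an answer for each
    \<open>S\<close>. Packed in pairs, they become functions of \<open>S\<close> by choice.\<close>
  define good where "good S q \<longleftrightarrow> does 18 [M, vec zs S, vec zs (A S), un (length (filter (\<lambda>v. v \<in> S \<inter> S) zs))] (enc_bool (snd q)) T \<and>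
    fst q \<subseteq> S \<and> (snd q \<longleftrightarrow> card S - 3 * card (fst q) \<le> card ((A S - E `` fst q) \<inter> set zs)) \<and>
    23 * card (fst q) \<le> card (A S \<inter> E `` fst q \<inter> set zs) \<and>
    (\<forall>x\<in>S. card (E `` {x} \<inter> (A S - E `` fst q) \<inter> set zs) < 23)" for S q
  have "\<exists>q. S \<subseteq> set zs \<longrightarrow> good S q" for S
  proof (cases "S \<subseteq> set zs")
    case True
    have Sz: "S \<inter> set zs = S" using True by blast
    obtain K b where K: "does 18 [mat E zs zs, vec zs S, vec zs (A S), un (card S)] (enc_bool b)
      ((60 * length zs + 700) * length zs + 20 * card S + 30 * length zs + 50)"
      "K \<subseteq> S" "b \<longleftrightarrow> card S - 3 * card K \<le> card ((A S - E `` K) \<inter> set zs)"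
      "23 * card K \<le> card (A S \<inter> E `` K \<inter> set zs)"
      "\<forall>x\<in>S. card (E `` {x} \<inter> (A S - E `` K) \<inter> set zs) < 23"
      using does_greedy[OF zs zs, of E S "A S" "card S"] unfolding Sz by (elim exE conjE)
    have "card S \<le> n" using True card_mono[of "set zs" S] by (simp add: nV)
    then have "(60 * length zs + 700) * length zs + 20 * card S + 30 * length zs + 50 \<le> T"
      using T(3) unfolding n_def by linarith
    from does_mono[OF K(1) this] have "good S (K, b)"
      unfolding good_def M_def cn[OF True] using K(2-5) by simp
    then show ?thesis by blast
  qed simp
  then have "\<forall>S. \<exists>q. S \<subseteq> set zs \<longrightarrow> good S q" by (rule allI)
  from choice[OF this] obtain q where q: "\<forall>S. S \<subseteq> set zs \<longrightarrow> good S (q S)" by (rule exE)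
  define g where "g S = snd (q S)" for S
  define K where "K S = fst (q S)" for S
  have gr: "does 18 [M, vec zs S, vec zs (A S), un (length (filter (\<lambda>v. v \<in> S \<inter> S) zs))] (enc_bool (g S)) T"
    and K: "K S \<subseteq> S" "g S \<longleftrightarrow> card S - 3 * card (K S) \<le> card ((A S \<inter> set zs) - E `` K S)"
      "23 * card (K S) \<le> card ((A S \<inter> set zs) \<inter> E `` K S)"
      "\<And>x. x \<in> S \<Longrightarrow> card (E `` {x} \<inter> ((A S \<inter> set zs) - E `` K S)) < 23"
    if S: "S \<subseteq> set zs" for S
  proof -
    have gd: "good S (q S)" using q S by blast
    have eq: "(A S \<inter> set zs) - X = (A S - X) \<inter> set zs" "(A S \<inter> set zs) \<inter> X = A S \<inter> X \<inter> set zs"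
      "Y \<inter> ((A S - X) \<inter> set zs) = Y \<inter> (A S - X) \<inter> set zs" for X Y by blast+
    show "does 18 [M, vec zs S, vec zs (A S), un (length (filter (\<lambda>v. v \<in> S \<inter> S) zs))] (enc_bool (g S)) T"
      using gd unfolding good_def g_def by (rule conjunct1)
    show "K S \<subseteq> S" "g S \<longleftrightarrow> card S - 3 * card (K S) \<le> card ((A S \<inter> set zs) - E `` K S)"
      "23 * card (K S) \<le> card ((A S \<inter> set zs) \<inter> E `` K S)"
      "\<And>x. x \<in> S \<Longrightarrow> card (E `` {x} \<inter> ((A S \<inter> set zs) - E `` K S)) < 23"
      using gd unfolding good_def g_def K_def eq by blast+
  qed
  \<comment> \<open>Free on the complement of \<open>W\<close> and empty on \<open>W\<close>: all
    subsets of \<open>set zs - W\<close>.\<close>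
  define Ss where "Ss = candidates zs (- W) {}"
  have SsV: "S \<subseteq> set zs" if "S \<in> set Ss" for S using candidates_subset that unfolding Ss_def by blast
  have set_Ss: "set Ss = Pow (set zs - W)"
    unfolding Ss_def using mem_candidates[OF zs, of _ "- W" "{}"] by auto
  have dist_Ss: "distinct Ss" unfolding Ss_def by (rule distinct_candidates[OF zs])
  have "- W \<inter> set zs = set zs - W" by blast
  then have len_Ss: "length Ss = 2 ^ (n - card W)"
    unfolding Ss_def using length_candidates[OF zs, of "- W" "{}"] W card_Diff_subset[of W "set zs"] nV
      finite_subset[OF W] by simp
  have mc: "does 14 [M, vec zs S'] (enc_bool (mcds (set zs) E S')) T'" if "S' \<in> set (candidates zs W S)" for S S'
    unfolding M_def T'_def n_def using candidates_subset[OF that] by (rule does_mcds[OF G zs])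
  define ok where "ok S \<longleftrightarrow> d S \<and> g S" for S
  define Rs where "Rs = concat (map (\<lambda>S. if ok S then filter (mcds (set zs) E) (candidates zs W S) else []) Ss)"
  have Wz: "W \<inter> set zs = W" using W by blast
  define c where "c = length (filter ok Ss)"
  have loop: "does 19 [M, vec zs W, enc_list (map (vec zs) Ss)] (enc_list (map (vec zs) Rs))
    ((3 * T + 90 * n + 130) * length Ss + (100 * n + T' + 100) * 2 ^ card W * c + 10)"
  proof -
    have "does 19 [M, vec zs W, enc_list (map (vec zs) Ss)]
      (enc_list (map (vec zs) (concat (map (\<lambda>S. if d S \<and> g S then filter (mcds (set zs) E) (candidates zs W S) else []) Ss))))
      ((3 * T + 90 * length zs + 130) * length Ss
      + (100 * length zs + T' + 100) * 2 ^ card (W \<inter> set zs) * length (filter (\<lambda>S. d S \<and> g S) Ss) + 10)"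
    proof (rule does_loop[OF zs, where A = A])
      fix S assume S: "S \<in> set Ss"
      show "does 9 [M, vec zs (S \<union> W), vec zs (S \<union> W)] (enc_bool (d S)) T"
        unfolding M_def d_def by (rule does_mono[OF does_dom]) (use T(1) in \<open>simp add: n_def\<close>)
      show "does 17 [M, vec zs S, vec zs S] (vec zs (A S)) T"
        unfolding M_def A_def by (rule does_mono[OF does_amplify]) (use T(2) in \<open>simp add: n_def\<close>)
      show "does 18 [M, vec zs S, vec zs (A S), un (length (filter (\<lambda>v. v \<in> S \<inter> S) zs))] (enc_bool (g S)) T"
        by (rule gr[OF SsV[OF S]])
      fix S' assume "S' \<in> set (candidates zs W S)"
      then show "does 14 [M, vec zs S'] (enc_bool (mcds (set zs) E S')) T'" by (rule mc)
    qed
    then show ?thesis unfolding Wz Rs_def ok_def[symmetric] n_def[symmetric] c_def by simp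
  qed
  obtain t1 where t1: "t1 \<le> (3 * T + 90 * n + 130) * length Ss + (100 * n + T' + 100) * 2 ^ card W * c + 10"
    "run prog 19 [M, vec zs W, enc_list (map (vec zs) Ss)] = Some (enc_list (map (vec zs) Rs), t1)"
    using loop by (rule doesE)
  obtain t2 where t2: "t2 \<le> 30 * n + 10" "run prog 21 [vec zs W] = Some (vec zs (- W), t2)"
    using does_not unfolding n_def by (rule doesE)
  obtain t3 where t3: "t3 \<le> 30 * n + 10" "run prog 5 [vec zs W] = Some (vec zs {}, t3)"
    using does_zero unfolding n_def by (rule doesE)
  obtain t4 where t4: "t4 \<le> (100 * n + 20) * length Ss"
    "run prog 15 [vec zs (- W), vec zs {}] = Some (enc_list (map (vec zs) Ss), t4)"
    using does_gen[OF zs] unfolding n_def Ss_def by (rule doesE)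
  define m where "m = (n + 1) ^ 4"
  have m: "1 \<le> m" "n \<le> m" "(n + 1) ^ 2 \<le> m"
  proof -
    show "1 \<le> m" by (simp add: m_def)
    have "(n + 1) ^ 1 \<le> (n + 1) ^ 4" by (rule power_increasing) auto
    then show "n \<le> m" by (simp add: m_def)
    show "(n + 1) ^ 2 \<le> m" unfolding m_def by (rule power_increasing) auto
  qed
  have "t1 + t2 + t3 + t4 + 20 \<le> 5000 * m * (length Ss + 2 ^ card W * c + 1)"
  proof -
    have "3 * T + 90 * n + 130 + (100 * n + 20) \<le> 5000 * m" using m by (simp add: T_def)
    then have "(3 * T + 90 * n + 130 + (100 * n + 20)) * length Ss \<le> 5000 * m * length Ss" by (rule mult_le_mono1)
    moreover have "T' = 3000 * m" by (simp only: T'_def m_def)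
    then have "100 * n + T' + 100 \<le> 5000 * m" using m by linarith
    then have "(100 * n + T' + 100) * (2 ^ card W * c) \<le> 5000 * m * (2 ^ card W * c)" by (rule mult_le_mono1)
    moreover have "60 * n + 50 \<le> 5000 * m" using m by simp
    ultimately show ?thesis using t1(1) t2(1) t3(1) t4(1) by (simp add: algebra_simps)
  qed
  then have "does 22 [M, vec zs W] (enc_list (map (vec zs) Rs)) (5000 * m * (length Ss + 2 ^ card W * c + 1))"
    using t1(2) t2(2) t3(2) t4(2) unfolding does_def
    by (subst run_prog) (simp add: search_body_def res_simps)
  then have run: "does 22 [mat E zs zs, vec zs W] (enc_list (map (vec zs) Rs))
      (5000 * (length zs + 1) ^ 4 * (2 ^ (length zs - card W) + 2 ^ card W * c + 1))"
    by (simp only: M_def m_def len_Ss n_def)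
  \<comment> \<open>An extension determines the set it came from, so lists produced from different
    sets are disjoint.\<close>
  have trace: "S' - W = S" if "S \<in> set Ss" "S' \<in> set (candidates zs W S)" for S S'
  proof -
    have "S' \<subseteq> set zs" "\<forall>v\<in>set zs - W. v \<in> S' \<longleftrightarrow> v \<in> S" "S \<subseteq> set zs - W"
      using that mem_candidates[OF zs, of S' W S] set_Ss by auto
    then show ?thesis by blast
  qed
  have "distinct Rs" unfolding Rs_def
  proof (rule distinct_concat_map[OF dist_Ss])
    fix S show "distinct (if ok S then filter (mcds (set zs) E) (candidates zs W S) else [])"
      using distinct_candidates[OF zs] by simp
  next
    fix S1 S2 assume "S1 \<in> set Ss" "S2 \<in> set Ss" "S1 \<noteq> S2"
    then show "set (if ok S1 then filter (mcds (set zs) E) (candidates zs W S1) else []) \<inter>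
      set (if ok S2 then filter (mcds (set zs) E) (candidates zs W S2) else []) = {}"
      using trace by auto
  qed
  moreover have "set Rs = {S. mcds (set zs) E S}"
  proof (intro set_eqI iffI)
    fix S assume "S \<in> set Rs"
    then show "S \<in> {S. mcds (set zs) E S}" by (auto simp: Rs_def split: if_splits)
  next
    fix S assume "S \<in> {S. mcds (set zs) E S}"
    then have S: "mcds (set zs) E S" by simp
    then have SV: "S \<subseteq> set zs" and SD: "set zs - S \<subseteq> E `` S" by (auto simp: mcds_def cds_def)
    let ?S' = "S - W"
    have S': "?S' \<in> set Ss" "?S' \<subseteq> set zs" using SV set_Ss by auto
    have "d ?S'" unfolding d_def
    proof
      fix u assume "u \<in> set zs"
      show "u \<in> ?S' \<union> W \<or> E `` {u} \<inter> (?S' \<union> W) \<inter> set zs \<noteq> {}"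
      proof (cases "u \<in> S")
        case False
        then obtain v where "v \<in> S" "(v, u) \<in> E" using SD \<open>u \<in> set zs\<close> by blast
        then show ?thesis using E_swap[of v u] SV by blast
      qed blast
    qed
    moreover have "g ?S'" unfolding K(2)[OF S'(2)]
      by (rule greedy_test_complete[OF S _ K(1)[OF S'(2)] A[OF S'(2)]]) blast
    moreover have "S \<in> set (candidates zs W ?S')" using mem_candidates[OF zs] SV by auto
    ultimately show "S \<in> set Rs" unfolding Rs_def ok_def using S S'(1) by auto
  qed
  moreover have "c \<le> card {S \<in> Pow (set zs - W). passing W S}"
  proof -
    have "passing W S" if S: "S \<in> set Ss" "d S" "g S" for S
    proof -
      have SV: "S \<subseteq> set zs" by (rule SsV[OF S(1)])
      have "set zs - (S \<union> W) \<subseteq> E `` (S \<union> W)" using S(2) E_swap unfolding d_def by blast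
      moreover have "20 * card (E `` h \<inter> (A S \<inter> set zs)) \<le> 460 * card h + 23 * card (sparse_nonmembers (set zs) E S)"
        if h: "h \<subseteq> S" for h
        by (rule greedy_test_sound[OF SV K(1)[OF SV] A[OF SV] _ K(3)[OF SV] K(4)[OF SV] h])
          (use K(2)[OF SV] S(3) in simp_all)
      ultimately show ?thesis unfolding passing_def A[OF SV] by blast
    qed
    then have "set (filter ok Ss) \<subseteq> {S \<in> Pow (set zs - W). passing W S}" using set_Ss by (auto simp: ok_def)
    then have "card (set (filter ok Ss)) \<le> card {S \<in> Pow (set zs - W). passing W S}"
      by (intro card_mono) auto
    then show ?thesis unfolding c_def using distinct_card[of "filter ok Ss"] dist_Ss by simp
  qed
  ultimately show ?thesis using run by blast
qed

section \<open>Running time and number of minimal connected dominating sets\<close>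

lemma run_main_body:
  assumes G: "fin_graph {0..<n} E" and L: "L \<subseteq> {0..<n}"
  shows "\<exists>W Ss c t. eval prog [Pair (mat E [0..<n] [0..<n]) (Pair (vec [0..<n] L) rest)] main_body
      (enc_list (map (vec [0..<n]) Ss)) t \<and>
    t \<le> 300000 * (n + 1) ^ 4 * (2 ^ (n - card W) + 2 ^ card W * c + 1) \<and>
    W \<subseteq> L \<and> 100000 * card W \<le> card L \<and> card L \<le> 100000 * card W + 99999 \<and>
    distinct Ss \<and> set Ss = {S. mcds {0..<n} E S} \<and>
    c \<le> card {S \<in> Pow ({0..<n} - W). fin_graph.passing {0..<n} E W S}"
proof -
  define zs where "zs = [0..<n]"
  have zs: "distinct zs" "set zs = {0..<n}" "length zs = n" by (simp_all add: zs_def)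
  have Lz: "L \<inter> set zs = L" using L zs by blast
  obtain W where pick: "does 20 [vec zs L, un 99999, un 99999] (vec zs W) (30 * length zs + 10)"
    and W: "W \<subseteq> L" and lo: "(99999 + 1) * card W \<le> card L + (99999 - 99999)"
    and hi: "card L \<le> (99999 + 1) * card W + 99999"
    using does_pick[where c = 99999 and m = 99999 and L = L, OF zs(1) order_refl] unfolding Lz by (elim exE conjE)
  have Wz: "W \<subseteq> set zs" using W L zs by blast
  obtain Ss c where search: "does 22 [mat E zs zs, vec zs W] (enc_list (map (vec zs) Ss))
      (5000 * (length zs + 1) ^ 4 * (2 ^ (length zs - card W) + 2 ^ card W * c + 1))"
    and Ss: "distinct Ss" "set Ss = {S. mcds (set zs) E S}"
    and c: "c \<le> card {S \<in> Pow (set zs - W). fin_graph.passing (set zs) E W S}"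
    using does_search[of zs E W] G zs(1) Wz unfolding zs(2) by blast
  obtain t1 where t1: "t1 \<le> 30 * n + 10" "run prog 20 [vec zs L, un 99999, un 99999] = Some (vec zs W, t1)"
    using pick unfolding zs(3) by (rule doesE)
  define X where "X = (n + 1) ^ 4 * (2 ^ (n - card W) + 2 ^ card W * c + 1)"
  obtain t2 where t2: "t2 \<le> 5000 * X" "run prog 22 [mat E zs zs, vec zs W] = Some (enc_list (map (vec zs) Ss), t2)"
    using search unfolding zs(3) X_def mult.assoc by (rule doesE)
  have "n + 1 \<le> X"
  proof -
    have "(n + 1) ^ 1 * 1 \<le> X" unfolding X_def by (intro mult_le_mono power_increasing) auto
    then show ?thesis by simp
  qed
  \<comment> \<open>The literal 99999 costs 199999 units, which is almost the whole
    constant.\<close>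
  moreover obtain t where t: "t \<le> t1 + t2 + 200100"
    "res prog [Pair (mat E zs zs) (Pair (vec zs L) rest)] main_body = Some (enc_list (map (vec zs) Ss), t)"
    using t1(2) t2(2) by (simp add: main_body_def res_simps res_lit)
  ultimately have "t \<le> 300000 * X" using t1(1) t2(1) by linarith
  then show ?thesis using t(2) W lo hi Ss c unfolding res_eq_Some zs(2) X_def mult.assoc[symmetric] zs_def
    by (intro exI[of _ W] exI[of _ Ss] exI[of _ c] exI[of _ t]) simp
qed

section \<open>Transfer to the graphs of the library\<close>

lemma pair_graph_fin_graph:
  assumes "pair_graph G"
  shows "fin_graph (pverts G) (parcs G)"
proof -
  interpret pair_graph G by (rule assms)
  show ?thesis
  proof
    show "finite (pverts G)" by (rule pair_finite_verts)
    show "parcs G \<subseteq> pverts G \<times> pverts G" using in_arcsD1 in_arcsD2 by auto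
    show "sym (parcs G)" using pair_sym_arcs by (simp add: symmetric_def)
    show "(v, v) \<notin> parcs G" for v using pair_no_loops by force
  qed
qed

text \<open>The library uses the symmetric closure of the arcs and a reflexive closure relative to
  the vertex set. For symmetric arcs and endpoints in \<open>S\<close> both agree with plain
  reachability.\<close>

lemma connected_induced_iff_conn:
  assumes "pair_graph G"
  shows "Digraph_Component.connected (with_proj G \<restriction> S) \<longleftrightarrow> conn (parcs G) S"
proof -
  interpret fin_graph "pverts G" "parcs G" by (rule pair_graph_fin_graph[OF assms])
  have ends: "arcs_ends (with_proj G \<restriction> S) = parcs G \<inter> S \<times> S"
    by (auto simp: arcs_ends_def arc_to_ends_def)
  have sym: "(parcs G \<inter> S \<times> S)\<^sup>s = parcs G \<inter> S \<times> S"
    using E_swap by (auto simp: symcl_def)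
  have "(u, v) \<in> rtrancl_on S (parcs G \<inter> S \<times> S) \<longleftrightarrow> (u, v) \<in> (parcs G \<inter> S \<times> S)\<^sup>*"
    if "u \<in> S" "v \<in> S" for u v
  proof
    assume "(u, v) \<in> (parcs G \<inter> S \<times> S)\<^sup>*"
    then show "(u, v) \<in> rtrancl_on S (parcs G \<inter> S \<times> S)"
      by (rule rtrancl_consistent_rtrancl_on) (use that in auto)
  qed (rule rtrancl_on_rtranclI)
  then show ?thesis unfolding connected_conv ends sym by (simp add: conn_def)
qed

lemma minimal_cds_iff_mcds:
  assumes "pair_graph G"
  shows "minimal_connected_dominating_set G S \<longleftrightarrow> mcds (pverts G) (parcs G) S"
proof -
  interpret fin_graph "pverts G" "parcs G" by (rule pair_graph_fin_graph[OF assms])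
  have dom: "dominating_set G T \<longleftrightarrow> T \<subseteq> pverts G \<and> pverts G - T \<subseteq> parcs G `` T" for T
    unfolding dominating_set_def using E_swap by blast
  have "connected_dominating_set G T \<longleftrightarrow> cds (pverts G) (parcs G) T" for T
    unfolding connected_dominating_set_def cds_def dom connected_induced_iff_conn[OF assms] by blast
  then show ?thesis by (simp add: minimal_connected_dominating_set_def mcds_def)
qed

section \<open>Final numerical bounds\<close>

lemma exp_minus_le_powr: "x \<ge> 0 \<Longrightarrow> exp (- x) \<le> 2 powr (- x)" for x :: real
proof -
  assume "x \<ge> 0"
  have "ln (2::real) \<le> 1" using ln_le_minus_one[of "2::real"] by simp
  then have "- x \<le> - x * ln 2" using \<open>x \<ge> 0\<close> by (simp add: mult_left_le)
  then show ?thesis by (simp add: powr_def)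
qed

lemma LHR_passing_count:
  assumes G: "pair_graph G" and P: "LHR_partition G L H R" and W: "W \<subseteq> L" "50000 * card W \<le> card (pverts G)"
    and n: "card (pverts G) > 0"
  shows "real (card {S \<in> Pow (pverts G - W). fin_graph.passing (pverts G) (parcs G) W S})
    \<le> 2 ^ card (pverts G - W) * 2 powr (- (real (card (pverts G)) / 10 ^ 38))"
proof -
  interpret fin_graph "pverts G" "parcs G" by (rule pair_graph_fin_graph[OF G])
  have "real (card (pverts G)) \<le> real (60 * card L)" "real (10 ^ 4 * card H) \<le> real (card (pverts G))"
    using P by (simp_all add: LHR_partition_def)
  then have cards: "card (pverts G) \<le> 60 * card L" "10 ^ 4 * card H \<le> card (pverts G)"
    unfolding of_nat_le_iff .
  have "real (card {S \<in> Pow (pverts G - W). passing W S})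
    \<le> 2 ^ card (pverts G - W) * exp (- (real (card (pverts G)) / 10 ^ 38))"
  proof (rule passing_count[of L H W])
    fix v assume "v \<in> L"
    moreover have "parcs G `` {v} = {u. (v, u) \<in> parcs G}" by auto
    ultimately show "card (parcs G `` {v} - H) < 14" using P by (simp add: LHR_partition_def)
  qed (use P W n cards in \<open>auto simp: LHR_partition_def\<close>)
  also have "\<dots> \<le> 2 ^ card (pverts G - W) * 2 powr (- (real (card (pverts G)) / 10 ^ 38))"
    by (intro mult_left_mono exp_minus_le_powr) auto
  finally show ?thesis .
qed

lemma mcds_count_bound:
  assumes G: "pair_graph G" and P: "LHR_partition G L H R"
  shows "real (card {S. minimal_connected_dominating_set G S})
    \<le> 2 powr (real (card (pverts G)) * (1 - 1 / 10 ^ 50))"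
proof -
  interpret fin_graph "pverts G" "parcs G" by (rule pair_graph_fin_graph[OF G])
  define n where "n = real (card (pverts G))"
  let ?M = "{S. mcds (pverts G) (parcs G) S}"
  have M: "{S. minimal_connected_dominating_set G S} = ?M" by (simp add: minimal_cds_iff_mcds[OF G])
  consider "pverts G = {}" | "pverts G \<noteq> {}" "n \<le> 10 ^ 50" | "pverts G \<noteq> {}" "n > 10 ^ 50" by linarith
  then have "real (card ?M) \<le> 2 powr (n * (1 - 1 / 10 ^ 50))"
  proof cases
    case 1
    then have "?M = {}" by (auto simp: mcds_def cds_def conn_def)
    then show ?thesis by simp
  next
    case 2
    \<comment> \<open>Here \<open>n / 10^50 <= 1\<close>, so saving a factor of two is
      enough.\<close>
    have "real (2 * card ?M) \<le> real (2 ^ card (pverts G))"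
      using mcds_count_half[OF 2(1)] by (rule of_nat_mono)
    then have "real (card ?M) \<le> 2 powr n / 2" by (simp add: n_def powr_realpow)
    also have "\<dots> = 2 powr (n - 1)" by (simp add: powr_diff)
    also have "\<dots> \<le> 2 powr (n * (1 - 1 / 10 ^ 50))"
      using 2 by (intro powr_mono) (simp_all add: field_simps)
    finally show ?thesis .
  next
    case 3
    have n0: "card (pverts G) > 0" using 3 finite_V by (simp add: card_gt_0_iff)
    have "?M \<subseteq> {S \<in> Pow (pverts G - {}). passing {} S}"
      using mcds_passing by (auto simp: mcds_def cds_def)
    then have "real (card ?M) \<le> real (card {S \<in> Pow (pverts G - {}). passing {} S})"
      using finite_V by (intro of_nat_mono card_mono) auto
    also have "\<dots> \<le> 2 ^ card (pverts G - {}) * 2 powr (- (real (card (pverts G)) / 10 ^ 38))"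
      by (rule LHR_passing_count[OF G P _ _ n0]) auto
    also have "\<dots> = 2 powr (n + - (n / 10 ^ 38))"
      unfolding n_def powr_add by (simp add: powr_realpow)
    also have "\<dots> \<le> 2 powr (n * (1 - 1 / 10 ^ 50))"
      using 3 by (intro powr_mono) (simp_all add: field_simps)
    finally show ?thesis .
  qed
  then show ?thesis by (simp only: M n_def)
qed

text \<open>The terms are the subsets off \<open>W\<close>, the extensions of the surviving ones,
  and an overhead. For large \<open>n\<close> the set \<open>W\<close> has at least
  \<open>n / 10^50\<close> members, and survival saves \<open>n / 10^38\<close> in the exponent. For
  \<open>n <= 10^50\<close> the target power is at least half of \<open>2^n\<close>.\<close>

lemma search_space_bound:
  fixes n w c :: nat
  assumes w: "w \<le> n" "real n \<le> 60 * (100000 * real w + 99999)"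
    and c: "real c \<le> 2 ^ (n - w)" "n > 0 \<Longrightarrow> real c \<le> 2 ^ (n - w) * 2 powr (- (real n / 10 ^ 38))"
  shows "2 ^ (n - w) + 2 ^ w * real c + 1 \<le> 6 * 2 powr (real n * (1 - 1 / 10 ^ 50))"
proof -
  define B where "B = 2 powr (real n * (1 - 1 / 10 ^ 50))"
  have B1: "1 \<le> B" unfolding B_def by (rule ge_one_powr_ge_zero) auto
  have pw: "2 ^ w * 2 ^ (n - w) = (2::real) ^ n" using w by (simp flip: power_add)
  show ?thesis
  proof (cases "real n \<le> 10 ^ 50")
    case True
    have "(2::real) ^ n = 2 powr real n" by (simp add: powr_realpow)
    also have "\<dots> \<le> 2 powr (1 + real n * (1 - 1 / 10 ^ 50))"
      using True by (intro powr_mono) (simp_all add: field_simps)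
    also have "\<dots> = 2 * B" by (simp only: powr_add B_def) simp
    finally have nB: "(2::real) ^ n \<le> 2 * B" .
    have "(2::real) ^ (n - w) \<le> 2 ^ n" by (intro power_increasing) auto
    moreover have "2 ^ w * real c \<le> 2 ^ w * 2 ^ (n - w)" using c(1) by (intro mult_left_mono) auto
    ultimately show ?thesis using nB B1 pw unfolding B_def[symmetric] by linarith
  next
    case False
    then have n0: "n > 0" by (cases n) auto
    have "(2::real) ^ (n - w) = 2 powr (real n - real w)"
      using w by (simp add: of_nat_diff flip: powr_realpow)
    also have "\<dots> \<le> B" unfolding B_def
    proof (rule powr_mono)
      \<comment> \<open>\<open>w\<close> is at least \<open>n / (6 * 10^6) - 1\<close>, and the
        rounding loss is negligible for \<open>n > 10^50\<close>.\<close>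
      have "real n / 10 ^ 50 \<le> real w" using w(2) False by simp
      then show "real n - real w \<le> real n * (1 - 1 / 10 ^ 50)" by (simp add: right_diff_distrib)
    qed simp
    finally have 1: "(2::real) ^ (n - w) \<le> B" .
    have "2 ^ w * real c \<le> 2 ^ w * (2 ^ (n - w) * 2 powr (- (real n / 10 ^ 38)))"
      using c(2)[OF n0] by (intro mult_left_mono) auto
    also have "\<dots> = 2 ^ n * 2 powr (- (real n / 10 ^ 38))" using pw by (simp only: mult.assoc[symmetric])
    also have "\<dots> = 2 powr (real n + - (real n / 10 ^ 38))"
      unfolding powr_add by (simp add: powr_realpow)
    also have "\<dots> \<le> B" unfolding B_def by (intro powr_mono) (simp_all add: field_simps)
    finally have 2: "2 ^ w * real c \<le> B" .
    show ?thesis using 1 2 B1 unfolding B_def[symmetric] by linarith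
  qed
qed

lemma enumeration_time_bound:
  assumes G: "pair_graph G" and V: "pverts G = {0..<n}" and P: "LHR_partition G L H R"
  shows "\<exists>y t. runs_in_time prog (enc_input n G L H R) y t
    \<and> enumeration_of n {S. minimal_connected_dominating_set G S} y
    \<and> real t \<le> 2 powr (real n * (1 - 1 / 10 ^ 50)) * (real 1800000 * real (n + 1) ^ 4)"
proof -
  have fg: "fin_graph {0..<n} (parcs G)" using pair_graph_fin_graph[OF G] by (simp only: V)
  have L: "L \<subseteq> {0..<n}" using P V by (auto simp: LHR_partition_def)
  have M: "{S. minimal_connected_dominating_set G S} = {S. mcds {0..<n} (parcs G) S}"
    using minimal_cds_iff_mcds[OF G] V by simp
  have vec: "vec [0..<n] = enc_set n" by (rule ext) (simp add: vec_def enc_set_def)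
  have "{v. (u, v) \<in> parcs G} = parcs G `` {u}" for u by auto
  then have inp: "enc_input n G L H R = Pair (mat (parcs G) [0..<n] [0..<n]) (Pair (vec [0..<n] L)
    (enc_list [enc_set n H, enc_set n R]))"
    by (simp add: enc_input_def mat_def vec)
  obtain W Ss c t where t: "eval prog [enc_input n G L H R] main_body (enc_list (map (vec [0..<n]) Ss)) t"
      "t \<le> 300000 * (n + 1) ^ 4 * (2 ^ (n - card W) + 2 ^ card W * c + 1)"
    and W: "W \<subseteq> L" "100000 * card W \<le> card L" "card L \<le> 100000 * card W + 99999"
    and Ss: "distinct Ss" "set Ss = {S. mcds {0..<n} (parcs G) S}"
    and c: "c \<le> card {S \<in> Pow ({0..<n} - W). fin_graph.passing {0..<n} (parcs G) W S}"
    using run_main_body[OF fg L] unfolding inp by blast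
  have "runs_in_time prog (enc_input n G L H R) (enc_list (map (enc_set n) Ss)) t"
    using t(1) unfolding runs_in_time_def vec by (simp add: prog_def)
  moreover have "enumeration_of n {S. minimal_connected_dominating_set G S} (enc_list (map (enc_set n) Ss))"
    unfolding enumeration_of_def M using Ss by blast
  moreover have "real t \<le> 2 powr (real n * (1 - 1 / 10 ^ 50)) * (real 1800000 * real (n + 1) ^ 4)"
  proof -
    have cL: "card L \<le> n" using L card_mono[of "{0..<n}" L] by simp
    have WV: "W \<subseteq> {0..<n}" using W L by blast
    then have cW: "card ({0..<n} - W) = n - card W" by (simp add: card_Diff_subset finite_subset)
    have wn: "card W \<le> n" "50000 * card W \<le> n" using W cL by linarith+
    have "real n \<le> 60 * real (card L)" using P V by (simp add: LHR_partition_def)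
    moreover have "real (card L) \<le> real (100000 * card W + 99999)" using W(3) by (rule of_nat_mono)
    ultimately have low: "real n \<le> 60 * (100000 * real (card W) + 99999)" by simp
    have c1: "real c \<le> 2 ^ (n - card W)"
    proof -
      have "card {S \<in> Pow ({0..<n} - W). fin_graph.passing {0..<n} (parcs G) W S} \<le> card (Pow ({0..<n} - W))"
        by (intro card_mono) auto
      then have "c \<le> 2 ^ (n - card W)" using c by (simp add: card_Pow cW)
      then have "real c \<le> real (2 ^ (n - card W))" by (rule of_nat_mono)
      then show ?thesis by simp
    qed
    have c2: "real c \<le> 2 ^ (n - card W) * 2 powr (- (real n / 10 ^ 38))" if "n > 0"
    proof -
      have "real c \<le> real (card {S \<in> Pow (pverts G - W). fin_graph.passing (pverts G) (parcs G) W S})"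
        using c by (simp only: V of_nat_le_iff)
      also have "\<dots> \<le> 2 ^ card (pverts G - W) * 2 powr (- (real (card (pverts G)) / 10 ^ 38))"
        by (rule LHR_passing_count[OF G P W(1)]) (use wn that V in simp_all)
      finally show ?thesis by (simp add: V cW)
    qed
    have "real t \<le> real (300000 * (n + 1) ^ 4 * (2 ^ (n - card W) + 2 ^ card W * c + 1))"
      using t(2) by (rule of_nat_mono)
    also have "\<dots> = 300000 * real (n + 1) ^ 4 * (2 ^ (n - card W) + 2 ^ card W * real c + 1)"
      by (simp add: algebra_simps)
    \<comment> \<open>The final constant is \<open>1800000 = 6 * 300000\<close>.\<close>
    also have "\<dots> \<le> 300000 * real (n + 1) ^ 4 * (6 * 2 powr (real n * (1 - 1 / 10 ^ 50)))"
      by (intro mult_left_mono search_space_bound[OF wn(1) low c1 c2]) auto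
    finally show ?thesis by (simp add: mult_ac)
  qed
  ultimately show ?thesis by blast
qed

theorem lemma6:
  shows "(\<forall>(G :: 'a pair_pre_digraph) L H R.
            pair_graph G \<and> LHR_partition G L H R \<longrightarrow>
            real (card {S. minimal_connected_dominating_set G S})
              \<le> 2 powr (real (card (pverts G)) * (1 - 1 / 10 ^ 50)))
       \<and> (\<exists>(P :: program) (c :: nat) (d :: nat).
            \<forall>(n :: nat) (G :: nat pair_pre_digraph) L H R.
            pair_graph G \<and> pverts G = {0..<n} \<and> LHR_partition G L H R \<longrightarrow>
            (\<exists>y t. runs_in_time P (enc_input n G L H R) y t
              \<and> enumeration_of n {S. minimal_connected_dominating_set G S} y
              \<and> real t \<le> 2 powr (real n * (1 - 1 / 10 ^ 50)) * (real c * real (n + 1) ^ d)))"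
proof (rule conjI)
  show "\<forall>(G :: 'a pair_pre_digraph) L H R. pair_graph G \<and> LHR_partition G L H R \<longrightarrow>
      real (card {S. minimal_connected_dominating_set G S})
        \<le> 2 powr (real (card (pverts G)) * (1 - 1 / 10 ^ 50))"
    by (intro allI impI, elim conjE) (rule mcds_count_bound)
  show "\<exists>(P :: program) (c :: nat) (d :: nat).
      \<forall>(n :: nat) (G :: nat pair_pre_digraph) L H R.
      pair_graph G \<and> pverts G = {0..<n} \<and> LHR_partition G L H R \<longrightarrow>
      (\<exists>y t. runs_in_time P (enc_input n G L H R) y t
        \<and> enumeration_of n {S. minimal_connected_dominating_set G S} y
        \<and> real t \<le> 2 powr (real n * (1 - 1 / 10 ^ 50)) * (real c * real (n + 1) ^ d))"
    by (rule exI[of _ prog], rule exI[of _ 1800000], rule exI[of _ 4], intro allI impI, elim conjE)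
      (rule enumeration_time_bound)
qed

end
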